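(* Let $M$ be a smooth manifold, $n\ge1$, and let $\pi\in\mathfrak{X}^{n+1}(M)$ be an $(n+1)$-vector field. Then the graph $\mathfrak{G}_\pi\subset TM\oplus\wedge^nT^*M$ of $\pi^\sharp$ is closed under the higher-order Dorfman bracket $\{\cdot,\cdot\}$ if and only if $\pi$ is a Nambu-Poisson structure (of order $n$).
   Context: $\mathfrak{X}^{n+1}(M)$ denotes the space of $(n+1)$-vector fields on $M$. The bundle map $\pi^\sharp:\wedge^nT^*M\to TM$ is $\pi^\sharp(\xi)=i_\xi\pi$, so that $\pi^\sharp(\xi_1\wedge\cdots\wedge\xi_n)=\pi(\xi_1,\dots,\xi_n,\cdot)$ for 1-forms $\xi_i$. Its graph is $\mathfrak{G}_\pi=\{\pi^\sharp(\alpha)+\alpha:\alpha\in\wedge^nT^*M\}$; "closed under the bracket" means that the bracket of two sections of $\mathfrak{G}_\pi$ is a section of $\mathfrak{G}_\pi$. The higher-order Dorfman bracket on $\Gamma(TM\oplus\wedge^nT^*M)$ is $$\{X+\alpha,Y+\beta\}=[X,Y]+L_X\beta-L_Y\alpha+d\,i_Y\alpha$$ for vector fields $X,Y$ and $\alpha,\beta\in\Omega^n(M)$. A Nambu-Poisson structure of order $n$ on $M$ is an $(n+1)$-linear map $\{\cdot,\dots,\cdot\}:C^\infty(M)^{n+1}\to C^\infty(M)$ that is skew-symmetric, satisfies the Leibniz rule $\{f_1g,f_2,\dots,f_{n+1}\}=f_1\{g,f_2,\dots,f_{n+1}\}+g\{f_1,\dots,f_{n+1}\}$, and satisfies the integrability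 condition $$\{f_1,\dots,f_n,\{g_1,\dots,g_{n+1}\}\}=\sum_{i=1}^{n+1}\{g_1,\dots,\{f_1,\dots,f_n,g_i\},\dots,g_{n+1}\}.$$ Such a bracket is determined by an $(n+1)$-vector field $\pi$ via $\{f_1,\dots,f_{n+1}\}=\pi(df_1,\dots,df_{n+1})$, and an $(n+1)$-vector field $\pi$ is called a Nambu-Poisson structure of order $n$ if the bracket it so defines is one; equivalently, $L_{\pi^\sharp(df_1\wedge\cdots\wedge df_n)}\pi=0$ for all $f_1,\dots,f_n\in C^\infty(M)$. *)

theory Defs
  imports "HOL-Analysis.Analysis"
begin

section \<open>Smooth manifolds\<close>

primrec times_differentiable_on ::
  "nat \<Rightarrow> 'e::real_normed_vector set \<Rightarrow> ('e \<Rightarrow> 'f::real_normed_vector) \<Rightarrow> bool" where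
  "times_differentiable_on 0 U g \<longleftrightarrow> continuous_on U g"
| "times_differentiable_on (Suc k) U g \<longleftrightarrow>
     (\<forall>x\<in>U. g differentiable (at x)) \<and>
     (\<forall>v. times_differentiable_on k U (\<lambda>x. frechet_derivative g (at x) v))"

text \<open>Smoothness on an arbitrary set: local extendability to a smooth function on an open set of the
  ambient space. On open sets, and on relatively open subsets of a linear subspace (identified with
  some Euclidean space), this is the usual notion.\<close>

definition smooth_on :: "'e::euclidean_space set \<Rightarrow> ('e \<Rightarrow> 'f::real_normed_vector) \<Rightarrow> bool" where
  "smooth_on S f \<longleftrightarrow>
     (\<forall>x\<in>S. \<exists>U g. open U \<and> x \<in> U \<and> (\<forall>k. times_differentiable_on k U g) \<and> (\<forall>y\<in>S \<inter> U. g y = f y))"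

text \<open>The manifold is a whole (Hausdorff, second countable) type \<open>'a\<close>. Charts take values in a linear
  subspace \<open>V\<close> of \<open>'e\<close>, so that the dimension of the manifold is \<open>dim V\<close>; the type \<open>'e\<close> itself has
  dimension at least 1, and a proper subspace is needed only to allow for manifolds of dimension 0.
  The atlas need not be maximal.\<close>

type_synonym ('a, 'e) atlas = "('a set \<times> ('a \<Rightarrow> 'e)) set"

definition smooth_manifold ::
  "'e::euclidean_space set \<Rightarrow> ('a::{t2_space,second_countable_topology}, 'e) atlas \<Rightarrow> bool" where
  "smooth_manifold V A \<longleftrightarrow>
     subspace V \<and>
     (\<Union>(U, \<phi>)\<in>A. U) = UNIV \<and>
     (\<forall>(U, \<phi>)\<in>A. open U \<and> openin (top_of_set V) (\<phi> ` U) \<and>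
        homeomorphism U (\<phi> ` U) \<phi> (inv_into U \<phi>)) \<and>
     (\<forall>(U, \<phi>)\<in>A. \<forall>(W, \<psi>)\<in>A. smooth_on (\<phi> ` (U \<inter> W)) (\<psi> \<circ> inv_into U \<phi>))"

definition smooth_functions :: "('a, 'e::euclidean_space) atlas \<Rightarrow> ('a \<Rightarrow> real) set" where
  "smooth_functions A = {f. \<forall>(U, \<phi>)\<in>A. smooth_on (\<phi> ` U) (f \<circ> inv_into U \<phi>)}"


section \<open>Multilinear algebra\<close>

text \<open>Vector spaces are given as sets \<open>W\<close> of real-valued functions, with the pointwise operations.
  Linear functionals and alternating forms on \<open>W\<close> are extended by zero outside their domain, so that
  equality of forms is equality of functions. A \<open>k\<close>-linear form takes the list of its \<open>k\<close> arguments.\<close>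

definition dual :: "('x \<Rightarrow> real) set \<Rightarrow> (('x \<Rightarrow> real) \<Rightarrow> real) set" where
  "dual W = {\<xi>. (\<forall>v. v \<notin> W \<longrightarrow> \<xi> v = 0) \<and>
     (\<forall>u\<in>W. \<forall>v\<in>W. \<forall>a b. \<xi> (\<lambda>x. a * u x + b * v x) = a * \<xi> u + b * \<xi> v)}"

definition alt_forms :: "nat \<Rightarrow> ('x \<Rightarrow> real) set \<Rightarrow> (('x \<Rightarrow> real) list \<Rightarrow> real) set" where
  "alt_forms k W = {\<omega>.
     (\<forall>vs. \<not> (length vs = k \<and> set vs \<subseteq> W) \<longrightarrow> \<omega> vs = 0) \<and>
     (\<forall>vs i u v a b. length vs = k \<and> set vs \<subseteq> W \<and> i < k \<and> u \<in> W \<and> v \<in> W \<longrightarrow>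
        \<omega> (vs[i := (\<lambda>x. a * u x + b * v x)]) = a * \<omega> (vs[i := u]) + b * \<omega> (vs[i := v])) \<and>
     (\<forall>vs i j. length vs = k \<and> set vs \<subseteq> W \<and> i < j \<and> j < k \<and> vs ! i = vs ! j \<longrightarrow> \<omega> vs = 0)}"

text \<open>\<open>\<xi>\<^sub>1 \<and> \<dots> \<and> \<xi>\<^sub>n\<close> as an alternating form on \<open>W\<close>, normalised by
  \<open>(\<xi>\<^sub>1 \<and> \<dots> \<and> \<xi>\<^sub>n)(v\<^sub>1, \<dots>, v\<^sub>n) = det (\<xi>\<^sub>i(v\<^sub>j))\<close>.\<close>

definition wedge ::
  "('x \<Rightarrow> real) set \<Rightarrow> (('x \<Rightarrow> real) \<Rightarrow> real) list \<Rightarrow> ('x \<Rightarrow> real) list \<Rightarrow> real" where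
  "wedge W \<xi>s vs =
     (if length vs = length \<xi>s \<and> set vs \<subseteq> W
      then \<Sum>\<sigma> | \<sigma> permutes {..<length \<xi>s}.
             of_int (sign \<sigma>) * (\<Prod>i<length \<xi>s. (\<xi>s ! i) (vs ! \<sigma> i))
      else 0)"


section \<open>Vector fields, differential forms, multivector fields\<close>

type_synonym 'a tangent = "('a \<Rightarrow> real) \<Rightarrow> real"
type_synonym 'a cotangent = "'a tangent \<Rightarrow> real"
type_synonym 'a form = "'a tangent list \<Rightarrow> real"
type_synonym 'a multivector = "'a cotangent list \<Rightarrow> real"

text \<open>Tangent vectors are derivations of the algebra of smooth functions at \<open>p\<close>, extended by zero to
  the functions that are not smooth.\<close>

definition tangent_space :: "('a, 'e::euclidean_space) atlas \<Rightarrow> 'a \<Rightarrow> 'a tangent set" where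
  "tangent_space A p = {v.
     (\<forall>f. f \<notin> smooth_functions A \<longrightarrow> v f = 0) \<and>
     (\<forall>f\<in>smooth_functions A. \<forall>g\<in>smooth_functions A.
        (\<forall>a b. v (\<lambda>x. a * f x + b * g x) = a * v f + b * v g) \<and>
        v (\<lambda>x. f x * g x) = f p * v g + g p * v f)}"

abbreviation cotangent_space :: "('a, 'e::euclidean_space) atlas \<Rightarrow> 'a \<Rightarrow> 'a cotangent set" where
  "cotangent_space A p \<equiv> dual (tangent_space A p)"

definition differential ::
  "('a, 'e::euclidean_space) atlas \<Rightarrow> ('a \<Rightarrow> real) \<Rightarrow> 'a \<Rightarrow> 'a cotangent" where
  "differential A f p = (\<lambda>v. if v \<in> tangent_space A p then v f else 0)"

definition vector_fields :: "('a, 'e::euclidean_space) atlas \<Rightarrow> ('a \<Rightarrow> 'a tangent) set" where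
  "vector_fields A = {X. (\<forall>p. X p \<in> tangent_space A p) \<and>
     (\<forall>f\<in>smooth_functions A. (\<lambda>p. X p f) \<in> smooth_functions A)}"

definition eval_form :: "('a \<Rightarrow> 'a form) \<Rightarrow> ('a \<Rightarrow> 'a tangent) list \<Rightarrow> 'a \<Rightarrow> real" where
  "eval_form \<alpha> Xs = (\<lambda>p. \<alpha> p (map (\<lambda>X. X p) Xs))"

definition diff_forms :: "('a, 'e::euclidean_space) atlas \<Rightarrow> nat \<Rightarrow> ('a \<Rightarrow> 'a form) set" where
  "diff_forms A k = {\<alpha>. (\<forall>p. \<alpha> p \<in> alt_forms k (tangent_space A p)) \<and>
     (\<forall>Xs. length Xs = k \<and> set Xs \<subseteq> vector_fields A \<longrightarrow> eval_form \<alpha> Xs \<in> smooth_functions A)}"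

text \<open>The \<open>k\<close>-th exterior power of the (finite-dimensional) tangent space is identified with the
  alternating \<open>k\<close>-linear forms on the cotangent space.\<close>

definition multivector_fields ::
  "('a, 'e::euclidean_space) atlas \<Rightarrow> nat \<Rightarrow> ('a \<Rightarrow> 'a multivector) set" where
  "multivector_fields A k = {\<pi>. (\<forall>p. \<pi> p \<in> alt_forms k (cotangent_space A p)) \<and>
     (\<forall>fs. length fs = k \<and> set fs \<subseteq> smooth_functions A \<longrightarrow>
        (\<lambda>p. \<pi> p (map (\<lambda>f. differential A f p) fs)) \<in> smooth_functions A)}"


section \<open>Cartan calculus\<close>

definition lie_bracket ::
  "('a, 'e::euclidean_space) atlas \<Rightarrow> ('a \<Rightarrow> 'a tangent) \<Rightarrow> ('a \<Rightarrow> 'a tangent) \<Rightarrow> 'a \<Rightarrow> 'a tangent" where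
  "lie_bracket A X Y p =
     (\<lambda>f. if f \<in> smooth_functions A then X p (\<lambda>q. Y q f) - Y p (\<lambda>q. X q f) else 0)"

definition interior_form :: "('a \<Rightarrow> 'a tangent) \<Rightarrow> ('a \<Rightarrow> 'a form) \<Rightarrow> 'a \<Rightarrow> 'a form" where
  "interior_form Y \<alpha> = (\<lambda>p vs. \<alpha> p (Y p # vs))"

text \<open>The \<open>k\<close>-form with prescribed values on \<open>k\<close>-tuples of vector fields; it exists (and is unique) iff
  the prescription \<open>F\<close> is alternating and multilinear over the smooth functions, with smooth values.\<close>

definition form_with_values :: "('a, 'e::euclidean_space) atlas \<Rightarrow> nat \<Rightarrow>
    (('a \<Rightarrow> 'a tangent) list \<Rightarrow> 'a \<Rightarrow> real) \<Rightarrow> 'a \<Rightarrow> 'a form" where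
  "form_with_values A k F = (THE \<omega>. \<omega> \<in> diff_forms A k \<and>
     (\<forall>Xs. length Xs = k \<and> set Xs \<subseteq> vector_fields A \<longrightarrow> eval_form \<omega> Xs = F Xs))"

definition lie_derivative :: "('a, 'e::euclidean_space) atlas \<Rightarrow> nat \<Rightarrow>
    ('a \<Rightarrow> 'a tangent) \<Rightarrow> ('a \<Rightarrow> 'a form) \<Rightarrow> 'a \<Rightarrow> 'a form" where
  "lie_derivative A k X \<beta> = form_with_values A k (\<lambda>Xs p.
     X p (eval_form \<beta> Xs) - (\<Sum>i<k. eval_form \<beta> (Xs[i := lie_bracket A X (Xs ! i)]) p))"

definition omit :: "nat \<Rightarrow> 'b list \<Rightarrow> 'b list" where
  "omit i xs = take i xs @ drop (Suc i) xs"

definition exterior_derivative ::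
  "('a, 'e::euclidean_space) atlas \<Rightarrow> nat \<Rightarrow> ('a \<Rightarrow> 'a form) \<Rightarrow> 'a \<Rightarrow> 'a form" where
  "exterior_derivative A k \<alpha> = form_with_values A (Suc k) (\<lambda>Xs p.
     (\<Sum>i\<le>k. (-1) ^ i * (Xs ! i) p (eval_form \<alpha> (omit i Xs))) +
     (\<Sum>j\<le>k. \<Sum>i<j. (-1) ^ (i + j) *
        eval_form \<alpha> (lie_bracket A (Xs ! i) (Xs ! j) # omit i (omit j Xs)) p))"

text \<open>Sections of \<open>TM \<oplus> \<and>\<^sup>nT\<^sup>*M\<close> are pairs of a vector field and an \<open>n\<close>-form; \<open>n \<ge> 1\<close>.\<close>

fun dorfman_bracket :: "('a, 'e::euclidean_space) atlas \<Rightarrow> nat \<Rightarrow>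
    ('a \<Rightarrow> 'a tangent) \<times> ('a \<Rightarrow> 'a form) \<Rightarrow> ('a \<Rightarrow> 'a tangent) \<times> ('a \<Rightarrow> 'a form) \<Rightarrow>
    ('a \<Rightarrow> 'a tangent) \<times> ('a \<Rightarrow> 'a form)" where
  "dorfman_bracket A n (X, \<alpha>) (Y, \<beta>) =
     (lie_bracket A X Y,
      \<lambda>p vs. lie_derivative A n X \<beta> p vs - lie_derivative A n Y \<alpha> p vs
        + exterior_derivative A (n - 1) (interior_form Y \<alpha>) p vs)"


section \<open>The graph of a multivector field\<close>

text \<open>The tangent vector \<open>P(\<xi>\<^sub>1, \<dots>, \<xi>\<^sub>n, \<cdot>)\<close>, an element of the double dual, as a derivation.\<close>

definition contract_covectors :: "('a, 'e::euclidean_space) atlas \<Rightarrow> 'a \<Rightarrow>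
    'a multivector \<Rightarrow> 'a cotangent list \<Rightarrow> 'a tangent" where
  "contract_covectors A p P \<xi>s =
     (\<lambda>f. if f \<in> smooth_functions A then P (\<xi>s @ [differential A f p]) else 0)"

text \<open>\<open>\<pi>\<^sup>\<sharp>\<close> at \<open>p\<close>: the linear map with \<open>\<xi>\<^sub>1 \<and> \<dots> \<and> \<xi>\<^sub>n \<mapsto> \<pi>(\<xi>\<^sub>1, \<dots>, \<xi>\<^sub>n, \<cdot>)\<close>, unique because the decomposable
  forms span.\<close>

definition sharp :: "('a, 'e::euclidean_space) atlas \<Rightarrow> nat \<Rightarrow> ('a \<Rightarrow> 'a multivector) \<Rightarrow>
    'a \<Rightarrow> 'a form \<Rightarrow> 'a tangent" where
  "sharp A n \<pi> p = (THE L.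
     (\<forall>\<xi>. \<xi> \<notin> alt_forms n (tangent_space A p) \<longrightarrow> L \<xi> = (\<lambda>f. 0)) \<and>
     (\<forall>\<xi>\<in>alt_forms n (tangent_space A p). L \<xi> \<in> tangent_space A p) \<and>
     (\<forall>\<xi>\<in>alt_forms n (tangent_space A p). \<forall>\<eta>\<in>alt_forms n (tangent_space A p). \<forall>a b.
        L (\<lambda>vs. a * \<xi> vs + b * \<eta> vs) = (\<lambda>f. a * L \<xi> f + b * L \<eta> f)) \<and>
     (\<forall>\<xi>s. length \<xi>s = n \<and> set \<xi>s \<subseteq> cotangent_space A p \<longrightarrow>
        L (wedge (tangent_space A p) \<xi>s) = contract_covectors A p (\<pi> p) \<xi>s))"

definition graph_at :: "('a, 'e::euclidean_space) atlas \<Rightarrow> nat \<Rightarrow> ('a \<Rightarrow> 'a multivector) \<Rightarrow>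
    'a \<Rightarrow> ('a tangent \<times> 'a form) set" where
  "graph_at A n \<pi> p = {(sharp A n \<pi> p \<xi>, \<xi>) | \<xi>. \<xi> \<in> alt_forms n (tangent_space A p)}"

definition graph_sections :: "('a, 'e::euclidean_space) atlas \<Rightarrow> nat \<Rightarrow> ('a \<Rightarrow> 'a multivector) \<Rightarrow>
    (('a \<Rightarrow> 'a tangent) \<times> ('a \<Rightarrow> 'a form)) set" where
  "graph_sections A n \<pi> = {(X, \<alpha>). X \<in> vector_fields A \<and> \<alpha> \<in> diff_forms A n \<and>
     (\<forall>p. (X p, \<alpha> p) \<in> graph_at A n \<pi> p)}"

definition graph_closed :: "('a, 'e::euclidean_space) atlas \<Rightarrow> nat \<Rightarrow>
    ('a \<Rightarrow> 'a multivector) \<Rightarrow> bool" where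
  "graph_closed A n \<pi> \<longleftrightarrow>
     (\<forall>s\<in>graph_sections A n \<pi>. \<forall>t\<in>graph_sections A n \<pi>.
        dorfman_bracket A n s t \<in> graph_sections A n \<pi>)"


section \<open>Nambu--Poisson structures\<close>

definition nambu_bracket :: "('a, 'e::euclidean_space) atlas \<Rightarrow> nat \<Rightarrow>
    (('a \<Rightarrow> real) list \<Rightarrow> 'a \<Rightarrow> real) \<Rightarrow> bool" where
  "nambu_bracket A n B \<longleftrightarrow>
     (let C = smooth_functions A; args = (\<lambda>k fs. length fs = k \<and> set fs \<subseteq> C) in
       (\<forall>fs. args (n + 1) fs \<longrightarrow> B fs \<in> C) \<and>
       (\<forall>fs i. \<forall>f\<in>C. \<forall>g\<in>C. \<forall>a b. args (n + 1) fs \<and> i < n + 1 \<longrightarrow>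
          B (fs[i := (\<lambda>x. a * f x + b * g x)]) = (\<lambda>x. a * B (fs[i := f]) x + b * B (fs[i := g]) x)) \<and>
       (\<forall>fs i j. args (n + 1) fs \<and> i < j \<and> j < n + 1 \<longrightarrow>
          B (fs[i := fs ! j, j := fs ! i]) = (\<lambda>x. - B fs x)) \<and>
       (\<forall>f\<in>C. \<forall>g\<in>C. \<forall>fs. args n fs \<longrightarrow>
          B ((\<lambda>x. f x * g x) # fs) = (\<lambda>x. f x * B (g # fs) x + g x * B (f # fs) x)) \<and>
       (\<forall>fs gs. args n fs \<and> args (n + 1) gs \<longrightarrow>
          B (fs @ [B gs]) = (\<lambda>x. \<Sum>i<n + 1. B (gs[i := B (fs @ [gs ! i])]) x)))"

definition nambu_poisson :: "('a, 'e::euclidean_space) atlas \<Rightarrow> nat \<Rightarrow>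
    ('a \<Rightarrow> 'a multivector) \<Rightarrow> bool" where
  "nambu_poisson A n \<pi> \<longleftrightarrow>
     nambu_bracket A n (\<lambda>fs p. \<pi> p (map (\<lambda>f. differential A f p) fs))"

end

theory Submission
  imports Defs "Jordan_Normal_Form.Determinant"
begin

text \<open>For vector fields \<open>X = \<pi>\<^sup>\<sharp> \<alpha>\<close> and \<open>Y = \<pi>\<^sup>\<sharp> \<beta>\<close>, Cartan's formula turns the form component of the bracket of
  \<open>X + \<alpha>\<close> and \<open>Y + \<beta>\<close> into \<open>L\<^sub>X \<beta> - i\<^sub>Y d\<alpha>\<close>, so the graph is closed iff the obstruction
  \<open>\<Delta>(\<alpha>, \<beta>) = [X, Y] - \<pi>\<^sup>\<sharp> (L\<^sub>X \<beta> - i\<^sub>Y d\<alpha>)\<close> vanishes for all \<open>\<alpha>\<close> and \<open>\<beta>\<close> (called \<open>defect\<close> below).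

  For \<open>\<alpha> = df\<^sub>1 \<and> \<dots> \<and> df\<^sub>n\<close> and \<open>\<beta> = dg\<^sub>1 \<and> \<dots> \<and> dg\<^sub>n\<close> the fields are Hamiltonian, \<open>d\<alpha> = 0\<close>, and \<open>L\<^sub>X \<beta>\<close> is the sum of
  the \<open>dg\<^sub>1 \<and> \<dots> \<and> d(X g\<^sub>j) \<and> \<dots> \<and> dg\<^sub>n\<close>. Applied to a function \<open>g\<close>, the obstruction is then exactly the difference of the two
  sides of the fundamental identity (\<open>defect_exact\<close>). Hence closedness implies the Nambu-Poisson condition, and conversely
  that condition makes the obstruction vanish on such \<open>\<alpha>\<close> and \<open>\<beta>\<close>, which span all forms over the smooth functions.

  It remains to see that \<open>\<Delta>\<close> is linear over the functions. In \<open>\<beta>\<close> this is immediate. In \<open>\<alpha>\<close> one finds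
  \<open>\<Delta>(u \<alpha>, \<beta>) = u \<Delta>(\<alpha>, \<beta>) - \<pi>\<^sup>\<sharp> (du \<and> (i\<^sub>X \<beta> + i\<^sub>Y \<alpha>))\<close>, and the last term is purely algebraic in \<open>\<pi>\<close>. It vanishes by a
  quadratic identity that is the symbol of the fundamental identity in its first \<open>n\<close> arguments (\<open>exchange_rows\<close>): for lists
  \<open>F\<close> and \<open>G\<close> of \<open>n + 1\<close> functions, the matrix of products \<open>{F with G\<^sub>j for F\<^sub>i} {G with F\<^sub>i for G\<^sub>j}\<close> has equal row sums.
  Exchanging \<open>F\<close> and \<open>G\<close> transposes the matrix, so the common row sum is also the common column sum
  (\<open>exchange_row_col\<close>), and comparing the last row with the last column gives \<open>\<pi>\<^sup>\<sharp> (du \<and> (i\<^sub>X \<beta> + i\<^sub>Y \<alpha>)) = 0\<close> for decomposable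
  \<open>\<alpha>\<close> and \<open>\<beta>\<close>, hence for all. (For \<open>n \<ge> 2\<close> it could also be read off from the decomposability of \<open>\<pi>\<close>; the argument with the matrix
  covers all \<open>n\<close> at once.)

  The definitions speak of derivations of the algebra of smooth functions and of forms prescribed by their values on vector
  fields. All that has to be known about the manifold is condensed in \<open>local_frame\<close>: near each point finitely many global
  vector fields and functions expand every derivation. Its proof uses charts, bump functions and Hadamard's lemma. The frames
  show that \<open>\<pi>\<^sup>\<sharp>\<close> is well defined, that forms are locally combinations of the \<open>df\<^sub>1 \<and> \<dots> \<and> df\<^sub>k\<close>, and that \<open>d\<close> and \<open>L\<^sub>X\<close> yield
  forms; the rest is algebra over the ring of smooth functions.\<close>

section \<open>Functions of class \<open>C\<^sup>k\<close>\<close>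

abbreviation "Ck \<equiv> times_differentiable_on"

lemma Ck_subset:
  "Ck k U f \<Longrightarrow> W \<subseteq> U \<Longrightarrow> Ck k W f"
  by (induction k arbitrary: f) (auto intro: continuous_on_subset)

lemma has_frechet_derivative:
  "Ck (Suc k) U f \<Longrightarrow> x \<in> U \<Longrightarrow> (f has_derivative frechet_derivative f (at x)) (at x)"
  using frechet_derivative_works by auto

lemma Ck_cong:
  assumes "open U" "\<And>x. x \<in> U \<Longrightarrow> f x = g x" "Ck k U f"
  shows "Ck k U g"
  using assms(2,3)
proof (induction k arbitrary: f g)
  case 0
  then show ?case by (auto cong: continuous_on_cong)
next
  case (Suc k)
  have g: "(g has_derivative frechet_derivative f (at x)) (at x)" if "x \<in> U" for x
    using has_derivative_transform_within_open[OF has_frechet_derivative[OF Suc.prems(2) that] \<open>open U\<close> that]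
      Suc.prems(1) by auto
  then have "frechet_derivative f (at x) = frechet_derivative g (at x)" if "x \<in> U" for x
    using that frechet_derivative_at by blast
  then have "Ck k U (\<lambda>x. frechet_derivative g (at x) v)" for v
    using Suc.IH[of "\<lambda>x. frechet_derivative f (at x) v"] Suc.prems(2) by auto
  then show ?case using g by (auto simp: differentiable_def)
qed

lemma Ck_SucI:
  assumes "open U" "\<And>x. x \<in> U \<Longrightarrow> (f has_derivative f' x) (at x)"
    "\<And>v. Ck k U (\<lambda>x. f' x v)"
  shows "Ck (Suc k) U f"
proof -
  have "f' x = frechet_derivative f (at x)" if "x \<in> U" for x
    by (rule frechet_derivative_at[OF assms(2)[OF that]])
  then have "Ck k U (\<lambda>x. frechet_derivative f (at x) v)" for v
    by (intro Ck_cong[OF assms(1) _ assms(3)[of v]]) simp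
  then show ?thesis using assms(2) by (auto simp: differentiable_def)
qed

lemma Ck_SucD:
  "Ck (Suc k) U f \<Longrightarrow> Ck k U f"
proof (induction k arbitrary: f)
  case 0
  then show ?case
    by (auto intro!: continuous_at_imp_continuous_on differentiable_imp_continuous_within)
qed auto

lemma Ck_local:
  assumes "\<And>x. x \<in> U \<Longrightarrow> \<exists>W. open W \<and> x \<in> W \<and> Ck k W f"
  shows "Ck k U f"
  using assms
proof (induction k arbitrary: f)
  case 0
  then show ?case
    by (metis continuous_on_eq_continuous_at continuous_at_imp_continuous_on times_differentiable_on.simps(1))
next
  case (Suc k)
  have "Ck k U (\<lambda>x. frechet_derivative f (at x) v)" for v
    by (rule Suc.IH) (use Suc.prems in fastforce)
  then show ?case using Suc.prems by fastforce
qed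

lemma Ck_const: "Ck k U (\<lambda>x. c)"
proof (induction k arbitrary: c)
  case 0
  then show ?case by auto
next
  case (Suc k)
  have "frechet_derivative (\<lambda>x. c) (at x) = (\<lambda>v. 0)" for x :: 'a
    using frechet_derivative_at[OF has_derivative_const[of c "at x"]] by simp
  then show ?case using Suc.IH by auto
qed

lemma Ck_linear:
  assumes "bounded_linear L" shows "Ck k U L"
proof (cases k)
  case 0
  then show ?thesis using linear_continuous_on[OF assms] by auto
next
  case (Suc k)
  have "Ck (Suc k) UNIV L"
    by (rule Ck_SucI[where f' = "\<lambda>x. L"])
      (auto intro: bounded_linear_imp_has_derivative assms Ck_const)
  then show ?thesis using Suc Ck_subset by blast
qed

lemma Ck_add:
  assumes "open U" "Ck k U f" "Ck k U g"
  shows "Ck k U (\<lambda>x. f x + g x)"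
  using assms(2,3)
proof (induction k arbitrary: f g)
  case 0
  then show ?case by (auto intro: continuous_on_add)
next
  case (Suc k)
  note d = Suc.prems[THEN has_frechet_derivative]
  show ?case
  proof (rule Ck_SucI[OF \<open>open U\<close>])
    show "((\<lambda>x. f x + g x) has_derivative
        (\<lambda>v. frechet_derivative f (at x) v + frechet_derivative g (at x) v)) (at x)" if "x \<in> U" for x
      using has_derivative_add[OF d(1)[OF that] d(2)[OF that]] .
    show "Ck k U
       (\<lambda>x. frechet_derivative f (at x) v + frechet_derivative g (at x) v)" for v
      by (rule Suc.IH) (use Suc.prems in auto)
  qed
qed

lemma Ck_scaleR:
  assumes "open U" "Ck k U f" "Ck k U g"
  shows "Ck k U (\<lambda>x. f x *\<^sub>R g x)"
  using assms(2,3)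
proof (induction k arbitrary: f g)
  case 0
  then show ?case by (auto intro: continuous_on_scaleR)
next
  case (Suc k)
  note d = Suc.prems[THEN has_frechet_derivative]
  show ?case
  proof (rule Ck_SucI[OF \<open>open U\<close>])
    show "((\<lambda>x. f x *\<^sub>R g x) has_derivative
        (\<lambda>v. f x *\<^sub>R frechet_derivative g (at x) v + frechet_derivative f (at x) v *\<^sub>R g x)) (at x)"
      if "x \<in> U" for x
      using has_derivative_scaleR[OF d(1)[OF that] d(2)[OF that]] .
    show "Ck k U
       (\<lambda>x. f x *\<^sub>R frechet_derivative g (at x) v + frechet_derivative f (at x) v *\<^sub>R g x)" for v
      by (intro Ck_add[OF \<open>open U\<close>] Suc.IH)
        (use Suc.prems Ck_SucD in auto)
  qed
qed

lemma Ck_sum: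
  assumes "open U" "finite I" "\<And>i. i \<in> I \<Longrightarrow> Ck k U (f i)"
  shows "Ck k U (\<lambda>x. \<Sum>i\<in>I. f i x)"
  using assms(2,3)
  by (induction I rule: finite_induct)
    (auto intro!: Ck_const Ck_add assms(1))

lemma Ck_linear_compose:
  assumes "open U" "bounded_linear L" "Ck k U f"
  shows "Ck k U (\<lambda>x. L (f x))"
  using assms(3)
proof (induction k arbitrary: f)
  case 0
  then show ?case using bounded_linear.continuous_on[OF assms(2)] by auto
next
  case (Suc k)
  show ?case
    by (rule Ck_SucI[where f' = "\<lambda>x v. L (frechet_derivative f (at x) v)", OF \<open>open U\<close>])
      (use bounded_linear.has_derivative[OF assms(2) has_frechet_derivative[OF Suc.prems]] Suc in \<open>simp_all del: o_apply\<close>)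
qed

lemma frechet_derivative_components:
  assumes "(f has_derivative D) (at x)"
  shows "D v = (\<Sum>b\<in>Basis. (v \<bullet> b) *\<^sub>R D b)"
proof -
  have "D (\<Sum>b\<in>Basis. (v \<bullet> b) *\<^sub>R b) = (\<Sum>b\<in>Basis. (v \<bullet> b) *\<^sub>R D b)"
    using has_derivative_linear[OF assms] by (simp add: linear_sum linear_scale)
  then show ?thesis by (simp add: euclidean_representation)
qed

text \<open>The chain rule \<open>D(g \<circ> f)(x) v = Dg(f x)(Df(x) v)\<close> has a direction that varies with \<open>x\<close>. Expanding it in the
standard basis turns it into a sum of products of functions of lower order, which closes the induction.\<close>

lemma Ck_compose:
  fixes f :: "'e::real_normed_vector \<Rightarrow> 'f::euclidean_space"
  assumes "open U" "open W" "f ` U \<subseteq> W" "Ck k U f" "Ck k W g"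
  shows "Ck k U (\<lambda>x. g (f x))"
  using assms(4,5)
proof (induction k arbitrary: g)
  case 0
  then show ?case using continuous_on_compose2 assms(3) by auto
next
  case (Suc k)
  let ?f' = "\<lambda>x. frechet_derivative f (at x)" and ?g' = "\<lambda>x. frechet_derivative g (at x)"
  have fd: "(f has_derivative ?f' x) (at x)" if "x \<in> U" for x
    using has_frechet_derivative[OF Suc.prems(1) that] .
  have gd: "(g has_derivative ?g' (f x)) (at (f x))" if "x \<in> U" for x
    using has_frechet_derivative[OF Suc.prems(2)] that assms(3) by blast
  show ?case
  proof (rule Ck_SucI[OF \<open>open U\<close>])
    show "((\<lambda>x. g (f x)) has_derivative (\<lambda>v. \<Sum>b\<in>Basis. (?f' x v \<bullet> b) *\<^sub>R ?g' (f x) b)) (at x)" if "x \<in> U" for x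
    proof -
      show ?thesis
        by (rule has_derivative_eq_rhs[OF has_derivative_compose[OF fd[OF that] gd[OF that]]]) (rule ext, rule frechet_derivative_components[OF gd[OF that]])
    qed
    show "Ck k U (\<lambda>x. \<Sum>b\<in>Basis. (?f' x v \<bullet> b) *\<^sub>R ?g' (f x) b)" for v
    proof (intro Ck_sum[OF \<open>open U\<close>] Ck_scaleR[OF \<open>open U\<close>])
      show "Ck k U (\<lambda>x. ?f' x v \<bullet> b)" for b
        by (rule Ck_linear_compose[OF \<open>open U\<close> bounded_linear_inner_left])
          (use Suc.prems(1) in simp)
      show "Ck k U (\<lambda>x. ?g' (f x) b)" for b
        using Suc.IH[of "\<lambda>y. ?g' y b"] Suc.prems Ck_SucD by auto
    qed simp
  qed
qed

section \<open>Bump functions\<close>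

text \<open>The derivative of \<open>t\<^sup>-\<^sup>m exp (-1/t)\<close> is a combination of two functions of the same family, so smoothness of the
whole family, the origin included, is one induction on the order.\<close>

definition flat_fun :: "nat \<Rightarrow> real \<Rightarrow> real" where
  "flat_fun m t = (if t > 0 then inverse t ^ m * exp (- inverse t) else 0)"

lemma flat_fun_at_0: "(flat_fun m \<longlongrightarrow> 0) (at 0)"
proof -
  have 1: "((\<lambda>t::real. inverse t ^ m * exp (- inverse t)) \<longlongrightarrow> 0) (at_right 0)"
  proof -
    have "((\<lambda>s::real. s ^ m / exp s) \<longlongrightarrow> 0) at_top" by (rule tendsto_power_div_exp_0)
    then have "((\<lambda>t::real. inverse t ^ m / exp (inverse t)) \<longlongrightarrow> 0) (at_right 0)"
      by (rule filterlim_compose) (rule filterlim_inverse_at_top_right)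
    then show ?thesis by (simp add: exp_minus field_simps)
  qed
  have 2: "(flat_fun m \<longlongrightarrow> 0) (at_right 0)"
    by (rule Lim_transform_eventually[OF 1]) (auto simp: eventually_at_right_less flat_fun_def eventually_at_filter)
  have 3: "(flat_fun m \<longlongrightarrow> 0) (at_left 0)"
    by (rule tendsto_eventually) (auto simp: flat_fun_def eventually_at_filter)
  show ?thesis using 2 3 by (simp add: filterlim_split_at)
qed

lemma has_derivative_flat_fun:
  "(flat_fun m has_derivative (\<lambda>v. (flat_fun (m + 2) t - m * flat_fun (m + 1) t) * v)) (at t)"
proof -
  consider "t < 0" | "t = 0" | "t > 0" by linarith
  then have "(flat_fun m has_field_derivative (flat_fun (m + 2) t - m * flat_fun (m + 1) t)) (at t)"
  proof cases
    case 1
    have "((\<lambda>_. 0) has_field_derivative 0) (at t)" by simp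
    then have "(flat_fun m has_field_derivative 0) (at t)"
      by (rule has_field_derivative_transform_within_open[where S = "{..<0}"]) (use 1 in \<open>auto simp: flat_fun_def\<close>)
    then show ?thesis using 1 by (auto simp: flat_fun_def)
  next
    case 2
    have "((\<lambda>h. flat_fun m h / h) \<longlongrightarrow> 0) (at 0)"
    proof (rule Lim_transform_eventually[OF flat_fun_at_0[of "Suc m"]])
      show "\<forall>\<^sub>F x in at 0. flat_fun (Suc m) x = flat_fun m x / x"
        by (auto simp: eventually_at_filter flat_fun_def field_simps)
    qed
    then have "(flat_fun m has_field_derivative 0) (at 0)"
      by (simp add: DERIV_def) (simp add: flat_fun_def)
    then show ?thesis using 2 by (auto simp: flat_fun_def)
  next
    case 3
    have "((\<lambda>t. inverse t ^ m * exp (- inverse t)) has_field_derivative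
       (flat_fun (m + 2) t - m * flat_fun (m + 1) t)) (at t)"
    proof -
      have inv: "(inverse has_field_derivative - (inverse t * inverse t)) (at t)"
        using 3 by (auto intro!: derivative_eq_intros simp: field_simps)
      show ?thesis
        by (rule DERIV_cong[OF DERIV_mult[OF DERIV_power[OF inv] DERIV_chain2[OF DERIV_exp DERIV_minus[OF inv]]]])
          (use 3 in \<open>cases m; simp add: flat_fun_def algebra_simps\<close>)
    qed
    then show ?thesis
      by (rule has_field_derivative_transform_within_open[where S = "{0<..}"]) (use 3 in \<open>auto simp: flat_fun_def\<close>)
  qed
  then show ?thesis by (simp add: has_field_derivative_def)
qed

lemma smooth_flat_fun: "Ck k UNIV (flat_fun m)"
proof (induction k arbitrary: m)
  case 0
  then show ?case
    by (auto intro!: continuous_at_imp_continuous_on has_derivative_continuous has_derivative_flat_fun)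
next
  case (Suc k)
  show ?case
  proof (rule Ck_SucI[OF open_UNIV has_derivative_flat_fun])
    fix v
    have "Ck k UNIV (\<lambda>t. v *\<^sub>R (flat_fun (m + 2) t + (- real m) *\<^sub>R flat_fun (m + 1) t))"
      by (intro Ck_scaleR Ck_add Ck_const Suc open_UNIV)
    then show "Ck k UNIV (\<lambda>t. (flat_fun (m + 2) t - real m * flat_fun (m + 1) t) * v)"
      by (simp add: mult.commute)
  qed
qed

lemma smooth_norm_square: "Ck k UNIV (\<lambda>y::'e::euclidean_space. (y - b) \<bullet> (y - b))"
proof -
  have l: "Ck k UNIV (\<lambda>y. (y - b) \<bullet> i)" for i :: 'e
  proof -
    have "Ck k UNIV (\<lambda>y. y \<bullet> i + - (b \<bullet> i))"
      by (intro Ck_add Ck_const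
          Ck_linear bounded_linear_inner_left open_UNIV)
    then show ?thesis by (simp add: inner_diff_left)
  qed
  have "Ck k UNIV (\<lambda>y. \<Sum>i\<in>Basis. ((y - b) \<bullet> i) *\<^sub>R ((y - b) \<bullet> i))"
    by (intro Ck_sum Ck_scaleR l) auto
  then show ?thesis by (simp flip: euclidean_inner)
qed

lemma bump_exists:
  fixes b :: "'e::euclidean_space"
  assumes "r > 0"
  shows "\<exists>\<kappa>::'e \<Rightarrow> real. \<kappa> b = 1 \<and> (\<forall>y. y \<notin> cball b r \<longrightarrow> \<kappa> y = 0) \<and>
    (\<forall>k. Ck k UNIV \<kappa>)"
proof -
  let ?c = "inverse (flat_fun 0 (r\<^sup>2))"
  define \<kappa> where "\<kappa> = (\<lambda>y. ?c *\<^sub>R flat_fun 0 (r\<^sup>2 + (-1) *\<^sub>R ((y - b) \<bullet> (y - b))))"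
  have 1: "\<kappa> b = 1" using assms by (simp add: flat_fun_def \<kappa>_def)
  have 2: "\<kappa> y = 0" if "y \<notin> cball b r" for y
  proof -
    have "r\<^sup>2 \<le> (dist b y)\<^sup>2" using that assms by (intro power_mono) auto
    then have "r\<^sup>2 \<le> (y - b) \<bullet> (y - b)"
      by (simp add: dist_norm norm_minus_commute flip: power2_norm_eq_inner)
    then show ?thesis by (simp add: flat_fun_def \<kappa>_def)
  qed
  have 3: "Ck k UNIV \<kappa>" for k
  proof -
    have "Ck k UNIV (\<lambda>y. r\<^sup>2 + (-1) *\<^sub>R ((y - b) \<bullet> (y - b)))"
      by (intro Ck_add Ck_scaleR
          Ck_const smooth_norm_square open_UNIV)
    from Ck_compose[OF open_UNIV open_UNIV _ this smooth_flat_fun]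
    show ?thesis
      unfolding \<kappa>_def by (intro Ck_scaleR Ck_const open_UNIV) auto
  qed
  show ?thesis by (intro exI[of _ \<kappa>] conjI allI impI 1 2 3)
qed

section \<open>Hadamard's lemma\<close>

text \<open>The remainder functions in Hadamard's lemma are the means with \<open>m = 0\<close> of the partial derivatives. The weight \<open>t ^ m\<close>
makes the family closed under differentiation, as differentiating under the integral produces a factor \<open>t\<close>.\<close>

definition ray_mean :: "'e::euclidean_space \<Rightarrow> nat \<Rightarrow> ('e \<Rightarrow> real) \<Rightarrow> 'e \<Rightarrow> real" where
  "ray_mean y0 m f y = integral {0..1} (\<lambda>t. t ^ m * f (y0 + t *\<^sub>R (y - y0)))"

lemma ray_in_convex:
  assumes "convex U" "y0 \<in> U" "y \<in> U" "t \<in> {0..1}"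
  shows "y0 + t *\<^sub>R (y - y0) \<in> U"
proof -
  have "y0 + t *\<^sub>R (y - y0) = (1 - t) *\<^sub>R y0 + t *\<^sub>R y" by (simp add: algebra_simps)
  then show ?thesis using convexD[OF assms(1-3), of "1 - t" t] assms(4) by auto
qed

lemma has_derivative_ray_mean:
  fixes f :: "'e::euclidean_space \<Rightarrow> real"
  assumes U: "open U" "convex U" "y0 \<in> U" "y \<in> U" and f: "\<And>k. Ck k U f"
  shows "(ray_mean y0 m f has_derivative (\<lambda>v. ray_mean y0 (Suc m) (\<lambda>z. frechet_derivative f (at z) v) y)) (at y)"
proof -
  let ?D = "\<lambda>z. frechet_derivative f (at z)"
  let ?z = "\<lambda>y t. y0 + t *\<^sub>R (y - y0)"
  \<comment> \<open>The derivative of the integrand, written in coordinates so that its continuity in both variables is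
    continuity of the partial derivatives.\<close>
  define fx where "fx y t = (\<Sum>b\<in>Basis. (t ^ Suc m * ?D (?z y t) b) *\<^sub>R blinfun_inner_right b)" for y t
  have zU: "?z y t \<in> U" if "y \<in> U" "t \<in> {0..1}" for y t
    using ray_in_convex[OF U(2,3) that] .
  have fd: "(f has_derivative ?D z) (at z)" if "z \<in> U" for z
    using has_frechet_derivative[OF f[of "Suc 0"] that] .
  have fx: "blinfun_apply (fx y t) v = t ^ Suc m * ?D (?z y t) v" if "y \<in> U" "t \<in> {0..1}" for y t v
  proof -
    have "?D (?z y t) v = (\<Sum>b\<in>Basis. (v \<bullet> b) *\<^sub>R ?D (?z y t) b)"
      by (rule frechet_derivative_components[OF fd[OF zU[OF that]]])
    then show ?thesis
      by (simp add: fx_def blinfun.sum_left blinfun.scaleR_left sum_distrib_left inner_commute algebra_simps)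
  qed
  have contD: "continuous_on U (\<lambda>z. ?D z b)" for b
    using f[of "Suc 0"] by simp
  have contf: "continuous_on U f" using f[of 0] by simp
  have cont_fx: "continuous_on (U \<times> {0..1}) (\<lambda>(y, t). fx y t)"
    unfolding fx_def case_prod_beta
    by (intro continuous_intros continuous_on_compose2[OF contD]) (use zU in auto)
  have "((\<lambda>y. integral (cbox 0 1) (\<lambda>t. t ^ m * f (?z y t))) has_derivative
      blinfun_apply (integral (cbox 0 1) (fx y))) (at y within U)"
  proof (rule leibniz_rule[where fx = fx])
    fix x t assume x: "x \<in> U" and t: "t \<in> cbox 0 (1::real)"
    have z: "((\<lambda>x. ?z x t) has_derivative (\<lambda>v. t *\<^sub>R v)) (at x)"
      by (auto intro!: derivative_eq_intros)
    have "((\<lambda>x. t ^ m * f (?z x t)) has_derivative (\<lambda>v. t ^ m * ?D (?z x t) (t *\<^sub>R v))) (at x)"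
      using t by (intro has_derivative_mult_right has_derivative_compose[OF z] fd zU x) auto
    moreover have "t ^ m * ?D (?z x t) (t *\<^sub>R v) = fx x t v" for v
      using t has_derivative_linear[OF fd[OF zU[OF x]], of t] by (simp add: fx x linear_scale)
    ultimately show "((\<lambda>x. t ^ m * f (?z x t)) has_derivative blinfun_apply (fx x t)) (at x within U)"
      by (auto intro: has_derivative_at_withinI)
  next
    fix x assume "x \<in> U"
    then show "(\<lambda>t. t ^ m * f (?z x t)) integrable_on cbox 0 1"
      by (intro integrable_continuous continuous_intros continuous_on_compose2[OF contf]) (use zU in auto)
  qed (use U cont_fx in auto)
  moreover have eq: "blinfun_apply (integral (cbox 0 1) (fx y)) v = ray_mean y0 (Suc m) (\<lambda>z. ?D z v) y" for v
  proof -
    have "continuous_on {0..1} (fx y)"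
    proof -
      have "continuous_on {0..1::real} (\<lambda>t. (y, t))" by (intro continuous_intros)
      from continuous_on_compose2[OF cont_fx this] U show ?thesis by auto
    qed
    then have "fx y integrable_on {0..1}" by (rule integrable_continuous_real)
    then have "blinfun_apply (integral {0..1} (fx y)) v = integral {0..1} (\<lambda>t. blinfun_apply (fx y t) v)"
      using integral_linear[of "fx y" "{0..1}" "\<lambda>B. blinfun_apply B v"] blinfun.bounded_linear_left by (auto simp: o_def)
    also have "\<dots> = ray_mean y0 (Suc m) (\<lambda>z. ?D z v) y"
      unfolding ray_mean_def by (rule integral_cong) (use fx U in auto)
    finally show ?thesis by simp
  qed
  ultimately show ?thesis
    using at_within_open[OF U(4,1)] unfolding eq[THEN ext] by (simp add: ray_mean_def[abs_def])
qed

lemma smooth_ray_mean: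
  fixes f :: "'e::euclidean_space \<Rightarrow> real"
  assumes U: "open U" "convex U" "y0 \<in> U" and f: "\<And>k. Ck k U f"
  shows "Ck k U (ray_mean y0 m f)"
  using f
proof (induction k arbitrary: m f)
  case 0
  show ?case
    using has_derivative_continuous[OF has_derivative_ray_mean[OF U _ 0]]
    by (auto intro!: continuous_at_imp_continuous_on)
next
  case (Suc k)
  show ?case
  proof (rule Ck_SucI[OF U(1) has_derivative_ray_mean[OF U _ Suc.prems]])
    show "Ck k U (ray_mean y0 (Suc m) (\<lambda>z. frechet_derivative f (at z) v))" for v
      by (rule Suc.IH) (use Suc.prems[of "Suc _"] in simp)
  qed
qed

lemma hadamard:
  fixes f :: "'e::euclidean_space \<Rightarrow> real"
  assumes U: "open U" "convex U" "y0 \<in> U" "y \<in> U" and f: "\<And>k. Ck k U f"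
  shows "f y = f y0 + (\<Sum>b\<in>Basis. ((y - y0) \<bullet> b) * ray_mean y0 0 (\<lambda>z. frechet_derivative f (at z) b) y)"
proof -
  let ?D = "\<lambda>z. frechet_derivative f (at z)"
  let ?z = "\<lambda>t. y0 + t *\<^sub>R (y - y0)"
  have zU: "?z t \<in> U" if "t \<in> {0..1}" for t using ray_in_convex[OF U(2-4) that] .
  have fd: "(f has_derivative ?D z) (at z)" if "z \<in> U" for z
    using has_frechet_derivative[OF f[of "Suc 0"] that] .
  have contD: "continuous_on U (\<lambda>z. ?D z b)" for b
    using f[of "Suc 0"] by simp
  have "((\<lambda>t. ?D (?z t) (y - y0)) has_integral f (?z 1) - f (?z 0)) {0..1}"
  proof (rule fundamental_theorem_of_calculus)
    fix t :: real assume t: "t \<in> {0..1}"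
    have z: "(?z has_derivative (\<lambda>s. s *\<^sub>R (y - y0))) (at t)"
      by (auto intro!: derivative_eq_intros)
    have "((\<lambda>t. f (?z t)) has_derivative (\<lambda>s. ?D (?z t) (s *\<^sub>R (y - y0)))) (at t)"
      by (rule has_derivative_compose[OF z fd[OF zU[OF t]]])
    then have "((\<lambda>t. f (?z t)) has_vector_derivative ?D (?z t) (y - y0)) (at t)"
      unfolding has_vector_derivative_def
      by (rule has_derivative_eq_rhs) (use has_derivative_linear[OF fd[OF zU[OF t]]] in \<open>auto simp: linear_scale\<close>)
    then show "((\<lambda>t. f (?z t)) has_vector_derivative ?D (?z t) (y - y0)) (at t within {0..1})"
      by (rule has_vector_derivative_at_within)
  qed simp
  then have "f y - f y0 = integral {0..1} (\<lambda>t. ?D (?z t) (y - y0))"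
    by (simp add: integral_unique)
  also have "\<dots> = integral {0..1} (\<lambda>t. \<Sum>b\<in>Basis. ((y - y0) \<bullet> b) * ?D (?z t) b)"
  proof (rule integral_cong)
    fix t :: real assume "t \<in> {0..1}"
    from frechet_derivative_components[OF fd[OF zU[OF this]], of "y - y0"]
    show "?D (?z t) (y - y0) = (\<Sum>b\<in>Basis. ((y - y0) \<bullet> b) * ?D (?z t) b)" by simp
  qed
  also have "\<dots> = (\<Sum>b\<in>Basis. integral {0..1} (\<lambda>t. ((y - y0) \<bullet> b) * ?D (?z t) b))"
    by (intro integral_sum integrable_continuous_real continuous_intros continuous_on_compose2[OF contD])
      (use zU in auto)
  finally show ?thesis by (simp add: ray_mean_def)
qed

lemma ray_mean_center: "ray_mean y0 0 f y0 = f y0"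
  by (simp add: ray_mean_def)

section \<open>Smooth functions on a manifold\<close>

lemma smooth_on_of_open:
  assumes "open U" "S \<subseteq> U" "\<And>k. Ck k U f"
  shows "smooth_on S f"
  using assms unfolding smooth_on_def by blast

lemma smooth_onE:
  assumes "smooth_on S f" "x \<in> S"
  obtains U g where "open U" "x \<in> U" "\<And>k. Ck k U g" "\<forall>y\<in>S \<inter> U. g y = f y"
  using assms unfolding smooth_on_def by blast

lemma smooth_on_local:
  assumes "\<And>x. x \<in> S \<Longrightarrow> \<exists>T g. open T \<and> x \<in> T \<and> smooth_on (S \<inter> T) g \<and> (\<forall>y\<in>S \<inter> T. g y = f y)"
  shows "smooth_on S f"
  unfolding smooth_on_def
proof
  fix x assume "x \<in> S"
  from assms[OF this] obtain T g where T: "open T" "x \<in> T" "smooth_on (S \<inter> T) g" "\<forall>y\<in>S \<inter> T. g y = f y"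
    by blast
  obtain U g' where U: "open U" "x \<in> U" "\<And>k. Ck k U g'" "\<forall>y\<in>S \<inter> T \<inter> U. g' y = g y"
    by (rule smooth_onE[OF T(3) IntI[OF \<open>x \<in> S\<close> T(2)]]) (rule that)
  show "\<exists>U g. open U \<and> x \<in> U \<and> (\<forall>k. Ck k U g) \<and> (\<forall>y\<in>S \<inter> U. g y = f y)"
  proof (intro exI[of _ "U \<inter> T"] exI[of _ g'] conjI)
    show "\<forall>k. Ck k (U \<inter> T) g'"
      by (intro allI Ck_subset[OF U(3) Int_lower1])
  qed (use T U in auto)
qed

lemma smooth_on_compose:
  fixes f :: "'e::euclidean_space \<Rightarrow> 'f::euclidean_space"
  assumes "smooth_on S f" "smooth_on T g" "f ` S \<subseteq> T"
  shows "smooth_on S (\<lambda>x. g (f x))"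
  unfolding smooth_on_def
proof
  fix x assume x: "x \<in> S"
  obtain U f' where U: "open U" "x \<in> U" "\<And>k. Ck k U f'" "\<forall>y\<in>S \<inter> U. f' y = f y"
    by (rule smooth_onE[OF assms(1) x]) (rule that)
  obtain W g' where W: "open W" "f x \<in> W" "\<And>k. Ck k W g'" "\<forall>y\<in>T \<inter> W. g' y = g y"
    by (rule smooth_onE[OF assms(2) subsetD[OF assms(3) imageI[OF x]]]) (rule that)
  have "continuous_on U f'" using U(3)[of 0] by simp
  then have o: "open (U \<inter> f' -` W)" using U(1) W(1) by (rule continuous_open_preimage)
  have "Ck k (U \<inter> f' -` W) (\<lambda>x. g' (f' x))" for k
    by (rule Ck_compose[OF o W(1) _ Ck_subset[OF U(3)] W(3)]) auto
  moreover have "x \<in> U \<inter> f' -` W" using U W x by auto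
  moreover have "\<forall>y\<in>S \<inter> (U \<inter> f' -` W). g' (f' y) = g (f y)" using U W assms(3) by auto
  ultimately show "\<exists>U h. open U \<and> x \<in> U \<and> (\<forall>k. Ck k U h) \<and> (\<forall>y\<in>S \<inter> U. h y = g (f y))"
    using o by (intro exI[of _ "U \<inter> f' -` W"] exI[of _ "\<lambda>x. g' (f' x)"] conjI) simp_all
qed

lemma smooth_on_combine:
  fixes S :: "'e::euclidean_space set"
  assumes "smooth_on S f" "smooth_on S g"
    and F: "\<And>(U :: 'e set) k f' g'. open U \<Longrightarrow> Ck k U f' \<Longrightarrow> Ck k U g' \<Longrightarrow> Ck k U (\<lambda>x. F (f' x) (g' x))"
  shows "smooth_on S (\<lambda>x. F (f x) (g x))"
  unfolding smooth_on_def
proof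
  fix x assume x: "x \<in> S"
  obtain U f' where U: "open U" "x \<in> U" "\<And>k. Ck k U f'" "\<forall>y\<in>S \<inter> U. f' y = f y"
    by (rule smooth_onE[OF assms(1) x]) (rule that)
  obtain W g' where W: "open W" "x \<in> W" "\<And>k. Ck k W g'" "\<forall>y\<in>S \<inter> W. g' y = g y"
    by (rule smooth_onE[OF assms(2) x]) (rule that)
  have "Ck k (U \<inter> W) (\<lambda>x. F (f' x) (g' x))" for k
    by (rule F[OF open_Int[OF U(1) W(1)] Ck_subset[OF U(3)] Ck_subset[OF W(3)]]) auto
  then show "\<exists>U h. open U \<and> x \<in> U \<and> (\<forall>k. Ck k U h) \<and> (\<forall>y\<in>S \<inter> U. h y = F (f y) (g y))"
    using U W by (intro exI[of _ "U \<inter> W"] exI[of _ "\<lambda>x. F (f' x) (g' x)"]) auto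
qed

lemma smooth_on_scaleR: "smooth_on S f \<Longrightarrow> smooth_on S g \<Longrightarrow> smooth_on S (\<lambda>x. f x *\<^sub>R g x)"
  by (rule smooth_on_combine[where F = scaleR]) (assumption+, rule Ck_scaleR)

lemma smooth_on_add: "smooth_on S f \<Longrightarrow> smooth_on S g \<Longrightarrow> smooth_on S (\<lambda>x. f x + g x)"
  by (rule smooth_on_combine[where F = plus]) (assumption+, rule Ck_add)

lemma smooth_on_const: "smooth_on S (\<lambda>x. c)"
  by (rule smooth_on_of_open[OF open_UNIV]) (auto intro: Ck_const)

lemma smooth_functions_const: "(\<lambda>x. c) \<in> smooth_functions A"
  by (auto simp: smooth_functions_def o_def smooth_on_const)

lemma smooth_functions_mult:
  assumes "f \<in> smooth_functions A" "g \<in> smooth_functions A"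
  shows "(\<lambda>x. f x * g x) \<in> smooth_functions A"
  unfolding smooth_functions_def
proof clarify
  fix U \<phi> assume "(U, \<phi>) \<in> A"
  then have "smooth_on (\<phi> ` U) (f \<circ> inv_into U \<phi>)" "smooth_on (\<phi> ` U) (g \<circ> inv_into U \<phi>)"
    using assms by (auto simp: smooth_functions_def)
  from smooth_on_scaleR[OF this] show "smooth_on (\<phi> ` U) ((\<lambda>x. f x * g x) \<circ> inv_into U \<phi>)"
    by (simp add: o_def)
qed

lemma smooth_functions_add:
  assumes "f \<in> smooth_functions A" "g \<in> smooth_functions A"
  shows "(\<lambda>x. f x + g x) \<in> smooth_functions A"
  using assms by (auto simp: smooth_functions_def o_def intro!: smooth_on_add)

lemma bump_times_smooth:
  fixes b :: "'e::euclidean_space"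
  assumes "r < s" and G: "\<And>k. Ck k UNIV G" "\<And>y. y \<notin> cball b r \<Longrightarrow> G y = (0::real)"
    and g: "\<And>k. Ck k (ball b s) g"
  shows "Ck k UNIV (\<lambda>y. if y \<in> ball b s then G y * g y else 0)" (is "Ck k UNIV ?h")
proof (rule Ck_local)
  fix x :: 'e
  show "\<exists>W. open W \<and> x \<in> W \<and> Ck k W ?h"
  proof (cases "x \<in> ball b s")
    case True
    have "Ck k (ball b s) (\<lambda>y. G y *\<^sub>R g y)"
      by (intro Ck_scaleR g Ck_subset[OF G(1)]) auto
    then have "Ck k (ball b s) ?h"
      by (intro Ck_cong[OF open_ball, of b s "\<lambda>y. G y *\<^sub>R g y" ?h]) auto
    then show ?thesis using True open_ball by blast
  next
    case False
    have "Ck k (- cball b r) ?h"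
      by (intro Ck_cong[OF _ _ Ck_const[of k _ 0]]) (auto simp: G(2))
    then show ?thesis using False \<open>r < s\<close> by (intro exI[of _ "- cball b r"]) auto
  qed
qed

context
  fixes V :: "'e::euclidean_space set"
    and A :: "('a::{t2_space,second_countable_topology}, 'e) atlas"
  assumes M: "smooth_manifold V A"
begin

lemma chart_facts:
  assumes "(U, \<phi>) \<in> A"
  shows "open U" "openin (top_of_set V) (\<phi> ` U)" "homeomorphism U (\<phi> ` U) \<phi> (inv_into U \<phi>)"
    "subspace V" "\<And>q. q \<in> U \<Longrightarrow> inv_into U \<phi> (\<phi> q) = q" "\<And>q. q \<in> U \<Longrightarrow> \<phi> q \<in> V"
proof -
  show *: "open U" "openin (top_of_set V) (\<phi> ` U)" "homeomorphism U (\<phi> ` U) \<phi> (inv_into U \<phi>)" "subspace V"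
    using M assms unfolding smooth_manifold_def by blast+
  show "inv_into U \<phi> (\<phi> q) = q" if "q \<in> U" for q using homeomorphism_apply1[OF *(3) that] .
  show "\<phi> q \<in> V" if "q \<in> U" for q using openin_imp_subset[OF *(2)] that by auto
qed

lemma chart_image_openin:
  assumes "(W, \<psi>) \<in> A" "open T"
  obtains T' where "open T'" "\<psi> ` (W \<inter> T) = \<psi> ` W \<inter> T'"
proof -
  have "openin (top_of_set W) (W \<inter> T)" using assms(2) by (simp add: openin_open_Int)
  then have "openin (top_of_set (\<psi> ` W)) (\<psi> ` (W \<inter> T))"
    using homeomorphism_imp_open_map[OF chart_facts(3)[OF assms(1)]] by blast
  then show ?thesis using that by (auto simp: openin_open)
qed

text \<open>The support is compact, hence closed in the Hausdorff space \<open>'a\<close>. So every point has a neighbourhood that lies either in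
the chart, where the function is smooth by the compatibility of charts, or off the support, where it is zero.\<close>

lemma extend_by_zero_smooth:
  assumes U: "(U, \<phi>) \<in> A" and G: "\<And>k. Ck k UNIV G" "\<And>y. y \<notin> cball b r \<Longrightarrow> G y = 0"
    and sub: "cball b r \<inter> V \<subseteq> \<phi> ` U"
  shows "(\<lambda>q. if q \<in> U then G (\<phi> q) else 0) \<in> smooth_functions A" (is "?f \<in> _")
  unfolding smooth_functions_def
proof (clarify)
  fix W \<psi> assume W: "(W, \<psi>) \<in> A"
  note u = chart_facts[OF U] and w = chart_facts[OF W]
  let ?K = "inv_into U \<phi> ` (cball b r \<inter> V)"
  have "compact (cball b r \<inter> V)" using closed_subspace[OF u(4)] by (simp add: compact_Int_closed)
  moreover have "continuous_on (cball b r \<inter> V) (inv_into U \<phi>)"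
    using u(3) sub continuous_on_subset by (auto simp: homeomorphism_def)
  ultimately have K: "closed ?K" using compact_continuous_image compact_imp_closed by blast
  show "smooth_on (\<psi> ` W) (?f \<circ> inv_into W \<psi>)"
  proof (rule smooth_on_local)
    fix x assume "x \<in> \<psi> ` W"
    then obtain z where z: "z \<in> W" "x = \<psi> z" by auto
    show "\<exists>T g. open T \<and> x \<in> T \<and> smooth_on (\<psi> ` W \<inter> T) g \<and> (\<forall>y\<in>\<psi> ` W \<inter> T. g y = (?f \<circ> inv_into W \<psi>) y)"
    proof (cases "z \<in> U")
      case True
      obtain T where T: "open T" "\<psi> ` (W \<inter> U) = \<psi> ` W \<inter> T" using chart_image_openin[OF W u(1)] .
      have "smooth_on (\<psi> ` (W \<inter> U)) (\<phi> \<circ> inv_into W \<psi>)"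
        using M U W unfolding smooth_manifold_def by blast
      moreover have "smooth_on UNIV G" by (rule smooth_on_of_open[OF open_UNIV]) (auto simp: G)
      ultimately have "smooth_on (\<psi> ` (W \<inter> U)) (\<lambda>y. G ((\<phi> \<circ> inv_into W \<psi>) y))"
        by (rule smooth_on_compose) auto
      moreover have "\<forall>y\<in>\<psi> ` (W \<inter> U). G ((\<phi> \<circ> inv_into W \<psi>) y) = (?f \<circ> inv_into W \<psi>) y"
        using w(5) by auto
      moreover have "x \<in> T" using z True T by auto
      ultimately show ?thesis
        using T(1) unfolding T(2) by (intro exI[of _ T] exI[of _ "\<lambda>y. G ((\<phi> \<circ> inv_into W \<psi>) y)"] conjI)
    next
      case False
      obtain T where T: "open T" "\<psi> ` (W \<inter> - ?K) = \<psi> ` W \<inter> T"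
        using chart_image_openin[OF W, of "- ?K"] K by (metis open_Compl)
      have "?K \<subseteq> U" using sub u(5) by auto
      then have "x \<in> \<psi> ` (W \<inter> - ?K)" using z False by blast
      then have "x \<in> T" unfolding T(2) by blast
      moreover have zero: "\<forall>y\<in>\<psi> ` (W \<inter> - ?K). 0 = (?f \<circ> inv_into W \<psi>) y"
      proof clarify
        fix q assume q: "q \<in> W" "q \<notin> ?K"
        have "G (\<phi> q) = 0" if "q \<in> U"
        proof (rule G(2), rule notI)
          assume "\<phi> q \<in> cball b r"
          then have "q \<in> ?K" using u(5,6)[OF that] by (metis IntI imageI)
          then show False using q by simp
        qed
        then show "0 = (?f \<circ> inv_into W \<psi>) (\<psi> q)" using w(5) q by auto
      qed
      ultimately show ?thesis
        using T(1) by (intro exI[of _ T] exI[of _ "\<lambda>_. 0"] conjI smooth_on_const zero[unfolded T(2)])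
    qed
  qed
qed

end

section \<open>Local frames\<close>

lemma linear_projection_exists:
  fixes V :: "'e::euclidean_space set"
  assumes "subspace V"
  obtains P where "linear P" "\<And>y. P y \<in> V" "\<And>y. y \<in> V \<Longrightarrow> P y = y"
proof -
  have "linear (\<lambda>x::'e. x)" by (rule linear_id[unfolded id_def])
  then obtain P where P: "range P \<subseteq> V" "linear P" "\<forall>v\<in>V. P v = v"
    using linear_exists_left_inverse_on[of "\<lambda>x. x" V] assms by (auto simp: inj_on_def)
  show ?thesis by (rule that[OF P(2)]) (use P in auto)
qed

lemma frechet_derivative_lincomb:
  assumes "(f has_derivative f') (at y)" "(g has_derivative g') (at y)"
  shows "frechet_derivative (\<lambda>y. a * f y + b * g y) (at y) v = a * f' v + (b::real) * g' v"
proof -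
  have "((\<lambda>y. a * f y + b * g y) has_derivative (\<lambda>v. a * f' v + b * g' v)) (at y)"
    using assms by (auto intro!: derivative_eq_intros)
  then show ?thesis by (simp add: frechet_derivative_at[symmetric])
qed

lemma frechet_derivative_mult:
  assumes "(f has_derivative f') (at y)" "(g has_derivative g') (at y)"
  shows "frechet_derivative (\<lambda>y. f y * g y) (at y) v = f y * g' v + g y * (f' v :: real)"
proof -
  have "((\<lambda>y. f y * g y) has_derivative (\<lambda>v. f y * g' v + f' v * g y)) (at y)"
    using assms by (auto intro!: derivative_eq_intros)
  then show ?thesis by (simp add: frechet_derivative_at[symmetric] mult.commute)
qed

text \<open>Near a point of a chart, functions on the manifold become functions on a ball of the whole space \<open>'e\<close> by composition
with a linear projection \<open>P\<close> onto \<open>V\<close>. The derivatives in the directions of all basis vectors of \<open>'e\<close> then serve as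
coordinate fields; they are linearly dependent if \<open>V\<close> is a proper subspace.\<close>

locale chart_ball =
  fixes V :: "'e::euclidean_space set"
    and A :: "('a::{t2_space,second_countable_topology}, 'e) atlas"
    and U :: "'a set" and \<phi> :: "'a \<Rightarrow> 'e" and P :: "'e \<Rightarrow> 'e" and b :: 'e and r s :: real
  assumes M: "smooth_manifold V A" and chart: "(U, \<phi>) \<in> A"
    and P: "linear P" "\<And>y. y \<in> V \<Longrightarrow> P y = y" and ball: "P ` ball b s \<subseteq> \<phi> ` U" and r: "0 < r" "r < s"
begin

lemmas chart_facts' = chart_facts[OF M chart]

definition local_rep :: "('a \<Rightarrow> real) \<Rightarrow> 'e \<Rightarrow> real" where
  "local_rep f y = f (inv_into U \<phi> (P y))"

lemma cball_sub: "cball b r \<inter> V \<subseteq> \<phi> ` U"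
proof
  fix y assume "y \<in> cball b r \<inter> V"
  then have "P y = y" "y \<in> ball b s" using P r by auto
  then show "y \<in> \<phi> ` U" using ball by force
qed

lemma local_rep_chart: "q \<in> U \<Longrightarrow> local_rep f (\<phi> q) = f q"
  using chart_facts' P by (simp add: local_rep_def)

lemma smooth_local_rep:
  assumes "f \<in> smooth_functions A"
  shows "Ck k (ball b s) (local_rep f)"
proof (rule Ck_local)
  fix y assume y: "y \<in> ball b s"
  have "smooth_on (\<phi> ` U) (f \<circ> inv_into U \<phi>)" using assms chart by (auto simp: smooth_functions_def)
  then obtain W g where W: "open W" "P y \<in> W" "\<And>k. Ck k W g"
    "\<forall>z\<in>\<phi> ` U \<inter> W. g z = (f \<circ> inv_into U \<phi>) z"
    by (rule smooth_onE) (use y ball in auto)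
  have bl: "bounded_linear P" using P(1) linear_conv_bounded_linear by blast
  let ?T = "ball b s \<inter> P -` W"
  have o: "open ?T"
    by (intro continuous_open_preimage linear_continuous_on bl W open_ball)
  have "Ck k ?T (\<lambda>y. g (P y))"
    by (rule Ck_compose[OF o W(1) _ Ck_linear[OF bl] W(3)]) auto
  then have "Ck k ?T (local_rep f)"
    by (intro Ck_cong[OF o, of "\<lambda>y. g (P y)" "local_rep f"])
      (use W(4) ball in \<open>auto simp: local_rep_def image_subset_iff\<close>)
  then show "\<exists>T. open T \<and> y \<in> T \<and> Ck k T (local_rep f)"
    using o y W(2) by (intro exI[of _ ?T]) auto
qed

definition cutoff :: "('e \<Rightarrow> real) \<Rightarrow> bool" where
  "cutoff G \<longleftrightarrow> (\<forall>k. Ck k UNIV G) \<and> (\<forall>y. y \<notin> cball b r \<longrightarrow> G y = 0)"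

text \<open>\<open>cut G g\<close> is the global function that is \<open>G g\<close> in the chart; the factor \<open>G\<close> vanishes near the boundary of the ball,
so \<open>g\<close> matters only inside.\<close>

definition cut :: "('e \<Rightarrow> real) \<Rightarrow> ('e \<Rightarrow> real) \<Rightarrow> 'a \<Rightarrow> real" where
  "cut G g q = (if q \<in> U then G (\<phi> q) * g (\<phi> q) else 0)"

lemma cut_smooth:
  assumes "cutoff G" "\<And>k. Ck k (ball b s) g"
  shows "cut G g \<in> smooth_functions A"
proof -
  let ?h = "\<lambda>y. if y \<in> ball b s then G y * g y else 0"
  have "Ck k UNIV ?h" for k
    by (rule bump_times_smooth[OF r(2)]) (use assms in \<open>auto simp: cutoff_def simp del: mem_cball\<close>)
  then have "(\<lambda>q. if q \<in> U then ?h (\<phi> q) else 0) \<in> smooth_functions A"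
    by (rule extend_by_zero_smooth[OF M chart _ _ cball_sub]) (use assms(1) in \<open>auto simp: cutoff_def\<close>)
  also have "(\<lambda>q. if q \<in> U then ?h (\<phi> q) else 0) = cut G g"
    using assms(1) r by (auto simp: cut_def cutoff_def)
  finally show ?thesis .
qed

definition coordinate_field :: "('e \<Rightarrow> real) \<Rightarrow> 'e \<Rightarrow> 'a \<Rightarrow> 'a tangent" where
  "coordinate_field G i q f =
     (if f \<in> smooth_functions A then cut G (\<lambda>y. frechet_derivative (local_rep f) (at y) i) q else 0)"

lemma coordinate_field_in: 
  assumes G: "cutoff G"
  shows "coordinate_field G i \<in> vector_fields A"
  unfolding vector_fields_def
proof (intro CollectI conjI allI ballI)
  fix f assume f: "f \<in> smooth_functions A"
  show "(\<lambda>p. coordinate_field G i p f) \<in> smooth_functions A"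
    unfolding coordinate_field_def
    using cut_smooth[OF G, of "\<lambda>y. frechet_derivative (local_rep f) (at y) i"] smooth_local_rep[OF f, of "Suc _"] f
    by simp
next
  fix q
  show "coordinate_field G i q \<in> tangent_space A q"
  proof (cases "q \<in> U \<and> \<phi> q \<in> ball b s")
    case True
    have d: "(local_rep f has_derivative frechet_derivative (local_rep f) (at (\<phi> q))) (at (\<phi> q))"
      if "f \<in> smooth_functions A" for f
      using has_frechet_derivative[OF smooth_local_rep[OF that, of "Suc 0"]] True by blast
    show ?thesis
      unfolding tangent_space_def
    proof (intro CollectI conjI ballI allI impI)
      fix f g and c d :: real assume f: "f \<in> smooth_functions A" "g \<in> smooth_functions A"
      have "(\<lambda>x. c * f x + d * g x) \<in> smooth_functions A"
        by (intro smooth_functions_add smooth_functions_mult smooth_functions_const f)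
      moreover have "local_rep (\<lambda>x. c * f x + d * g x) = (\<lambda>y. c * local_rep f y + d * local_rep g y)"
        by (rule ext) (simp add: local_rep_def)
      ultimately show "coordinate_field G i q (\<lambda>x. c * f x + d * g x)
          = c * coordinate_field G i q f + d * coordinate_field G i q g"
        using f True by (simp add: coordinate_field_def cut_def frechet_derivative_lincomb[OF d d] algebra_simps)
    next
      fix f g assume f: "f \<in> smooth_functions A" "g \<in> smooth_functions A"
      have "(\<lambda>x. f x * g x) \<in> smooth_functions A"
        by (intro smooth_functions_mult f)
      moreover have "local_rep (\<lambda>x. f x * g x) = (\<lambda>y. local_rep f y * local_rep g y)"
        by (rule ext) (simp add: local_rep_def)
      ultimately show "coordinate_field G i q (\<lambda>x. f x * g x)
          = f q * coordinate_field G i q g + g q * coordinate_field G i q f"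
        using f True by (simp add: coordinate_field_def cut_def frechet_derivative_mult[OF d d] local_rep_chart algebra_simps)
    qed (simp add: coordinate_field_def)
  next
    case False
    then have "coordinate_field G i q = (\<lambda>f. 0)"
      using G r by (auto simp: coordinate_field_def cut_def cutoff_def)
    then show ?thesis by (simp add: tangent_space_def)
  qed
qed

lemma cutoff_exists: "\<exists>G. cutoff G \<and> G b = 1"
  using bump_exists[OF r(1), of b] by (rule ex_forward) (auto simp: cutoff_def)

lemma cutoff_mult:
  assumes "cutoff G" "\<And>k. Ck k UNIV g"
  shows "cutoff (\<lambda>y. G y * g y)"
  using assms Ck_scaleR[OF open_UNIV, of _ G g] by (simp add: cutoff_def)

text \<open>A derivation at \<open>q\<close> is determined by its values on the cut-off coordinates \<open>G y\<^sub>i\<close> and on the cut-off function \<open>G\<close>.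
With \<open>k\<close> for the function \<open>G\<close> and \<open>x\<^sub>i\<close> for \<open>k y\<^sub>i\<close>, Hadamard's lemma gives
\<open>k\<^sup>2 f = k\<^sup>2 f(q) + \<Sum>\<^sub>i (x\<^sub>i - y\<^sub>i(q) k) (k g\<^sub>i)\<close>, to which the derivation is applied. The terms with \<open>v k\<close>, which
arise because \<open>k\<close> is not constant near \<open>q\<close>, are collected in the second summand.\<close>

lemma derivation_expansion:
  assumes G: "cutoff G" and v: "v \<in> tangent_space A q" and f: "f \<in> smooth_functions A"
  shows "(cut G (\<lambda>y. 1) q)\<^sup>2 * v f =
    (\<Sum>i\<in>Basis. v (cut G (\<lambda>y. y \<bullet> i)) * coordinate_field G i q f
       + v (cut G (\<lambda>y. 1)) * coordinate_field (\<lambda>y. G y * (- (y \<bullet> i))) i q f)"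
proof (cases "q \<in> U \<and> \<phi> q \<in> ball b s")
  case False
  then have "cut G g q = 0" for g using G r by (auto simp: cut_def cutoff_def)
  moreover have "cut (\<lambda>y. G y * (- (y \<bullet> i))) g q = 0" for g i
    using False G r by (auto simp: cut_def cutoff_def)
  ultimately show ?thesis using f by (simp add: coordinate_field_def)
next
  case True
  let ?y0 = "\<phi> q" and ?F = "local_rep f"
  let ?k = "cut G (\<lambda>y. 1)" and ?x = "\<lambda>i. cut G (\<lambda>y. y \<bullet> i)"
  define g where "g i = ray_mean ?y0 0 (\<lambda>z. frechet_derivative ?F (at z) i)" for i
  have gs: "Ck k (ball b s) (g i)" for k i
    unfolding g_def
    by (rule smooth_ray_mean) (use True smooth_local_rep[OF f, of "Suc _"] in auto)
  note C = smooth_functions_add smooth_functions_mult smooth_functions_const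
  have k: "?k \<in> smooth_functions A"
    by (rule cut_smooth[OF G]) (rule Ck_const)
  have x: "?x i \<in> smooth_functions A" for i
    by (rule cut_smooth[OF G]) (rule Ck_linear[OF bounded_linear_inner_left])
  have gi: "cut G (g i) \<in> smooth_functions A" for i
    by (rule cut_smooth[OF G gs])
  have v_lin: "v (\<lambda>x. c * h1 x + d * h2 x) = c * v h1 + d * v h2"
    and v_mult: "v (\<lambda>x. h1 x * h2 x) = h1 q * v h2 + h2 q * v h1"
    if "h1 \<in> smooth_functions A" "h2 \<in> smooth_functions A" for h1 h2 c d
    using v that by (auto simp: tangent_space_def)
  have v_sum: "v (\<lambda>x. \<Sum>i\<in>I. h i x) = (\<Sum>i\<in>I. v (h i)) \<and> (\<lambda>x. \<Sum>i\<in>I. h i x) \<in> smooth_functions A"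
    if "finite I" "\<And>i. i \<in> I \<Longrightarrow> h i \<in> smooth_functions A" for I :: "'e set" and h
    using that
  proof (induction I)
    case empty
    have "v (\<lambda>x. 0) = 0" using v_lin[of "\<lambda>x. 0" "\<lambda>x. 0" 0 0] by (simp add: C)
    then show ?case by (simp add: C)
  next
    case (insert j I)
    then show ?case using v_lin[of "h j" "\<lambda>x. \<Sum>i\<in>I. h i x" 1 1] by (simp add: C)
  qed
  have v_cmult: "v (\<lambda>x. c * h x) = c * v h" if "h \<in> smooth_functions A" for c h
    using v_lin[OF that that, of c 0] by simp
  let ?u = "\<lambda>i x. ?x i x + (- (?y0 \<bullet> i)) * ?k x"
  have u: "?u i \<in> smooth_functions A" for i by (intro C x k)
  have vu: "v (?u i) = v (?x i) - (?y0 \<bullet> i) * v ?k" for i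
    using v_lin[OF x[of i] k, of 1 "- (?y0 \<bullet> i)"] by simp
  have vug: "v (\<lambda>p. ?u i p * cut G (g i) p) = cut G (g i) q * v (?u i)" for i
    using v_mult[OF u gi, of i i] True by (simp add: cut_def)
  \<comment> \<open>Hadamard's expansion of \<open>f\<close> at \<open>q\<close>, multiplied by the square of the cut-off function so that all
    factors are globally defined.\<close>
  have "?k p * (?k p * f p) = f q * (?k p * ?k p) + (\<Sum>i\<in>Basis. ?u i p * cut G (g i) p)" for p
  proof (cases "p \<in> U \<and> \<phi> p \<in> ball b s")
    case False
    then have "cut G h p = 0" for h using G r by (auto simp: cut_def cutoff_def)
    then show ?thesis by simp
  next
    case p: True
    have "?F (\<phi> p) = ?F ?y0 + (\<Sum>i\<in>Basis. ((\<phi> p - ?y0) \<bullet> i) * g i (\<phi> p))"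
      unfolding g_def by (rule hadamard[where U = "ball b s"]) (use True p smooth_local_rep[OF f] in auto)
    then have "f p = f q + (\<Sum>i\<in>Basis. ((\<phi> p - ?y0) \<bullet> i) * g i (\<phi> p))"
      using p True by (simp add: local_rep_chart)
    then show ?thesis using p
      by (simp add: cut_def sum_distrib_left algebra_simps inner_diff_left)
  qed
  moreover have ug: "(\<lambda>p. ?u i p * cut G (g i) p) \<in> smooth_functions A" for i
    by (rule smooth_functions_mult[OF u gi])
  ultimately have "v (\<lambda>p. ?k p * (?k p * f p)) = v (\<lambda>p. f q * (?k p * ?k p) + 1 * (\<Sum>i\<in>Basis. ?u i p * cut G (g i) p))"
    by simp
  also have "\<dots> = f q * v (\<lambda>p. ?k p * ?k p) + (\<Sum>i\<in>Basis. v (\<lambda>p. ?u i p * cut G (g i) p))"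
    using v_lin[OF smooth_functions_mult[OF k k] conjunct2[OF v_sum[OF finite_Basis ug]], of "f q" 1]
      conjunct1[OF v_sum[OF finite_Basis ug]] by simp
  also have "\<dots> = f q * v (\<lambda>p. ?k p * ?k p) + (\<Sum>i\<in>Basis. cut G (g i) q * v (?u i))"
    by (simp only: vug)
  finally have "?k q * (?k q * v f + f q * v ?k) + ?k q * f q * v ?k =
      f q * (2 * ?k q * v ?k) + (\<Sum>i\<in>Basis. cut G (g i) q * v (?u i))"
    using v_mult[OF k smooth_functions_mult[OF k f]] v_mult[OF k f] v_mult[OF k k] by simp
  then have "(?k q)\<^sup>2 * v f = (\<Sum>i\<in>Basis. cut G (g i) q * v (?u i))"
    by (simp add: algebra_simps power2_eq_square)
  also have "\<dots> = (\<Sum>i\<in>Basis. v (?x i) * coordinate_field G i q f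
       + v ?k * coordinate_field (\<lambda>y. G y * (- (y \<bullet> i))) i q f)"
  proof (rule sum.cong[OF refl])
    fix i :: 'e
    have "cut G (g i) q = coordinate_field G i q f"
      using f True by (simp add: coordinate_field_def cut_def g_def ray_mean_center)
    moreover have "coordinate_field (\<lambda>y. G y * (- (y \<bullet> i))) i q f = - (?y0 \<bullet> i) * coordinate_field G i q f"
      using f True by (simp add: coordinate_field_def cut_def)
    ultimately show "cut G (g i) q * v (?u i) = v (?x i) * coordinate_field G i q f
       + v ?k * coordinate_field (\<lambda>y. G y * (- (y \<bullet> i))) i q f"
      by (simp only: vu) (simp add: algebra_simps)
  qed
  finally show ?thesis .
qed

end

text \<open>Everything that the proof needs to know about the manifold beyond the algebra of its smooth functions: up to a function
\<open>h\<close> with \<open>h p = 1\<close>, tangent vectors at all points are combinations of finitely many global vector fields, with global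
functions as coordinates. The factor \<open>h\<close> takes the place of a partition of unity.\<close>

lemma local_frame:
  assumes M: "smooth_manifold V (A :: ('a::{t2_space,second_countable_topology}, 'e::euclidean_space) atlas)"
  shows "\<exists>(N::nat) x E. \<exists>h\<in>smooth_functions A. h p = 1 \<and>
    (\<forall>i<N. x i \<in> smooth_functions A \<and> E i \<in> vector_fields A) \<and>
    (\<forall>q. \<forall>v\<in>tangent_space A q. \<forall>f\<in>smooth_functions A. h q * v f = (\<Sum>i<N. v (x i) * E i q f))"
proof -
  have "p \<in> (\<Union>(U, \<phi>)\<in>A. U)" using M by (simp add: smooth_manifold_def)
  then obtain U \<phi> where chart: "(U, \<phi>) \<in> A" and p: "p \<in> U" by blast
  note cf = chart_facts[OF M chart]
  obtain P where P: "linear P" "\<And>y. P y \<in> V" "\<And>y. y \<in> V \<Longrightarrow> P y = y"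
    using linear_projection_exists[OF cf(4)] by metis
  let ?b = "\<phi> p"
  obtain T where T: "open T" "\<phi> ` U = V \<inter> T" using cf(2) by (auto simp: openin_open)
  have "continuous_on UNIV P" using P(1) by (simp add: linear_continuous_on linear_conv_bounded_linear)
  then have "open (P -` T)" using T(1) by (simp add: continuous_on_open_vimage[OF open_UNIV])
  moreover have "?b \<in> P -` T" using p T(2) P(3)[OF cf(6)[OF p]] by auto
  ultimately obtain s where s: "s > 0" "ball ?b s \<subseteq> P -` T" using open_contains_ball by metis
  interpret chart_ball V A U \<phi> P ?b "s / 2" s
    by (rule chart_ball.intro) (use M chart P s T in auto)
  obtain G where cG: "cutoff G" and G: "G ?b = 1" using cutoff_exists by blast
  have lin: "Ck k W (\<lambda>y. y \<bullet> i)" for k W and i :: 'e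
    by (rule Ck_linear[OF bounded_linear_inner_left])
  have cG': "cutoff (\<lambda>y. G y * (- (y \<bullet> i)))" for i
    by (rule cutoff_mult[OF cG])
      (use Ck_linear[OF bounded_linear_minus[OF bounded_linear_inner_left]] in auto)
  \<comment> \<open>Two families indexed by the standard basis: one for the coordinates, one for the cut-off function.\<close>
  let ?I = "(Basis :: 'e set) \<times> (UNIV :: bool set)"
  define x where "x = (\<lambda>(i, c). if c then cut G (\<lambda>y. y \<bullet> i) else cut G (\<lambda>y. 1))"
  define E where "E = (\<lambda>(i, c). if c then coordinate_field G i else coordinate_field (\<lambda>y. G y * (- (y \<bullet> i))) i)"
  obtain e where e: "bij_betw e {0..<card ?I} ?I" using ex_bij_betw_nat_finite[of ?I] by auto
  have inC: "x j \<in> smooth_functions A" "E j \<in> vector_fields A" for j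
    using cut_smooth[OF cG lin] cut_smooth[OF cG Ck_const] coordinate_field_in cG cG'
    by (auto simp: x_def E_def split: prod.split)
  let ?h = "\<lambda>q. cut G (\<lambda>y. 1) q * cut G (\<lambda>y. 1) q"
  have 1: "?h \<in> smooth_functions A"
    by (intro smooth_functions_mult cut_smooth[OF cG] Ck_const)
  have 2: "?h p = 1" using p G by (simp add: cut_def)
  have 3: "?h q * v f = (\<Sum>i<card ?I. v ((x \<circ> e) i) * (E \<circ> e) i q f)"
    if "v \<in> tangent_space A q" "f \<in> smooth_functions A" for q v f
  proof -
    have "(\<Sum>i<card ?I. v ((x \<circ> e) i) * (E \<circ> e) i q f) = (\<Sum>j\<in>?I. v (x j) * E j q f)"
      using sum.reindex_bij_betw[OF e, of "\<lambda>j. v (x j) * E j q f"] by (simp add: atLeast0LessThan)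
    also have "\<dots> = (\<Sum>i\<in>Basis. \<Sum>c\<in>UNIV. v (x (i, c)) * E (i, c) q f)"
      by (simp add: sum.cartesian_product)
    also have "\<dots> = ?h q * v f"
      using derivation_expansion[OF cG that] by (simp add: UNIV_bool x_def E_def power2_eq_square add.commute)
    finally show ?thesis by simp
  qed
  show ?thesis
    using 1 2 3 inC
    by (intro exI[of _ "card ?I"] exI[of _ "x \<circ> e"] exI[of _ "E \<circ> e"] bexI[of _ ?h]) auto
qed

section \<open>Multilinear expansion\<close>

lemma length_omit [simp]: "i < length xs \<Longrightarrow> length (omit i xs) = length xs - 1"
  by (simp add: omit_def)

lemma nth_omit:
  assumes "i < length xs" "j < length xs - 1"
  shows "omit i xs ! j = xs ! (if j < i then j else Suc j)"
  using assms by (auto simp: omit_def nth_append min_def)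

lemma set_omit_subset: "set xs \<subseteq> S \<Longrightarrow> set (omit i xs) \<subseteq> S"
  using set_take_subset[of i xs] set_drop_subset[of "Suc i" xs] by (auto simp: omit_def)

lemma omit_0_Cons [simp]: "omit 0 (x # xs) = xs"
  by (simp add: omit_def)

lemma omit_Suc_Cons [simp]: "omit (Suc i) (x # xs) = x # omit i xs"
  by (simp add: omit_def)

lemma omit_update [simp]: "omit i (xs[i := x]) = omit i xs"
  by (simp add: omit_def)

lemma map_omit: "map f (omit i xs) = omit i (map f xs)"
  by (simp add: omit_def take_map drop_map)

lemma list_update_subset: "set xs \<subseteq> S \<Longrightarrow> x \<in> S \<Longrightarrow> set (xs[i := x]) \<subseteq> S"
  using set_update_subset_insert[of xs i x] by auto

definition tuples :: "nat \<Rightarrow> nat \<Rightarrow> nat list set" where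
  "tuples N k = {I. length I = k \<and> set I \<subseteq> {..<N}}"

lemma finite_tuples [simp]: "finite (tuples N k)"
  using finite_lists_length_eq[of "{..<N}" k] by (simp add: tuples_def conj_commute)

lemma sum_tuples_Suc: "(\<Sum>I\<in>tuples N (Suc k). f I) = (\<Sum>i<N. \<Sum>I\<in>tuples N k. f (i # I))"
proof -
  have "tuples N (Suc k) = (\<lambda>(i, I). i # I) ` ({..<N} \<times> tuples N k)"
    by (auto simp: tuples_def length_Suc_conv image_iff)
  moreover have "inj_on (\<lambda>(i, I). i # I) ({..<N} \<times> tuples N k)" by (auto simp: inj_on_def)
  ultimately have "(\<Sum>I\<in>tuples N (Suc k). f I) = (\<Sum>(i, I)\<in>{..<N} \<times> tuples N k. f (i # I))"
    by (simp add: sum.reindex case_prod_beta')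
  then show ?thesis by (simp add: sum.cartesian_product)
qed

lemma sum_tuples_0 [simp]: "(\<Sum>I\<in>tuples N 0. f I) = f []"
proof -
  have "tuples N 0 = {[]}" by (auto simp: tuples_def)
  then show ?thesis by simp
qed

text \<open>Multilinearity is assumed only as an expansion of a single slot, up to a common factor \<open>h\<close>, so that the lemma also covers
families \<open>E\<close> that span only where \<open>h\<close> does not vanish.\<close>

lemma multilinear_expand:
  fixes F :: "'v list \<Rightarrow> real"
  assumes E: "\<And>i. i < N \<Longrightarrow> E i \<in> S"
    and slot: "\<And>us v ws. Suc (length us + length ws) = k \<Longrightarrow> set us \<subseteq> S \<Longrightarrow> v \<in> S \<Longrightarrow> set ws \<subseteq> S \<Longrightarrow>
      h * F (us @ v # ws) = (\<Sum>i<N. c v i * F (us @ E i # ws))"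
    and "length us + length vs = k" "set us \<subseteq> S" "set vs \<subseteq> S"
  shows "h ^ length vs * F (us @ vs) = (\<Sum>I\<in>tuples N (length vs). (\<Prod>j<length vs. c (vs ! j) (I ! j)) * F (us @ map E I))"
  using assms(3-5)
proof (induction vs arbitrary: us)
  case Nil
  then show ?case by simp
next
  case (Cons v vs)
  have "h ^ length (v # vs) * F (us @ v # vs) = h ^ length vs * (\<Sum>i<N. c v i * F ((us @ [E i]) @ vs))"
    using slot[of us vs v] Cons.prems by (simp add: mult.assoc mult.left_commute)
  also have "\<dots> = (\<Sum>i<N. c v i * (h ^ length vs * F ((us @ [E i]) @ vs)))"
    by (simp add: sum_distrib_left mult.left_commute)
  also have "\<dots> = (\<Sum>i<N. c v i * (\<Sum>I\<in>tuples N (length vs).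
      (\<Prod>j<length vs. c (vs ! j) (I ! j)) * F ((us @ [E i]) @ map E I)))"
    by (intro sum.cong refl arg_cong2[where f = "(*)"] Cons.IH) (use Cons.prems E in auto)
  also have "\<dots> = (\<Sum>I\<in>tuples N (Suc (length vs)).
      (\<Prod>j<Suc (length vs). c ((v # vs) ! j) (I ! j)) * F (us @ map E I))"
    unfolding sum_tuples_Suc prod.lessThan_Suc_shift
    by (simp add: sum_distrib_left mult.assoc)
  finally show ?case by simp
qed

section \<open>Alternating forms\<close>

definition linear_space :: "('x \<Rightarrow> real) set \<Rightarrow> bool" where
  "linear_space W \<longleftrightarrow> (\<forall>u\<in>W. \<forall>v\<in>W. \<forall>a b. (\<lambda>x. a * u x + b * v x) \<in> W)"

lemma linear_spaceD: "linear_space W \<Longrightarrow> u \<in> W \<Longrightarrow> v \<in> W \<Longrightarrow> (\<lambda>x. a * u x + b * v x) \<in> W"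
  by (auto simp: linear_space_def)

lemma linear_space_sum:
  assumes "linear_space W" "u \<in> W" "\<And>i. i \<in> I \<Longrightarrow> e i \<in> W" "finite I"
  shows "(\<lambda>x. \<Sum>i\<in>I. c i * e i x) \<in> W"
  using assms(4,3)
proof (induction I)
  case empty
  show ?case using linear_spaceD[OF assms(1,2,2), of 0 0] by simp
next
  case (insert j I)
  then show ?case using linear_spaceD[OF assms(1), of "e j" "\<lambda>x. \<Sum>i\<in>I. c i * e i x" "c j" 1] by simp
qed

lemma linear_space_dual: "linear_space (dual W)"
  unfolding linear_space_def dual_def by (auto simp: algebra_simps)

lemma dual_lin: "\<xi> \<in> dual W \<Longrightarrow> u \<in> W \<Longrightarrow> v \<in> W \<Longrightarrow> \<xi> (\<lambda>x. a * u x + b * v x) = a * \<xi> u + b * \<xi> v"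
  by (simp add: dual_def)

lemma dual_outside: "\<xi> \<in> dual W \<Longrightarrow> v \<notin> W \<Longrightarrow> \<xi> v = 0"
  by (simp add: dual_def)

lemma dual_sum:
  assumes W: "linear_space W" "u \<in> W" and \<xi>: "\<xi> \<in> dual W" and "finite I" "\<And>i. i \<in> I \<Longrightarrow> e i \<in> W"
  shows "\<xi> (\<lambda>x. \<Sum>i\<in>I. c i * e i x) = (\<Sum>i\<in>I. c i * \<xi> (e i))"
  using assms(4,5)
proof (induction I)
  case empty
  show ?case using dual_lin[OF \<xi> W(2,2), of 0 0] by simp
next
  case (insert j I)
  then show ?case
    using dual_lin[OF \<xi>, of "e j" "\<lambda>x. \<Sum>i\<in>I. c i * e i x" "c j" 1] linear_space_sum[OF W, of I e c] by simp
qed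

lemma alt_forms_outside: "\<omega> \<in> alt_forms k W \<Longrightarrow> \<not> (length vs = k \<and> set vs \<subseteq> W) \<Longrightarrow> \<omega> vs = 0"
  unfolding alt_forms_def by blast

lemma alt_forms_lin:
  assumes "\<omega> \<in> alt_forms k W" "length vs = k" "set vs \<subseteq> W" "i < k" "u \<in> W" "v \<in> W"
  shows "\<omega> (vs[i := (\<lambda>x. a * u x + b * v x)]) = a * \<omega> (vs[i := u]) + b * \<omega> (vs[i := v])"
  using assms unfolding alt_forms_def by blast

lemma alt_forms_equal:
  assumes "\<omega> \<in> alt_forms k W" "length vs = k" "set vs \<subseteq> W" "i < k" "j < k" "i \<noteq> j" "vs ! i = vs ! j"
  shows "\<omega> vs = 0"
proof -
  have *: "\<forall>vs i j. length vs = k \<and> set vs \<subseteq> W \<and> i < j \<and> j < k \<and> vs ! i = vs ! j \<longrightarrow> \<omega> vs = 0"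
    using assms(1) unfolding alt_forms_def by blast
  show ?thesis
    using *[rule_format, of vs i j] *[rule_format, of vs j i] assms(2-) by (cases "i < j") auto
qed

lemma alt_forms_lincomb:
  assumes "\<omega> \<in> alt_forms k W" "\<eta> \<in> alt_forms k W"
  shows "(\<lambda>vs. a * \<omega> vs + b * \<eta> vs) \<in> alt_forms k W"
  unfolding alt_forms_def
proof (intro CollectI conjI allI impI)
  fix vs assume "\<not> (length vs = k \<and> set vs \<subseteq> W)"
  then show "a * \<omega> vs + b * \<eta> vs = 0" using assms[THEN alt_forms_outside] by simp
next
  fix vs i u v c d assume "length vs = k \<and> set vs \<subseteq> W \<and> i < k \<and> u \<in> W \<and> v \<in> W"
  then show "a * \<omega> (vs[i := \<lambda>x. c * u x + d * v x]) + b * \<eta> (vs[i := \<lambda>x. c * u x + d * v x]) =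
      c * (a * \<omega> (vs[i := u]) + b * \<eta> (vs[i := u])) + d * (a * \<omega> (vs[i := v]) + b * \<eta> (vs[i := v]))"
    using assms[THEN alt_forms_lin, of vs i u v c d] by (simp add: algebra_simps)
next
  fix vs i j assume "length vs = k \<and> set vs \<subseteq> W \<and> i < j \<and> j < k \<and> vs ! i = vs ! j"
  then show "a * \<omega> vs + b * \<eta> vs = 0" using assms[THEN alt_forms_equal, of vs i j] by simp
qed

lemma alt_forms_sum_arg:
  assumes W: "linear_space W" and \<omega>: "\<omega> \<in> alt_forms k W" and vs: "length vs = k" "set vs \<subseteq> W" and "i < k"
    and "finite I" "\<And>m. m \<in> I \<Longrightarrow> e m \<in> W"
  shows "\<omega> (vs[i := (\<lambda>x. \<Sum>m\<in>I. c m * e m x)]) = (\<Sum>m\<in>I. c m * \<omega> (vs[i := e m]))"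
  using assms(6,7)
proof (induction I)
  case empty
  have "vs ! i \<in> W" using vs \<open>i < k\<close> by auto
  then show ?case using alt_forms_lin[OF \<omega> vs \<open>i < k\<close>, of "vs ! i" "vs ! i" 0 0] by simp
next
  case (insert j I)
  have "vs ! i \<in> W" using vs \<open>i < k\<close> by auto
  then show ?case
    using insert alt_forms_lin[OF \<omega> vs \<open>i < k\<close>, of "e j" "\<lambda>x. \<Sum>m\<in>I. c m * e m x" "c j" 1]
      linear_space_sum[OF W, of _ I e c] by simp
qed

text \<open>Polarisation: the form vanishes on lists with \<open>u + v\<close> in both slots.\<close>

lemma alt_forms_swap:
  assumes W: "linear_space W" and \<omega>: "\<omega> \<in> alt_forms k W" and vs: "length vs = k" "set vs \<subseteq> W"
    and ij: "i < k" "j < k" "i \<noteq> j"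
  shows "\<omega> (vs[i := vs ! j, j := vs ! i]) = - \<omega> vs"
proof -
  let ?u = "vs ! i" and ?v = "vs ! j"
  let ?s = "\<lambda>x. 1 * ?u x + 1 * ?v x"
  have uv: "?u \<in> W" "?v \<in> W" using vs ij by auto
  have s: "?s \<in> W" by (rule linear_spaceD[OF W uv])
  have upd: "length (vs[m := w]) = k" "set (vs[m := w]) \<subseteq> W" if "w \<in> W" for m w
    using vs list_update_subset[OF vs(2) that] by simp_all
  have *: "\<omega> (vs[i := x, j := y]) = 0" if "x = y" "x \<in> W" for x y
  proof (rule alt_forms_equal[OF \<omega>, of _ i j])
    show "set (vs[i := x, j := y]) \<subseteq> W" by (intro list_update_subset) (use that vs in auto)
  qed (use that vs ij in auto)
  have "0 = \<omega> (vs[i := ?s, j := ?s])" using *[OF refl s] by simp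
  also have "\<dots> = \<omega> (vs[i := ?s, j := ?u]) + \<omega> (vs[i := ?s, j := ?v])"
    using alt_forms_lin[OF \<omega> upd[OF s] ij(2) uv, of i 1 1] by simp
  finally have eq: "0 = \<omega> (vs[i := ?s, j := ?u]) + \<omega> (vs[i := ?s, j := ?v])" .
  have split: "\<omega> (vs[i := ?s, j := w]) = \<omega> (vs[i := ?u, j := w]) + \<omega> (vs[i := ?v, j := w])" if "w \<in> W" for w
    using alt_forms_lin[OF \<omega> upd[OF that] ij(1) uv, of j 1 1]
    by (simp only: list_update_swap[OF ij(3)] mult_1_left)
  have "0 = \<omega> (vs[i := ?u, j := ?u]) + \<omega> (vs[i := ?v, j := ?u]) + (\<omega> (vs[i := ?u, j := ?v]) + \<omega> (vs[i := ?v, j := ?v]))"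
    unfolding split[OF uv(1), symmetric] split[OF uv(2), symmetric] by (rule eq)
  then show ?thesis using *[OF refl uv(1)] *[OF refl uv(2)] by simp
qed

lemma alt_forms_permute:
  assumes W: "linear_space W" and \<omega>: "\<omega> \<in> alt_forms k W" and \<sigma>: "\<sigma> permutes {..<k}"
  shows "length vs = k \<Longrightarrow> set vs \<subseteq> W \<Longrightarrow> \<omega> (map (\<lambda>i. vs ! \<sigma> i) [0..<k]) = of_int (sign \<sigma>) * \<omega> vs"
  using \<sigma> finite_lessThan[of k]
proof (induction \<sigma> arbitrary: vs rule: permutes_induct)
  case id
  then show ?case by (auto simp: map_nth)
next
  case (swap a b p)
  let ?vs = "vs[a := vs ! b, b := vs ! a]"
  have ab: "a < k" "b < k" "a \<noteq> b" using swap.hyps by auto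
  have vs': "length ?vs = k" "set ?vs \<subseteq> W"
    using list_update_subset[OF list_update_subset[OF swap.prems(2)]] swap.prems ab by auto
  have eq: "map (\<lambda>i. vs ! (Transposition.transpose a b \<circ> p) i) [0..<k] = map (\<lambda>i. ?vs ! p i) [0..<k]"
  proof (rule map_cong[OF refl])
    fix i assume "i \<in> set [0..<k]"
    then have "p i < k" using permutes_in_image[OF swap.hyps(4)] by auto
    then show "vs ! (Transposition.transpose a b \<circ> p) i = ?vs ! p i"
      using ab swap.prems by (auto simp: Transposition.transpose_def nth_list_update)
  qed
  have "\<omega> (map (\<lambda>i. vs ! (Transposition.transpose a b \<circ> p) i) [0..<k]) = of_int (sign p) * \<omega> ?vs"
    unfolding eq by (rule swap.IH[OF vs'])
  also have "\<omega> ?vs = - \<omega> vs" by (rule alt_forms_swap[OF W \<omega> swap.prems ab])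
  also have "sign (Transposition.transpose a b \<circ> p) = - sign p"
    using ab swap.hyps(4) permutes_imp_permutation[of "{..<k}" p]
    by (simp add: sign_compose permutation_swap_id sign_swap_id)
  then have "of_int (sign p) * - \<omega> vs = of_int (sign (Transposition.transpose a b \<circ> p)) * \<omega> vs" by simp
  finally show ?case .
qed

section \<open>Decomposable forms\<close>

text \<open>The normalisation of \<open>wedge\<close> makes it a determinant, so that the Laplace expansions give the expansions along a covector
or along a vector.\<close>

definition pairing_matrix :: "(('x \<Rightarrow> real) \<Rightarrow> real) list \<Rightarrow> ('x \<Rightarrow> real) list \<Rightarrow> real mat" where
  "pairing_matrix \<xi>s vs = mat (length \<xi>s) (length vs) (\<lambda>(i, j). (\<xi>s ! i) (vs ! j))"

lemma wedge_eq_det: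
  assumes "length vs = length \<xi>s" "set vs \<subseteq> W"
  shows "wedge W \<xi>s vs = det (pairing_matrix \<xi>s vs)"
proof -
  have "signof p = (of_int (sign p) :: real)" for p :: "nat \<Rightarrow> nat"
    by (simp add: sign_def)
  moreover have "(\<Prod>i<length \<xi>s. (\<xi>s ! i) (vs ! p i)) = (\<Prod>i = 0..<length \<xi>s. pairing_matrix \<xi>s vs $$ (i, p i))"
    if "p permutes {0..<length \<xi>s}" for p
    unfolding atLeast0LessThan
    by (intro prod.cong refl) (use permutes_in_image[OF that] assms in \<open>auto simp: pairing_matrix_def\<close>)
  ultimately show ?thesis
    using assms by (auto simp: wedge_def det_def pairing_matrix_def lessThan_atLeast0 intro!: sum.cong)
qed

lemma wedge_outside: "\<not> (length vs = length \<xi>s \<and> set vs \<subseteq> W) \<Longrightarrow> wedge W \<xi>s vs = 0"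
  by (auto simp: wedge_def)

lemma wedge_Nil [simp]: "wedge W [] [] = 1"
  by (simp add: wedge_def)

lemma pairing_matrix_delete:
  assumes "i < length \<xi>s" "j < length vs"
  shows "mat_delete (pairing_matrix \<xi>s vs) i j = pairing_matrix (omit i \<xi>s) (omit j vs)"
  using assms by (intro eq_matI) (auto simp: mat_delete_def pairing_matrix_def nth_omit)

lemma pairing_matrix_entry:
  "i < length \<xi>s \<Longrightarrow> j < length vs \<Longrightarrow> pairing_matrix \<xi>s vs $$ (i, j) = (\<xi>s ! i) (vs ! j)"
  by (simp add: pairing_matrix_def)

lemma pairing_matrix_carrier: "pairing_matrix \<xi>s vs \<in> carrier_mat (length \<xi>s) (length vs)"
  by (simp add: pairing_matrix_def)

lemma cofactor_pairing_matrix: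
  assumes "length vs = length \<xi>s" "set vs \<subseteq> W" "j < length \<xi>s" "i < length \<xi>s"
  shows "cofactor (pairing_matrix \<xi>s vs) j i = (-1) ^ (i + j) * wedge W (omit j \<xi>s) (omit i vs)"
  using assms by (simp add: cofactor_def pairing_matrix_delete wedge_eq_det set_omit_subset add.commute)

lemma wedge_expand_row:
  assumes "length vs = length \<xi>s" "set vs \<subseteq> W" "j < length \<xi>s"
  shows "wedge W \<xi>s vs = (\<Sum>i<length vs. (-1) ^ (i + j) * (\<xi>s ! j) (vs ! i) * wedge W (omit j \<xi>s) (omit i vs))"
  using laplace_expansion_row[of "pairing_matrix \<xi>s vs" "length \<xi>s" j] pairing_matrix_carrier[of \<xi>s vs] assms
  by (simp add: wedge_eq_det[OF assms(1,2)] pairing_matrix_entry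
      cofactor_pairing_matrix[OF assms(1,2)] algebra_simps)

lemma wedge_expand_col:
  assumes "length vs = length \<xi>s" "set vs \<subseteq> W" "i < length \<xi>s"
  shows "wedge W \<xi>s vs = (\<Sum>j<length vs. (-1) ^ (i + j) * (\<xi>s ! j) (vs ! i) * wedge W (omit j \<xi>s) (omit i vs))"
  using laplace_expansion_column[of "pairing_matrix \<xi>s vs" "length \<xi>s" i] pairing_matrix_carrier[of \<xi>s vs] assms
  by (simp add: wedge_eq_det[OF assms(1,2)] pairing_matrix_entry
      cofactor_pairing_matrix[OF assms(1,2)] algebra_simps)

lemma wedge_update_row:
  assumes "length vs = length \<xi>s" "set vs \<subseteq> W" "j < length \<xi>s"
  shows "wedge W (\<xi>s[j := \<xi>]) vs = (\<Sum>i<length vs. (-1) ^ (i + j) * \<xi> (vs ! i) * wedge W (omit j \<xi>s) (omit i vs))"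
  using wedge_expand_row[of vs "\<xi>s[j := \<xi>]" W j] assms by simp

lemma wedge_update_col:
  assumes "length vs = length \<xi>s" "set vs \<subseteq> W" "i < length \<xi>s" "v \<in> W"
  shows "wedge W \<xi>s (vs[i := v]) = (\<Sum>j<length vs. (-1) ^ (i + j) * (\<xi>s ! j) v * wedge W (omit j \<xi>s) (omit i vs))"
  using wedge_expand_col[of "vs[i := v]" \<xi>s W i] assms list_update_subset[OF assms(2,4), of i] by simp

lemma wedge_in_alt_forms:
  assumes W: "linear_space W" and \<xi>s: "set \<xi>s \<subseteq> dual W" "length \<xi>s = k"
  shows "wedge W \<xi>s \<in> alt_forms k W"
  unfolding alt_forms_def
proof (intro CollectI conjI allI impI)
  fix vs assume "\<not> (length vs = k \<and> set vs \<subseteq> W)"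
  then show "wedge W \<xi>s vs = 0" using \<xi>s wedge_outside by blast
next
  fix vs i u v a b assume *: "length vs = k \<and> set vs \<subseteq> W \<and> i < k \<and> u \<in> W \<and> v \<in> W"
  have "(\<xi>s ! j) (\<lambda>x. a * u x + b * v x) = a * (\<xi>s ! j) u + b * (\<xi>s ! j) v" if "j < length vs" for j
    using that \<xi>s * by (intro dual_lin) auto
  then show "wedge W \<xi>s (vs[i := \<lambda>x. a * u x + b * v x]) = a * wedge W \<xi>s (vs[i := u]) + b * wedge W \<xi>s (vs[i := v])"
    using * \<xi>s linear_spaceD[OF W]
    by (simp add: wedge_update_col sum_distrib_left sum.distrib[symmetric] algebra_simps cong: sum.cong_simp)
next
  fix vs i j assume *: "length vs = k \<and> set vs \<subseteq> W \<and> i < j \<and> j < k \<and> vs ! i = vs ! j"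
  have "det (pairing_matrix \<xi>s vs) = 0"
    by (rule det_identical_columns[of _ k i j]) (use * \<xi>s in \<open>auto simp: pairing_matrix_def\<close>)
  then show "wedge W \<xi>s vs = 0" using * \<xi>s by (simp add: wedge_eq_det)
qed

lemma wedge_transpose:
  assumes "length vs = length \<xi>s" "set vs \<subseteq> W" "set \<xi>s \<subseteq> W'"
    and "length gs = length vs" "\<And>i j. i < length vs \<Longrightarrow> j < length vs \<Longrightarrow> (gs ! i) (\<xi>s ! j) = (\<xi>s ! j) (vs ! i)"
  shows "wedge W' gs \<xi>s = wedge W \<xi>s vs"
proof -
  have "pairing_matrix gs \<xi>s = transpose_mat (pairing_matrix \<xi>s vs)"
    using assms by (intro eq_matI) (auto simp: pairing_matrix_def)
  moreover have "pairing_matrix \<xi>s vs \<in> carrier_mat (length vs) (length vs)"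
    using assms by (auto simp: pairing_matrix_def)
  ultimately have "det (pairing_matrix gs \<xi>s) = det (pairing_matrix \<xi>s vs)" by (simp add: det_transpose)
  then show ?thesis using assms wedge_eq_det[of \<xi>s gs W'] wedge_eq_det[of vs \<xi>s W] by simp
qed

text \<open>Laplace expansion turns both sides into the contraction of the rank-one matrix \<open>\<eta> (v\<^sub>i) \<xi>\<^sub>j (w)\<close> with the cofactors.\<close>

lemma wedge_rank_one:
  assumes "length vs = length \<xi>s" "set vs \<subseteq> W" "w \<in> W"
  shows "(\<Sum>i<length vs. \<eta> (vs ! i) * wedge W \<xi>s (vs[i := w])) = (\<Sum>j<length vs. (\<xi>s ! j) w * wedge W (\<xi>s[j := \<eta>]) vs)"
proof -
  have "(\<Sum>i<length vs. \<eta> (vs ! i) * wedge W \<xi>s (vs[i := w])) =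
    (\<Sum>i<length vs. \<Sum>j<length vs. (-1) ^ (i + j) * (\<xi>s ! j) w * \<eta> (vs ! i) * wedge W (omit j \<xi>s) (omit i vs))"
    using assms by (intro sum.cong refl) (simp add: wedge_update_col sum_distrib_left algebra_simps)
  also have "\<dots> = (\<Sum>j<length vs. \<Sum>i<length vs. (-1) ^ (i + j) * (\<xi>s ! j) w * \<eta> (vs ! i) * wedge W (omit j \<xi>s) (omit i vs))"
    by (rule sum.swap)
  also have "\<dots> = (\<Sum>j<length vs. (\<xi>s ! j) w * wedge W (\<xi>s[j := \<eta>]) vs)"
    using assms by (intro sum.cong refl) (simp add: wedge_update_row sum_distrib_left algebra_simps)
  finally show ?thesis .
qed

section \<open>Frames\<close>

text \<open>A finite spanning family \<open>e\<close> with coefficient functions \<open>d\<close> in the role of a dual basis. The scalar \<open>h\<close> is the value of a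
cut-off function and may be zero, in which case the expansion holds but carries no information.\<close>

locale finite_frame =
  fixes W :: "('x \<Rightarrow> real) set" and N :: nat and e :: "nat \<Rightarrow> 'x \<Rightarrow> real" and d :: "nat \<Rightarrow> ('x \<Rightarrow> real) \<Rightarrow> real"
    and h :: real
  assumes W: "linear_space W" and e: "\<And>i. i < N \<Longrightarrow> e i \<in> W"
    and expand: "\<And>v. v \<in> W \<Longrightarrow> (\<lambda>x. h * v x) = (\<lambda>x. \<Sum>i<N. d i v * e i x)"
begin

lemma alt_form_expand:
  assumes \<omega>: "\<omega> \<in> alt_forms k W" and vs: "length vs = k" "set vs \<subseteq> W"
  shows "h ^ k * \<omega> vs = (\<Sum>I\<in>tuples N k. (\<Prod>j<k. d (I ! j) (vs ! j)) * \<omega> (map e I))"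
proof -
  have slot: "h * \<omega> (us @ v # ws) = (\<Sum>i<N. d i v * \<omega> (us @ e i # ws))"
    if "Suc (length us + length ws) = k" "set us \<subseteq> W" "v \<in> W" "set ws \<subseteq> W" for us v ws
  proof -
    let ?l = "us @ v # ws"
    have l: "length ?l = k" "set ?l \<subseteq> W" "length us < k" using that by auto
    have "h * \<omega> ?l = \<omega> (?l[length us := (\<lambda>x. h * v x)])"
      using alt_forms_lin[OF \<omega> l that(3,3), of h 0] by simp
    also have "\<dots> = \<omega> (?l[length us := (\<lambda>x. \<Sum>i<N. d i v * e i x)])"
      by (simp only: expand[OF that(3)])
    also have "\<dots> = (\<Sum>i<N. d i v * \<omega> (?l[length us := e i]))"
      by (rule alt_forms_sum_arg[OF W \<omega> l]) (use e in auto)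
    finally show ?thesis by simp
  qed
  show ?thesis
    using multilinear_expand[where F = \<omega> and us = "[]" and vs = vs and c = "\<lambda>v i. d i v", OF e slot] vs by simp
qed

text \<open>Expand each \<open>wedge\<close> over the permutations: the multilinear expansion of \<open>\<omega>\<close> applied to the permuted arguments gives
\<open>\<omega> vs\<close> for every permutation, after its sign is cancelled by the sign in \<open>wedge\<close>.\<close>

lemma alt_form_eq_sum_wedge:
  assumes \<omega>: "\<omega> \<in> alt_forms k W" and vs: "length vs = k" "set vs \<subseteq> W"
  shows "fact k * (h ^ k * \<omega> vs) = (\<Sum>I\<in>tuples N k. \<omega> (map e I) * wedge W (map d I) vs)"
proof -
  have "wedge W (map d I) vs = (\<Sum>\<sigma> | \<sigma> permutes {..<k}. of_int (sign \<sigma>) * (\<Prod>j<k. d (I ! j) (vs ! \<sigma> j)))"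
    if "I \<in> tuples N k" for I
    using that vs by (simp add: wedge_def tuples_def)
  then have "(\<Sum>I\<in>tuples N k. \<omega> (map e I) * wedge W (map d I) vs) =
      (\<Sum>I\<in>tuples N k. \<Sum>\<sigma> | \<sigma> permutes {..<k}. of_int (sign \<sigma>) * ((\<Prod>j<k. d (I ! j) (vs ! \<sigma> j)) * \<omega> (map e I)))"
    by (intro sum.cong refl) (simp add: sum_distrib_left algebra_simps)
  also have "\<dots> = (\<Sum>\<sigma> | \<sigma> permutes {..<k}. of_int (sign \<sigma>) *
      (\<Sum>I\<in>tuples N k. (\<Prod>j<k. d (I ! j) (vs ! \<sigma> j)) * \<omega> (map e I)))"
    by (subst sum.swap) (simp add: sum_distrib_left)
  also have "\<dots> = (\<Sum>\<sigma> | \<sigma> permutes {..<k}. h ^ k * \<omega> vs)"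
  proof (rule sum.cong[OF refl])
    fix \<sigma> assume "\<sigma> \<in> {\<sigma>. \<sigma> permutes {..<k}}"
    then have \<sigma>: "\<sigma> permutes {..<k}" by simp
    let ?vs = "map (\<lambda>i. vs ! \<sigma> i) [0..<k]"
    have "set ?vs \<subseteq> W" using permutes_in_image[OF \<sigma>] vs by auto
    then have "(\<Sum>I\<in>tuples N k. (\<Prod>j<k. d (I ! j) (vs ! \<sigma> j)) * \<omega> (map e I)) = h ^ k * \<omega> ?vs"
      using alt_form_expand[OF \<omega>, of ?vs] by simp
    also have "\<dots> = of_int (sign \<sigma>) * (h ^ k * \<omega> vs)"
      by (simp add: alt_forms_permute[OF W \<omega> \<sigma> vs])
    finally show "of_int (sign \<sigma>) * (\<Sum>I\<in>tuples N k. (\<Prod>j<k. d (I ! j) (vs ! \<sigma> j)) * \<omega> (map e I)) = h ^ k * \<omega> vs"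
      by (simp flip: mult.assoc of_int_mult)
  qed
  also have "\<dots> = fact k * (h ^ k * \<omega> vs)" by (simp add: card_permutations)
  finally show ?thesis by simp
qed

lemma dual_frame: "finite_frame (dual W) N d (\<lambda>i \<xi>. \<xi> (e i)) h" if d: "\<And>i. i < N \<Longrightarrow> d i \<in> dual W"
proof
  show "linear_space (dual W)" by (rule linear_space_dual)
  show "(\<lambda>v. h * \<xi> v) = (\<lambda>v. \<Sum>i<N. \<xi> (e i) * d i v)" if \<xi>: "\<xi> \<in> dual W" for \<xi>
  proof
    fix v show "h * \<xi> v = (\<Sum>i<N. \<xi> (e i) * d i v)"
    proof (cases "v \<in> W")
      case True
      have "h * \<xi> v = \<xi> (\<lambda>x. h * v x)" using dual_lin[OF \<xi> True True, of h 0] by simp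
      also have "\<dots> = \<xi> (\<lambda>x. \<Sum>i<N. d i v * e i x)" by (simp only: expand[OF True])
      also have "\<dots> = (\<Sum>i<N. d i v * \<xi> (e i))" by (rule dual_sum[OF W True \<xi>]) (use e in auto)
      finally show ?thesis by (simp add: mult.commute)
    next
      case False
      then show ?thesis
        using dual_outside[OF \<xi>] dual_outside[OF d] by simp
    qed
  qed
qed (use d in auto)

text \<open>The previous expansion in the dual space, with the determinant transposed.\<close>

lemma multivector_eq_sum_wedge:
  assumes d: "\<And>i. i < N \<Longrightarrow> d i \<in> dual W" and P: "P \<in> alt_forms k (dual W)" and \<xi>s: "length \<xi>s = k" "set \<xi>s \<subseteq> dual W"
  shows "fact k * (h ^ k * P \<xi>s) = (\<Sum>I\<in>tuples N k. wedge W \<xi>s (map e I) * P (map d I))"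
proof -
  interpret D: finite_frame "dual W" N d "\<lambda>i \<xi>. \<xi> (e i)" h by (rule dual_frame[OF d])
  have "wedge (dual W) (map (\<lambda>i \<xi>. \<xi> (e i)) I) \<xi>s = wedge W \<xi>s (map e I)" if "I \<in> tuples N k" for I
    by (rule wedge_transpose) (use that \<xi>s e in \<open>auto simp: tuples_def\<close>)
  then show ?thesis using D.alt_form_eq_sum_wedge[OF P \<xi>s] by (simp add: mult.commute)
qed

end

lemma alt_forms_fix_last:
  assumes P: "P \<in> alt_forms (Suc k) W" and w: "w \<in> W"
  shows "(\<lambda>vs. P (vs @ [w])) \<in> alt_forms k W"
  unfolding alt_forms_def
proof (intro CollectI conjI allI impI)
  fix vs assume "\<not> (length vs = k \<and> set vs \<subseteq> W)"
  then show "P (vs @ [w]) = 0" using alt_forms_outside[OF P, of "vs @ [w]"] by auto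
next
  fix vs i u v a b assume *: "length vs = k \<and> set vs \<subseteq> W \<and> i < k \<and> u \<in> W \<and> v \<in> W"
  show "P (vs[i := \<lambda>x. a * u x + b * v x] @ [w]) = a * P (vs[i := u] @ [w]) + b * P (vs[i := v] @ [w])"
    using alt_forms_lin[OF P, of "vs @ [w]" i u v a b] * w by (simp add: list_update_append)
next
  fix vs i j assume *: "length vs = k \<and> set vs \<subseteq> W \<and> i < j \<and> j < k \<and> vs ! i = vs ! j"
  show "P (vs @ [w]) = 0"
    using alt_forms_equal[OF P, of "vs @ [w]" i j] * w by (simp add: nth_append)
qed

lemma alt_forms_fix_first:
  assumes P: "P \<in> alt_forms (Suc k) W" and w: "w \<in> W"
  shows "(\<lambda>vs. P (w # vs)) \<in> alt_forms k W"
  unfolding alt_forms_def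
proof (intro CollectI conjI allI impI)
  fix vs assume "\<not> (length vs = k \<and> set vs \<subseteq> W)"
  then show "P (w # vs) = 0" using alt_forms_outside[OF P, of "w # vs"] by auto
next
  fix vs i u v a b assume *: "length vs = k \<and> set vs \<subseteq> W \<and> i < k \<and> u \<in> W \<and> v \<in> W"
  show "P (w # vs[i := \<lambda>x. a * u x + b * v x]) = a * P (w # vs[i := u]) + b * P (w # vs[i := v])"
    using alt_forms_lin[OF P, of "w # vs" "Suc i" u v a b] * w by simp
next
  fix vs i j assume *: "length vs = k \<and> set vs \<subseteq> W \<and> i < j \<and> j < k \<and> vs ! i = vs ! j"
  show "P (w # vs) = 0"
    using alt_forms_equal[OF P, of "w # vs" "Suc i" "Suc j"] * w by simp
qed

lemma alt_forms_sum:
  assumes "finite I" "\<And>i. i \<in> I \<Longrightarrow> \<omega> i \<in> alt_forms k W"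
  shows "(\<lambda>vs. \<Sum>i\<in>I. c i * \<omega> i vs) \<in> alt_forms k W"
  using assms
proof (induction I)
  case empty
  show ?case by (simp add: alt_forms_def)
next
  case (insert j I)
  then show ?case using alt_forms_lincomb[of "\<omega> j" k W "\<lambda>vs. \<Sum>i\<in>I. c i * \<omega> i vs" "c j" 1] by simp
qed

lemma alt_forms_eqI:
  assumes "\<omega> \<in> alt_forms k W" "\<eta> \<in> alt_forms k W"
    "\<And>vs. length vs = k \<Longrightarrow> set vs \<subseteq> W \<Longrightarrow> \<omega> vs = \<eta> vs"
  shows "\<omega> = \<eta>"
proof
  fix vs show "\<omega> vs = \<eta> vs" 
    using assms(3) alt_forms_outside[OF assms(1)] alt_forms_outside[OF assms(2)]
    by (cases "length vs = k \<and> set vs \<subseteq> W") auto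
qed

section \<open>Tangent vectors and vector fields\<close>

text \<open>From here on the manifold enters only through its algebra of smooth functions and the existence of local frames.\<close>

locale smooth_frames =
  fixes A :: "('a, 'e::euclidean_space) atlas"
  assumes C_const: "\<And>c. (\<lambda>x. c) \<in> smooth_functions A"
    and C_add: "\<And>f g. f \<in> smooth_functions A \<Longrightarrow> g \<in> smooth_functions A \<Longrightarrow> (\<lambda>x. f x + g x) \<in> smooth_functions A"
    and C_mult: "\<And>f g. f \<in> smooth_functions A \<Longrightarrow> g \<in> smooth_functions A \<Longrightarrow> (\<lambda>x. f x * g x) \<in> smooth_functions A"
    and frame: "\<And>p. \<exists>(N::nat) x E. \<exists>h\<in>smooth_functions A. h p = 1 \<and>
      (\<forall>i<N. x i \<in> smooth_functions A \<and> E i \<in> vector_fields A) \<and>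
      (\<forall>q. \<forall>v\<in>tangent_space A q. \<forall>f\<in>smooth_functions A. h q * v f = (\<Sum>i<N. v (x i) * E i q f))"
begin

abbreviation "C \<equiv> smooth_functions A"
abbreviation "T \<equiv> tangent_space A"
abbreviation "D \<equiv> differential A"
abbreviation "VF \<equiv> vector_fields A"

lemma C_cmult: "f \<in> C \<Longrightarrow> (\<lambda>x. c * f x) \<in> C"
  by (intro C_mult C_const)

lemma C_lin: "f \<in> C \<Longrightarrow> g \<in> C \<Longrightarrow> (\<lambda>x. a * f x + b * g x) \<in> C"
  by (intro C_add C_cmult)

lemma C_diff: "f \<in> C \<Longrightarrow> g \<in> C \<Longrightarrow> (\<lambda>x. f x - g x) \<in> C"
  using C_add[OF _ C_cmult[of g "-1"], of f] by simp

lemma C_sum: "finite I \<Longrightarrow> (\<And>i. i \<in> I \<Longrightarrow> f i \<in> C) \<Longrightarrow> (\<lambda>x. \<Sum>i\<in>I. f i x) \<in> C"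
  by (induction I rule: finite_induct) (auto intro: C_const C_add)

lemma C_prod: "finite I \<Longrightarrow> (\<And>i. i \<in> I \<Longrightarrow> f i \<in> C) \<Longrightarrow> (\<lambda>x. \<Prod>i\<in>I. f i x) \<in> C"
  by (induction I rule: finite_induct) (auto intro: C_const C_mult)

lemma C_power: "f \<in> C \<Longrightarrow> (\<lambda>x. f x ^ k) \<in> C"
  by (induction k) (auto intro: C_const C_mult)

lemma T_outside: "v \<in> T p \<Longrightarrow> f \<notin> C \<Longrightarrow> v f = 0"
  by (simp add: tangent_space_def)

lemma T_lin: "v \<in> T p \<Longrightarrow> f \<in> C \<Longrightarrow> g \<in> C \<Longrightarrow> v (\<lambda>x. a * f x + b * g x) = a * v f + b * v g"
  by (simp add: tangent_space_def)

lemma T_mult: "v \<in> T p \<Longrightarrow> f \<in> C \<Longrightarrow> g \<in> C \<Longrightarrow> v (\<lambda>x. f x * g x) = f p * v g + g p * v f"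
  by (simp add: tangent_space_def)

lemma T_const: "v \<in> T p \<Longrightarrow> v (\<lambda>x. c) = 0"
  using T_mult[of v p "\<lambda>x. 1" "\<lambda>x. 1"] T_lin[of v p "\<lambda>x. 1" "\<lambda>x. 1" c 0] C_const by simp

lemma T_add: "v \<in> T p \<Longrightarrow> f \<in> C \<Longrightarrow> g \<in> C \<Longrightarrow> v (\<lambda>x. f x + g x) = v f + v g"
  using T_lin[of v p f g 1 1] by simp

lemma T_cmult: "v \<in> T p \<Longrightarrow> f \<in> C \<Longrightarrow> v (\<lambda>x. c * f x) = c * v f"
  using T_lin[of v p f f c 0] by simp

lemma T_sum:
  assumes "v \<in> T p" "finite I" "\<And>i. i \<in> I \<Longrightarrow> f i \<in> C"
  shows "v (\<lambda>x. \<Sum>i\<in>I. f i x) = (\<Sum>i\<in>I. v (f i))"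
  using assms(2,3) by (induction I rule: finite_induct) (auto simp: T_const[OF assms(1)] T_add[OF assms(1)] C_sum)

lemma TI:
  assumes "\<And>f. f \<notin> C \<Longrightarrow> v f = 0"
    "\<And>f g a b. f \<in> C \<Longrightarrow> g \<in> C \<Longrightarrow> v (\<lambda>x. a * f x + b * g x) = a * v f + b * v g"
    "\<And>f g. f \<in> C \<Longrightarrow> g \<in> C \<Longrightarrow> v (\<lambda>x. f x * g x) = f p * v g + g p * v f"
  shows "v \<in> T p"
  using assms by (simp add: tangent_space_def)

lemma linear_space_T: "linear_space (T p)"
  unfolding linear_space_def
  by (intro ballI allI TI) (simp_all add: T_outside T_lin T_mult algebra_simps)

lemma T_zero: "(\<lambda>f. 0) \<in> T p"
  by (rule TI) auto

lemma T_sum_mem: "finite I \<Longrightarrow> (\<And>i. i \<in> I \<Longrightarrow> v i \<in> T p) \<Longrightarrow> (\<lambda>f. \<Sum>i\<in>I. c i * v i f) \<in> T p"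
  by (rule linear_space_sum[OF linear_space_T T_zero])

lemma D_apply: "v \<in> T p \<Longrightarrow> D f p v = v f"
  by (simp add: differential_def)

lemma D_dual [simp]: "D f p \<in> dual (T p)"
  unfolding dual_def using linear_spaceD[OF linear_space_T] by (auto simp: differential_def)

lemma D_lin: "f \<in> C \<Longrightarrow> g \<in> C \<Longrightarrow> D (\<lambda>x. a * f x + b * g x) p = (\<lambda>v. a * D f p v + b * D g p v)"
  by (auto simp: differential_def T_lin)

lemma D_mult: "f \<in> C \<Longrightarrow> g \<in> C \<Longrightarrow> D (\<lambda>x. f x * g x) p = (\<lambda>v. f p * D g p v + g p * D f p v)"
  by (auto simp: differential_def T_mult)

lemma set_map_D: "set (map (\<lambda>f. D f p) fs) \<subseteq> dual (T p)"
  by auto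

lemma VF_T: "X \<in> VF \<Longrightarrow> X p \<in> T p"
  unfolding vector_fields_def by blast

lemma VF_C: "X \<in> VF \<Longrightarrow> f \<in> C \<Longrightarrow> (\<lambda>p. X p f) \<in> C"
  unfolding vector_fields_def by blast

lemma VFI: "(\<And>p. X p \<in> T p) \<Longrightarrow> (\<And>f. f \<in> C \<Longrightarrow> (\<lambda>p. X p f) \<in> C) \<Longrightarrow> X \<in> VF"
  unfolding vector_fields_def by blast

lemma set_map_VF: "set Xs \<subseteq> VF \<Longrightarrow> set (map (\<lambda>X. X p) Xs) \<subseteq> T p"
  unfolding set_map image_subset_iff by (intro ballI VF_T) (erule subsetD)

lemma VF_lin:
  assumes "X \<in> VF" "Y \<in> VF" "u \<in> C" "w \<in> C"
  shows "(\<lambda>p f. u p * X p f + w p * Y p f) \<in> VF"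
proof (rule VFI)
  show "(\<lambda>f. u p * X p f + w p * Y p f) \<in> T p" for p
    by (rule linear_spaceD[OF linear_space_T VF_T[OF assms(1)] VF_T[OF assms(2)]])
qed (intro C_add C_mult VF_C[OF assms(1)] VF_C[OF assms(2)] assms(3,4))

lemma VF_scale: "X \<in> VF \<Longrightarrow> u \<in> C \<Longrightarrow> (\<lambda>p f. u p * X p f) \<in> VF"
  using VF_lin[of X X u "\<lambda>x. 0"] C_const by simp

lemma VF_zero: "(\<lambda>p f. 0) \<in> VF"
  by (rule VFI) (rule T_zero, rule C_const)

lemma VF_sum:
  assumes "finite I" "\<And>i. i \<in> I \<Longrightarrow> u i \<in> C" "\<And>i. i \<in> I \<Longrightarrow> X i \<in> VF"
  shows "(\<lambda>p f. \<Sum>i\<in>I. u i p * X i p f) \<in> VF"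
  using assms
proof (induction I)
  case empty
  then show ?case by (simp add: VF_zero)
next
  case (insert i I)
  then show ?case using VF_lin[of "X i" "\<lambda>p f. \<Sum>i\<in>I. u i p * X i p f" "u i" "\<lambda>x. 1"] C_const by simp
qed

lemma bracket_apply: "f \<in> C \<Longrightarrow> lie_bracket A X Y p f = X p (\<lambda>q. Y q f) - Y p (\<lambda>q. X q f)"
  by (simp add: lie_bracket_def)

lemma VF_bracket:
  assumes X: "X \<in> VF" and Y: "Y \<in> VF"
  shows "lie_bracket A X Y \<in> VF"
proof (rule VFI)
  fix p
  show "lie_bracket A X Y p \<in> T p"
  proof (rule TI)
    fix f g a b assume f: "f \<in> C" "g \<in> C"
    have *: "(\<lambda>q. Z q (\<lambda>x. a * f x + b * g x)) = (\<lambda>q. a * Z q f + b * Z q g)"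
      "(\<lambda>q. Z q (\<lambda>x. f x * g x)) = (\<lambda>q. f q * Z q g + g q * Z q f)" if "Z \<in> VF" for Z
      using f by (auto simp: T_lin[OF VF_T[OF that]] T_mult[OF VF_T[OF that]])
    show "lie_bracket A X Y p (\<lambda>x. a * f x + b * g x) = a * lie_bracket A X Y p f + b * lie_bracket A X Y p g"
      using f X Y by (simp add: bracket_apply C_lin * T_lin[OF VF_T[OF X]] T_lin[OF VF_T[OF Y]] VF_C[OF X] VF_C[OF Y] algebra_simps)
    show "lie_bracket A X Y p (\<lambda>x. f x * g x) = f p * lie_bracket A X Y p g + g p * lie_bracket A X Y p f"
      using f X Y
      by (simp add: bracket_apply C_mult * T_add[OF VF_T[OF X]] T_add[OF VF_T[OF Y]] T_mult[OF VF_T[OF X]] T_mult[OF VF_T[OF Y]] VF_C[OF X] VF_C[OF Y] algebra_simps)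
  qed (simp add: lie_bracket_def)
next
  fix f assume "f \<in> C"
  then show "(\<lambda>p. lie_bracket A X Y p f) \<in> C"
    using X Y by (simp add: bracket_apply C_diff VF_C[OF X] VF_C[OF Y])
qed

lemma bracket_scale_right:
  assumes X: "X \<in> VF" and Y: "Y \<in> VF" and u: "u \<in> C"
  shows "lie_bracket A X (\<lambda>p f. u p * Y p f) p = (\<lambda>f. u p * lie_bracket A X Y p f + X p u * Y p f)"
proof
  fix f show "lie_bracket A X (\<lambda>p f. u p * Y p f) p f = u p * lie_bracket A X Y p f + X p u * Y p f"
  proof (cases "f \<in> C")
    case True
    then show ?thesis
      using X Y u by (simp add: bracket_apply T_mult[OF VF_T[OF X]] T_mult[OF VF_T[OF Y]] VF_C[OF X] VF_C[OF Y] algebra_simps)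
  next
    case False
    then show ?thesis using T_outside[OF VF_T[OF Y]] by (simp add: lie_bracket_def)
  qed
qed

lemma bracket_swap: "lie_bracket A X Y p f = - lie_bracket A Y X p f"
  by (simp add: lie_bracket_def)

lemma bracket_scale_left:
  assumes X: "X \<in> VF" and Y: "Y \<in> VF" and u: "u \<in> C"
  shows "lie_bracket A (\<lambda>p f. u p * X p f) Y p = (\<lambda>f. u p * lie_bracket A X Y p f - Y p u * X p f)"
  using fun_cong[OF bracket_scale_right[OF Y X u, of p]] by (simp add: bracket_swap[of _ Y] fun_eq_iff)

lemma bracket_sum_right:
  assumes X: "X \<in> VF" and I: "finite I" and Y: "\<And>i. i \<in> I \<Longrightarrow> Y i \<in> VF"
  shows "lie_bracket A X (\<lambda>p f. \<Sum>i\<in>I. Y i p f) p = (\<lambda>f. \<Sum>i\<in>I. lie_bracket A X (Y i) p f)"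
proof
  fix f show "lie_bracket A X (\<lambda>p f. \<Sum>i\<in>I. Y i p f) p f = (\<Sum>i\<in>I. lie_bracket A X (Y i) p f)"
  proof (cases "f \<in> C")
    case True
    then have "X p (\<lambda>q. \<Sum>i\<in>I. Y i q f) = (\<Sum>i\<in>I. X p (\<lambda>q. Y i q f))"
      by (intro T_sum[OF VF_T[OF X] I] VF_C[OF Y])
    then show ?thesis using True by (simp add: bracket_apply sum_subtractf)
  qed (simp add: lie_bracket_def)
qed

lemma bracket_sum_left:
  assumes "Y \<in> VF" "finite I" "\<And>i. i \<in> I \<Longrightarrow> X i \<in> VF"
  shows "lie_bracket A (\<lambda>p f. \<Sum>i\<in>I. X i p f) Y p = (\<lambda>f. \<Sum>i\<in>I. lie_bracket A (X i) Y p f)"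
  using fun_cong[OF bracket_sum_right[OF assms, where p = p]] by (simp add: bracket_swap[of _ Y] sum_negf fun_eq_iff)

lemma frameE:
  obtains N x E h where "h \<in> C" "h p = 1" "\<And>i. i < N \<Longrightarrow> x i \<in> C" "\<And>i. i < N \<Longrightarrow> E i \<in> VF"
    "\<And>q. finite_frame (T q) N (\<lambda>i. E i q) (\<lambda>i. D (x i) q) (h q)"
proof -
  from frame[of p] obtain N :: nat and x E h where h: "h \<in> C" and
    *: "h p = 1 \<and> (\<forall>i<N. x i \<in> C \<and> E i \<in> VF) \<and>
      (\<forall>q. \<forall>v\<in>T q. \<forall>f\<in>C. h q * v f = (\<Sum>i<N. v (x i) * E i q f))"
    by (elim exE bexE) (rule that, assumption+)
  have xE: "\<And>i. i < N \<Longrightarrow> x i \<in> C" "\<And>i. i < N \<Longrightarrow> E i \<in> VF" using * by auto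
  have "finite_frame (T q) N (\<lambda>i. E i q) (\<lambda>i. D (x i) q) (h q)" for q
  proof
    fix v assume v: "v \<in> T q"
    show "(\<lambda>f. h q * v f) = (\<lambda>f. \<Sum>i<N. D (x i) q v * E i q f)"
    proof
      fix f show "h q * v f = (\<Sum>i<N. D (x i) q v * E i q f)"
        using v * T_outside[OF VF_T[OF xE(2)]] T_outside[OF v] by (cases "f \<in> C") (simp_all add: D_apply)
    qed
  qed (simp_all add: linear_space_T VF_T[OF xE(2)])
  then show ?thesis using * by (intro that[where h = h and x = x and E = E and N = N] h xE) auto
qed

lemma extend_to_field:
  assumes v: "v \<in> T p"
  shows "\<exists>X\<in>VF. X p = v"
proof -
  obtain N x E h where h: "h \<in> C" "h p = 1" and E: "\<And>i. i < N \<Longrightarrow> E i \<in> VF"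
    and fr: "\<And>q. finite_frame (T q) N (\<lambda>i. E i q) (\<lambda>i. D (x i) q) (h q)" by (rule frameE[of p]) (rule that)
  let ?X = "\<lambda>q f. \<Sum>i<N. D (x i) p v * E i q f"
  have "?X \<in> VF" by (rule VF_sum[OF finite_lessThan C_const]) (simp add: E)
  moreover have "?X p = v"
  proof -
    have "?X p = (\<lambda>f. h p * v f)" by (rule finite_frame.expand[OF fr v, symmetric])
    also have "\<dots> = v" by (simp add: h(2))
    finally show ?thesis .
  qed
  ultimately show ?thesis by (intro bexI[of _ ?X])
qed

lemma extend_to_fields:
  assumes "set vs \<subseteq> T p"
  obtains Xs where "length Xs = length vs" "set Xs \<subseteq> VF" "map (\<lambda>X. X p) Xs = vs"
proof -
  have "\<forall>v\<in>T p. \<exists>X\<in>VF. X p = v" by (intro ballI extend_to_field)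
  then obtain X where X: "\<forall>v\<in>T p. X v \<in> VF \<and> X v p = v" unfolding Bex_def by (rule bchoice[THEN exE])
  show ?thesis
  proof (rule that[of "map X vs"])
    show "set (map X vs) \<subseteq> VF" using X assms by auto
    show "map (\<lambda>X. X p) (map X vs) = vs" using X assms by (simp add: subset_iff) (rule map_idI, simp)
  qed simp
qed

text \<open>Tangent vectors extend to vector fields, so a form at a point is determined by its values on vector fields. This is how
all identities between forms are checked below.\<close>

lemma form_eqI:
  assumes "\<omega> \<in> alt_forms k (T p)" "\<eta> \<in> alt_forms k (T p)"
    and "\<And>Xs. length Xs = k \<Longrightarrow> set Xs \<subseteq> VF \<Longrightarrow> \<omega> (map (\<lambda>X. X p) Xs) = \<eta> (map (\<lambda>X. X p) Xs)"
  shows "\<omega> = \<eta>"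
proof (rule alt_forms_eqI[OF assms(1,2)])
  fix vs assume vs: "length vs = k" "set vs \<subseteq> T p"
  obtain Xs where "length Xs = length vs" "set Xs \<subseteq> VF" "map (\<lambda>X. X p) Xs = vs"
    by (rule extend_to_fields[OF vs(2)])
  then show "\<omega> vs = \<eta> vs" using assms(3)[of Xs] vs by simp
qed

section \<open>Smooth forms\<close>

definition dwedge :: "('a \<Rightarrow> real) list \<Rightarrow> 'a \<Rightarrow> 'a form" where
  "dwedge fs p = wedge (T p) (map (\<lambda>f. D f p) fs)"

lemma dwedge_alt: "length fs = k \<Longrightarrow> dwedge fs p \<in> alt_forms k (T p)"
  unfolding dwedge_def by (rule wedge_in_alt_forms[OF linear_space_T]) auto

text \<open>At a point the frame expansion writes every form as a combination of the forms \<open>df\<^sub>1 \<and> \<dots> \<and> df\<^sub>k\<close>; so a statement that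
is linear in a form needs to be checked only for these.\<close>

lemma form_induct [consumes 1, case_names wedge lincomb]:
  assumes \<omega>: "\<omega> \<in> alt_forms k (T p)"
    and w: "\<And>fs. length fs = k \<Longrightarrow> set fs \<subseteq> C \<Longrightarrow> Q (dwedge fs p)"
    and lin: "\<And>\<omega> \<eta> a b. \<omega> \<in> alt_forms k (T p) \<Longrightarrow> \<eta> \<in> alt_forms k (T p) \<Longrightarrow> Q \<omega> \<Longrightarrow> Q \<eta> \<Longrightarrow>
      Q (\<lambda>vs. a * \<omega> vs + b * \<eta> vs)"
  shows "Q \<omega>"
proof -
  obtain N x E h where h: "h \<in> C" "h p = 1" and x: "\<And>i. i < N \<Longrightarrow> x i \<in> C"
    and fr: "\<And>q. finite_frame (T q) N (\<lambda>i. E i q) (\<lambda>i. D (x i) q) (h q)" by (rule frameE[of p]) (rule that)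
  let ?w = "\<lambda>I. dwedge (map x I) p"
  let ?c = "\<lambda>I. \<omega> (map (\<lambda>i. E i p) I) / fact k"
  have wI: "?w I \<in> alt_forms k (T p)" "Q (?w I)" if "I \<in> tuples N k" for I
    using that x by (auto intro!: dwedge_alt w simp: tuples_def subset_iff)
  have "Q (\<lambda>vs. \<Sum>I\<in>S. ?c I * ?w I vs)" if "finite S" "S \<subseteq> tuples N k" for S
    using that
  proof (induction S)
    case empty
    let ?f = "replicate k (\<lambda>x. 0)"
    have "Q (\<lambda>vs. 0 * dwedge ?f p vs + 0 * dwedge ?f p vs)"
      by (intro lin dwedge_alt w) (auto simp: C_const)
    then show ?case by simp
  next
    case (insert I S)
    then have "Q (\<lambda>vs. ?c I * ?w I vs + 1 * (\<Sum>I\<in>S. ?c I * ?w I vs))"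
      by (intro lin alt_forms_sum wI) auto
    then show ?case using insert by simp
  qed
  from this[OF finite_tuples subset_refl] have "Q (\<lambda>vs. \<Sum>I\<in>tuples N k. ?c I * ?w I vs)" .
  also have "(\<lambda>vs. \<Sum>I\<in>tuples N k. ?c I * ?w I vs) = \<omega>"
  proof (rule alt_forms_eqI[OF alt_forms_sum \<omega>])
    fix vs assume vs: "length vs = k" "set vs \<subseteq> T p"
    have "fact k * \<omega> vs = (\<Sum>I\<in>tuples N k. \<omega> (map (\<lambda>i. E i p) I) * ?w I vs)"
      using finite_frame.alt_form_eq_sum_wedge[OF fr[of p] \<omega> vs] h by (simp add: dwedge_def o_def)
    also have "\<dots> = fact k * (\<Sum>I\<in>tuples N k. ?c I * ?w I vs)" by (simp add: sum_distrib_left)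
    finally show "(\<Sum>I\<in>tuples N k. ?c I * ?w I vs) = \<omega> vs" by simp
  qed (use wI in auto)
  finally show ?thesis .
qed

lemma form_alt: "\<alpha> \<in> diff_forms A k \<Longrightarrow> \<alpha> p \<in> alt_forms k (T p)"
  by (simp add: diff_forms_def)

lemma form_C: "\<alpha> \<in> diff_forms A k \<Longrightarrow> length Xs = k \<Longrightarrow> set Xs \<subseteq> VF \<Longrightarrow> eval_form \<alpha> Xs \<in> C"
  by (simp add: diff_forms_def)

lemma dwedge_apply:
  assumes "length Xs = length fs" "set Xs \<subseteq> VF"
  shows "eval_form (dwedge fs) Xs =
    (\<lambda>p. \<Sum>\<sigma> | \<sigma> permutes {..<length fs}. of_int (sign \<sigma>) * (\<Prod>i<length fs. (Xs ! \<sigma> i) p (fs ! i)))"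
proof
  fix p
  have "D (fs ! i) p ((Xs ! \<sigma> i) p) = (Xs ! \<sigma> i) p (fs ! i)" if "\<sigma> permutes {..<length fs}" "i < length fs" for \<sigma> i
  proof -
    have "\<sigma> i < length Xs" using that assms permutes_in_image[OF that(1), of i] by simp
    then show ?thesis using assms(2) by (intro D_apply VF_T) (auto dest: nth_mem)
  qed
  moreover have "(map (\<lambda>X. X p) Xs) ! \<sigma> i = (Xs ! \<sigma> i) p" if "\<sigma> permutes {..<length fs}" "i < length fs" for \<sigma> i
    using that assms permutes_in_image[OF that(1), of i] by simp
  moreover have "set (map (\<lambda>X. X p) Xs) \<subseteq> T p" by (rule set_map_VF[OF assms(2)])
  ultimately show "eval_form (dwedge fs) Xs p =
    (\<Sum>\<sigma> | \<sigma> permutes {..<length fs}. of_int (sign \<sigma>) * (\<Prod>i<length fs. (Xs ! \<sigma> i) p (fs ! i)))"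
    using assms by (auto simp: eval_form_def dwedge_def wedge_def intro!: sum.cong prod.cong)
qed

lemma dwedge_form:
  assumes "length fs = k" "set fs \<subseteq> C"
  shows "dwedge fs \<in> diff_forms A k"
  unfolding diff_forms_def
proof (intro CollectI conjI allI impI)
  show "dwedge fs p \<in> alt_forms k (T p)" for p by (rule dwedge_alt[OF assms(1)])
  fix Xs assume Xs: "length Xs = k \<and> set Xs \<subseteq> VF"
  have "(\<lambda>p. (Xs ! \<sigma> i) p (fs ! i)) \<in> C" if "\<sigma> permutes {..<length fs}" "i < length fs" for \<sigma> i
  proof -
    have "\<sigma> i < length Xs" using that assms Xs permutes_in_image[OF that(1), of i] by simp
    then have "Xs ! \<sigma> i \<in> VF" "fs ! i \<in> C" using Xs assms that by auto
    then show ?thesis by (rule VF_C)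
  qed
  then show "eval_form (dwedge fs) Xs \<in> C"
    using Xs assms by (subst dwedge_apply) (auto intro!: C_sum C_cmult C_prod finite_permutations)
qed

lemma form_lin:
  assumes "\<alpha> \<in> diff_forms A k" "\<beta> \<in> diff_forms A k" "u \<in> C" "w \<in> C"
  shows "(\<lambda>p vs. u p * \<alpha> p vs + w p * \<beta> p vs) \<in> diff_forms A k"
  using assms by (auto simp: diff_forms_def eval_form_def intro!: alt_forms_lincomb C_add C_mult)

lemma form_scale: "\<alpha> \<in> diff_forms A k \<Longrightarrow> u \<in> C \<Longrightarrow> (\<lambda>p vs. u p * \<alpha> p vs) \<in> diff_forms A k"
  using form_lin[of \<alpha> k \<alpha> u "\<lambda>x. 0"] C_const by simp

lemma form_sum:
  assumes "finite I" "\<And>i. i \<in> I \<Longrightarrow> u i \<in> C" "\<And>i. i \<in> I \<Longrightarrow> \<alpha> i \<in> diff_forms A k"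
  shows "(\<lambda>p vs. \<Sum>i\<in>I. u i p * \<alpha> i p vs) \<in> diff_forms A k"
  using assms
proof (induction I)
  case empty
  have "(\<lambda>vs. 0) \<in> alt_forms k (T p)" for p by (simp add: alt_forms_def)
  then show ?case by (simp add: diff_forms_def eval_form_def C_const)
next
  case (insert i I)
  then show ?case
    using form_lin[of "\<alpha> i" k "\<lambda>p vs. \<Sum>i\<in>I. u i p * \<alpha> i p vs" "u i" "\<lambda>x. 1"] C_const by simp
qed

lemma interior_form_in:
  assumes "\<alpha> \<in> diff_forms A (Suc k)" "Y \<in> VF"
  shows "interior_form Y \<alpha> \<in> diff_forms A k"
  unfolding diff_forms_def
proof (intro CollectI conjI allI impI)
  show "interior_form Y \<alpha> p \<in> alt_forms k (T p)" for p
    unfolding interior_form_def by (rule alt_forms_fix_first[OF form_alt[OF assms(1)] VF_T[OF assms(2)]])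
  fix Xs assume "length Xs = k \<and> set Xs \<subseteq> VF"
  then have "eval_form \<alpha> (Y # Xs) \<in> C" using assms by (intro form_C[of _ "Suc k"]) auto
  then show "eval_form (interior_form Y \<alpha>) Xs \<in> C" by (simp add: eval_form_def interior_form_def)
qed

text \<open>The same expansion with smooth coefficients, valid near \<open>p\<close> in the sense that it holds everywhere after multiplication by
\<open>H\<close>. Operators that obey a Leibniz rule are computed at \<open>p\<close> by applying them to both sides.\<close>

lemma local_decomposition:
  assumes \<alpha>: "\<alpha> \<in> diff_forms A k"
  obtains S :: "nat list set" and F a H where "finite S" "H \<in> C" "H p = 1"
    "\<And>I. I \<in> S \<Longrightarrow> a I \<in> C" "\<And>I. I \<in> S \<Longrightarrow> length (F I) = k" "\<And>I. I \<in> S \<Longrightarrow> set (F I) \<subseteq> C"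
    "(\<lambda>q vs. H q * \<alpha> q vs) = (\<lambda>q vs. \<Sum>I\<in>S. a I q * dwedge (F I) q vs)"
proof -
  obtain N x E h where h: "h \<in> C" "h p = 1" and x: "\<And>i. i < N \<Longrightarrow> x i \<in> C" and E: "\<And>i. i < N \<Longrightarrow> E i \<in> VF"
    and fr: "\<And>q. finite_frame (T q) N (\<lambda>i. E i q) (\<lambda>i. D (x i) q) (h q)" by (rule frameE[of p]) (rule that)
  let ?a = "\<lambda>I q. inverse (fact k) * eval_form \<alpha> (map E I) q"
  have a: "?a I \<in> C" if "I \<in> tuples N k" for I
    using that E by (intro C_cmult form_C[OF \<alpha>]) (auto simp: tuples_def)
  have eq: "h q ^ k * \<alpha> q vs = (\<Sum>I\<in>tuples N k. ?a I q * dwedge (map x I) q vs)" for q vs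
  proof (cases "length vs = k \<and> set vs \<subseteq> T q")
    case True
    then have "fact k * (h q ^ k * \<alpha> q vs) =
        (\<Sum>I\<in>tuples N k. eval_form \<alpha> (map E I) q * dwedge (map x I) q vs)"
      using finite_frame.alt_form_eq_sum_wedge[OF fr[of q] form_alt[OF \<alpha>], of vs]
      by (simp add: dwedge_def o_def eval_form_def)
    then have "h q ^ k * \<alpha> q vs = inverse (fact k) *
        (\<Sum>I\<in>tuples N k. eval_form \<alpha> (map E I) q * dwedge (map x I) q vs)"
      by (simp add: field_simps)
    then show ?thesis by (simp add: sum_distrib_left mult.assoc)
  next
    case False
    have "dwedge (map x I) q vs = 0" if "I \<in> tuples N k" for I
      by (rule alt_forms_outside[OF dwedge_alt False]) (use that in \<open>simp add: tuples_def\<close>)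
    then show ?thesis using alt_forms_outside[OF form_alt[OF \<alpha>] False] by simp
  qed
  show thesis
  proof (rule that[of "tuples N k" "\<lambda>q. h q ^ k" ?a "map x"])
    show "(\<lambda>q vs. h q ^ k * \<alpha> q vs) = (\<lambda>q vs. \<Sum>I\<in>tuples N k. ?a I q * dwedge (map x I) q vs)"
      by (intro ext eq)
    show "length (map x I) = k" "set (map x I) \<subseteq> C" if "I \<in> tuples N k" for I
      using that x by (auto simp: tuples_def)
  qed (use a h C_power[OF h(1)] in auto)
qed

text \<open>A prescription on vector fields comes from a form as soon as it does so at each point separately: smoothness of a form is
smoothness of its values on vector fields, and these are the prescribed ones.\<close>

lemma form_with_values_spec:
  assumes "\<And>Xs. length Xs = k \<Longrightarrow> set Xs \<subseteq> VF \<Longrightarrow> F Xs \<in> C"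
    and "\<And>p. \<exists>\<omega>\<in>alt_forms k (T p). \<forall>Xs. length Xs = k \<and> set Xs \<subseteq> VF \<longrightarrow> F Xs p = \<omega> (map (\<lambda>X. X p) Xs)"
  shows "form_with_values A k F \<in> diff_forms A k"
    and "length Xs = k \<Longrightarrow> set Xs \<subseteq> VF \<Longrightarrow> eval_form (form_with_values A k F) Xs = F Xs"
proof -
  let ?Q = "\<lambda>\<omega>. \<omega> \<in> diff_forms A k \<and> (\<forall>Xs. length Xs = k \<and> set Xs \<subseteq> VF \<longrightarrow> eval_form \<omega> Xs = F Xs)"
  obtain \<omega> where \<omega>: "\<And>p. \<omega> p \<in> alt_forms k (T p)"
    "\<And>p Xs. length Xs = k \<Longrightarrow> set Xs \<subseteq> VF \<Longrightarrow> F Xs p = \<omega> p (map (\<lambda>X. X p) Xs)"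
  proof -
    have "\<forall>p. \<exists>\<omega>. \<omega> \<in> alt_forms k (T p) \<and> (\<forall>Xs. length Xs = k \<and> set Xs \<subseteq> VF \<longrightarrow> F Xs p = \<omega> (map (\<lambda>X. X p) Xs))"
      using assms(2) unfolding Bex_def by (rule allI)
    from choice[OF this] obtain \<omega> where
      "\<forall>p. \<omega> p \<in> alt_forms k (T p) \<and> (\<forall>Xs. length Xs = k \<and> set Xs \<subseteq> VF \<longrightarrow> F Xs p = \<omega> p (map (\<lambda>X. X p) Xs))" ..
    then show thesis by (intro that[of \<omega>]) auto
  qed
  then have ev: "eval_form \<omega> Xs = F Xs" if "length Xs = k" "set Xs \<subseteq> VF" for Xs
    using that by (auto simp: eval_form_def)
  have "?Q \<omega>" using \<omega>(1) ev assms(1) by (auto simp: diff_forms_def)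
  moreover have "\<omega>' = \<omega>" if "?Q \<omega>'" for \<omega>'
  proof
    fix p
    show "\<omega>' p = \<omega> p"
    proof (rule form_eqI[OF form_alt \<omega>(1)])
      show "\<omega>' \<in> diff_forms A k" using that by simp
      fix Xs assume "length Xs = k" "set Xs \<subseteq> VF"
      then have "eval_form \<omega>' Xs p = eval_form \<omega> Xs p" using that ev by simp
      then show "\<omega>' p (map (\<lambda>X. X p) Xs) = \<omega> p (map (\<lambda>X. X p) Xs)" by (simp add: eval_form_def)
    qed
  qed
  ultimately have "?Q (form_with_values A k F)"
    unfolding form_with_values_def by (rule theI)
  then show "form_with_values A k F \<in> diff_forms A k"
    "length Xs = k \<Longrightarrow> set Xs \<subseteq> VF \<Longrightarrow> eval_form (form_with_values A k F) Xs = F Xs" by auto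
qed

end

section \<open>Cartan calculus\<close>

lemma alt_forms_move:
  assumes W: "linear_space W"
  shows "\<omega> \<in> alt_forms k W \<Longrightarrow> length vs = k \<Longrightarrow> set vs \<subseteq> W \<Longrightarrow> v \<in> W \<Longrightarrow> j < k \<Longrightarrow>
    \<omega> (v # omit j vs) = (-1) ^ j * \<omega> (vs[j := v])"
proof (induction j arbitrary: \<omega> k vs)
  case 0
  then show ?case by (cases vs) auto
next
  case (Suc j)
  then obtain w ws where vs: "vs = w # ws" by (cases vs) auto
  obtain k' where k: "k = Suc k'" using Suc.prems by (cases k) auto
  have ws: "length ws = k'" "set ws \<subseteq> W" "w \<in> W" "j < k'" using Suc.prems vs k by auto
  let ?l = "w # v # omit j ws"
  have l: "length ?l = k" "set ?l \<subseteq> W"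
    using ws Suc.prems k set_omit_subset[OF ws(2), of j] by auto
  have "\<omega> (v # omit (Suc j) vs) = \<omega> (?l[0 := ?l ! 1, 1 := ?l ! 0])" by (simp add: vs)
  also have "\<dots> = - \<omega> ?l" by (rule alt_forms_swap[OF W Suc.prems(1) l]) (use ws k in auto)
  also have "\<omega> ?l = (-1) ^ j * \<omega> (w # ws[j := v])"
    using Suc.IH[OF alt_forms_fix_first[OF Suc.prems(1)[unfolded k] ws(3)] ws(1,2) Suc.prems(4) ws(4)] .
  finally show ?case by (simp add: vs)
qed

lemma alt_forms_swap_first:
  assumes W: "linear_space W" and \<omega>: "\<omega> \<in> alt_forms k W" and l: "length (a # b # vs) = k" "set (a # b # vs) \<subseteq> W"
  shows "\<omega> (b # a # vs) = - \<omega> (a # b # vs)"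
  using alt_forms_swap[OF W \<omega> l, of 0 1] l by auto

context smooth_frames
begin

text \<open>The prescriptions by which \<open>lie_derivative\<close> and \<open>exterior_derivative\<close> are defined. Their algebra is developed first;
that they are tensorial, and so define forms, is a consequence.\<close>

definition lie_values :: "nat \<Rightarrow> ('a \<Rightarrow> 'a tangent) \<Rightarrow> ('a \<Rightarrow> 'a form) \<Rightarrow> ('a \<Rightarrow> 'a tangent) list \<Rightarrow> 'a \<Rightarrow> real" where
  "lie_values k X \<beta> = (\<lambda>Xs p. X p (eval_form \<beta> Xs) - (\<Sum>i<k. eval_form \<beta> (Xs[i := lie_bracket A X (Xs ! i)]) p))"

definition ext_values :: "nat \<Rightarrow> ('a \<Rightarrow> 'a form) \<Rightarrow> ('a \<Rightarrow> 'a tangent) list \<Rightarrow> 'a \<Rightarrow> real" where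
  "ext_values k \<alpha> = (\<lambda>Xs p.
     (\<Sum>i\<le>k. (-1) ^ i * (Xs ! i) p (eval_form \<alpha> (omit i Xs))) +
     (\<Sum>j\<le>k. \<Sum>i<j. (-1) ^ (i + j) *
        eval_form \<alpha> (lie_bracket A (Xs ! i) (Xs ! j) # omit i (omit j Xs)) p))"

lemma nth_VF: "set Xs \<subseteq> VF \<Longrightarrow> i < length Xs \<Longrightarrow> Xs ! i \<in> VF"
  using nth_mem by blast

lemma update_VF: "set Xs \<subseteq> VF \<Longrightarrow> X \<in> VF \<Longrightarrow> set (Xs[i := X]) \<subseteq> VF"
  by (rule list_update_subset)

lemma omit_VF: "set Xs \<subseteq> VF \<Longrightarrow> set (omit i Xs) \<subseteq> VF"
  by (rule set_omit_subset)

lemma eval_scale: "eval_form (\<lambda>p vs. u p * \<alpha> p vs) Xs = (\<lambda>p. u p * eval_form \<alpha> Xs p)"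
  by (simp add: eval_form_def)

lemma eval_sum: "eval_form (\<lambda>p vs. \<Sum>i\<in>I. \<alpha> i p vs) Xs = (\<lambda>p. \<Sum>i\<in>I. eval_form (\<alpha> i) Xs p)"
  by (simp add: eval_form_def)

lemma eval_interior: "eval_form (interior_form Y \<alpha>) Xs = eval_form \<alpha> (Y # Xs)"
  by (simp add: eval_form_def interior_form_def)

lemma lie_values_scale:
  assumes X: "X \<in> VF" and \<alpha>: "\<alpha> \<in> diff_forms A k" and u: "u \<in> C" and Z: "length Zs = k" "set Zs \<subseteq> VF"
  shows "lie_values k X (\<lambda>p vs. u p * \<alpha> p vs) Zs p = u p * lie_values k X \<alpha> Zs p + X p u * eval_form \<alpha> Zs p"
  using T_mult[OF VF_T[OF X] u form_C[OF \<alpha> Z], of p]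
  by (simp add: lie_values_def eval_scale sum_distrib_left algebra_simps)

lemma lie_values_sum:
  assumes X: "X \<in> VF" and I: "finite I" "\<And>i. i \<in> I \<Longrightarrow> \<alpha> i \<in> diff_forms A k" and Z: "length Zs = k" "set Zs \<subseteq> VF"
  shows "lie_values k X (\<lambda>p vs. \<Sum>i\<in>I. \<alpha> i p vs) Zs p = (\<Sum>i\<in>I. lie_values k X (\<alpha> i) Zs p)"
proof -
  have "X p (\<lambda>p. \<Sum>i\<in>I. eval_form (\<alpha> i) Zs p) = (\<Sum>i\<in>I. X p (eval_form (\<alpha> i) Zs))"
    by (rule T_sum[OF VF_T[OF X] I(1) form_C[OF I(2) Z]])
  then show ?thesis
    by (simp add: lie_values_def eval_sum sum_subtractf) (rule sum.swap)
qed

lemma lie_values_scale_field: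
  assumes X: "X \<in> VF" and \<alpha>: "\<alpha> \<in> diff_forms A k" and u: "u \<in> C" and Z: "length Zs = k" "set Zs \<subseteq> VF"
  shows "lie_values k (\<lambda>p f. u p * X p f) \<alpha> Zs p =
    u p * lie_values k X \<alpha> Zs p + (\<Sum>i<k. (Zs ! i) p u * eval_form \<alpha> (Zs[i := X]) p)"
proof -
  have step: "eval_form \<alpha> (Zs[i := lie_bracket A (\<lambda>p f. u p * X p f) (Zs ! i)]) p =
      u p * eval_form \<alpha> (Zs[i := lie_bracket A X (Zs ! i)]) p - (Zs ! i) p u * eval_form \<alpha> (Zs[i := X]) p"
    if i: "i < k" for i
  proof -
    have Zi: "Zs ! i \<in> VF" using nth_VF Z i by auto
    let ?vs = "map (\<lambda>X. X p) Zs"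
    have "\<alpha> p (?vs[i := (\<lambda>f. u p * lie_bracket A X (Zs ! i) p f + (- (Zs ! i) p u) * X p f)]) =
      u p * \<alpha> p (?vs[i := lie_bracket A X (Zs ! i) p]) + (- (Zs ! i) p u) * \<alpha> p (?vs[i := X p])"
      by (rule alt_forms_lin[OF form_alt[OF \<alpha>] _ set_map_VF[OF Z(2)] i VF_T[OF VF_bracket[OF X Zi]] VF_T[OF X]])
        (simp add: Z)
    then show ?thesis
      by (simp add: eval_form_def map_update bracket_scale_left[OF X Zi u])
  qed
  have "(\<Sum>i<k. eval_form \<alpha> (Zs[i := lie_bracket A (\<lambda>p f. u p * X p f) (Zs ! i)]) p) =
      (\<Sum>i<k. u p * eval_form \<alpha> (Zs[i := lie_bracket A X (Zs ! i)]) p - (Zs ! i) p u * eval_form \<alpha> (Zs[i := X]) p)"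
    by (rule sum.cong[OF refl], rule step) simp
  then show ?thesis by (simp add: lie_values_def sum_subtractf sum_distrib_left algebra_simps)
qed

lemma lie_values_sum_field:
  assumes I: "finite I" "\<And>i. i \<in> I \<Longrightarrow> X i \<in> VF" and \<alpha>: "\<alpha> \<in> diff_forms A k" and Z: "length Zs = k" "set Zs \<subseteq> VF"
  shows "lie_values k (\<lambda>p f. \<Sum>i\<in>I. X i p f) \<alpha> Zs p = (\<Sum>i\<in>I. lie_values k (X i) \<alpha> Zs p)"
proof -
  have "eval_form \<alpha> (Zs[j := lie_bracket A (\<lambda>p f. \<Sum>i\<in>I. X i p f) (Zs ! j)]) p =
      (\<Sum>i\<in>I. eval_form \<alpha> (Zs[j := lie_bracket A (X i) (Zs ! j)]) p)"
    if j: "j < k" for j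
  proof -
    have Zj: "Zs ! j \<in> VF" using nth_VF Z j by auto
    let ?vs = "map (\<lambda>X. X p) Zs"
    have "\<alpha> p (?vs[j := (\<lambda>f. \<Sum>i\<in>I. 1 * lie_bracket A (X i) (Zs ! j) p f)]) =
      (\<Sum>i\<in>I. 1 * \<alpha> p (?vs[j := lie_bracket A (X i) (Zs ! j) p]))"
      by (rule alt_forms_sum_arg[OF linear_space_T form_alt[OF \<alpha>] _ set_map_VF[OF Z(2)] j I(1)
            VF_T[OF VF_bracket[OF I(2) Zj]]]) (simp_all add: Z)
    then show ?thesis
      by (simp add: eval_form_def map_update bracket_sum_left[OF Zj I])
  qed
  then show ?thesis
    by (simp add: lie_values_def sum_subtractf) (rule sum.swap)
qed

lemma ext_values_scale:
  assumes \<alpha>: "\<alpha> \<in> diff_forms A k" and u: "u \<in> C" and Z: "length Zs = Suc k" "set Zs \<subseteq> VF"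
  shows "ext_values k (\<lambda>p vs. u p * \<alpha> p vs) Zs p =
    u p * ext_values k \<alpha> Zs p + (\<Sum>i\<le>k. (-1) ^ i * (Zs ! i) p u * eval_form \<alpha> (omit i Zs) p)"
proof -
  have "(Zs ! i) p (\<lambda>p. u p * eval_form \<alpha> (omit i Zs) p) =
      u p * (Zs ! i) p (eval_form \<alpha> (omit i Zs)) + eval_form \<alpha> (omit i Zs) p * (Zs ! i) p u" if "i \<le> k" for i
    by (rule T_mult[OF VF_T[OF nth_VF[OF Z(2)]] u form_C[OF \<alpha> _ omit_VF[OF Z(2)]]]) (use that Z in auto)
  then show ?thesis
    by (simp add: ext_values_def eval_scale sum_distrib_left sum.distrib algebra_simps)
qed

lemma ext_values_sum:
  assumes I: "finite I" "\<And>i. i \<in> I \<Longrightarrow> \<alpha> i \<in> diff_forms A k" and Z: "length Zs = Suc k" "set Zs \<subseteq> VF"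
  shows "ext_values k (\<lambda>p vs. \<Sum>i\<in>I. \<alpha> i p vs) Zs p = (\<Sum>i\<in>I. ext_values k (\<alpha> i) Zs p)"
proof -
  have "(Zs ! j) p (\<lambda>p. \<Sum>i\<in>I. eval_form (\<alpha> i) (omit j Zs) p) =
      (\<Sum>i\<in>I. (Zs ! j) p (eval_form (\<alpha> i) (omit j Zs)))" if "j \<le> k" for j
    by (rule T_sum[OF VF_T[OF nth_VF[OF Z(2)]] I(1) form_C[OF I(2) _ omit_VF[OF Z(2)]]]) (use that Z in auto)
  moreover have "(\<Sum>j\<le>k. \<Sum>m<j. \<Sum>i\<in>I. g i j m) = (\<Sum>i\<in>I. \<Sum>j\<le>k. \<Sum>m<j. g i j m)"
    for g :: "_ \<Rightarrow> nat \<Rightarrow> nat \<Rightarrow> real"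
  proof -
    have "(\<Sum>j\<le>k. \<Sum>m<j. \<Sum>i\<in>I. g i j m) = (\<Sum>j\<le>k. \<Sum>i\<in>I. \<Sum>m<j. g i j m)"
      by (intro sum.cong refl) (rule sum.swap)
    also have "\<dots> = (\<Sum>i\<in>I. \<Sum>j\<le>k. \<Sum>m<j. g i j m)" by (rule sum.swap)
    finally show ?thesis .
  qed
  moreover have "(\<Sum>j\<le>k. \<Sum>i\<in>I. g i j) = (\<Sum>i\<in>I. \<Sum>j\<le>k. g i j)" for g :: "_ \<Rightarrow> nat \<Rightarrow> real"
    by (rule sum.swap)
  ultimately show ?thesis
    by (simp add: ext_values_def eval_sum sum_distrib_left sum.distrib)
qed

text \<open>Cartan's formula \<open>i\<^sub>Y d = L\<^sub>Y - d i\<^sub>Y\<close>. In the sums that define the left side, the terms in which \<open>Y\<close> is differentiated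
along or bracketed give \<open>L\<^sub>Y \<alpha>\<close>, once the bracket is moved back to its slot; the remaining terms give \<open>d i\<^sub>Y \<alpha>\<close> up to
the sign from exchanging \<open>Y\<close> with the bracket in front.\<close>

lemma ext_values_Cons:
  assumes \<alpha>: "\<alpha> \<in> diff_forms A (Suc k)" and Y: "Y \<in> VF" and Z: "length Zs = Suc k" "set Zs \<subseteq> VF"
  shows "ext_values (Suc k) \<alpha> (Y # Zs) p = lie_values (Suc k) Y \<alpha> Zs p - ext_values k (interior_form Y \<alpha>) Zs p"
proof -
  let ?t = "\<lambda>i j. (-1) ^ (i + j) * eval_form \<alpha> (lie_bracket A ((Y # Zs) ! i) ((Y # Zs) ! j) # omit i (omit j (Y # Zs))) p"
  have 0: "?t 0 (Suc j) = - eval_form \<alpha> (Zs[j := lie_bracket A Y (Zs ! j)]) p" if j: "j \<le> k" for j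
  proof -
    let ?B = "lie_bracket A Y (Zs ! j)"
    have B: "?B \<in> VF" using nth_VF[OF Z(2)] j Z(1) by (auto intro: VF_bracket[OF Y])
    have "\<alpha> p (?B p # omit j (map (\<lambda>X. X p) Zs)) = (-1) ^ j * \<alpha> p ((map (\<lambda>X. X p) Zs)[j := ?B p])"
      by (rule alt_forms_move[OF linear_space_T form_alt[OF \<alpha>] _ set_map_VF[OF Z(2)] VF_T[OF B]])
        (use Z j in auto)
    then show ?thesis by (simp add: eval_form_def map_omit map_update flip: power_add)
  qed
  have S: "?t (Suc i) (Suc j) = - ((-1) ^ (i + j) *
      eval_form (interior_form Y \<alpha>) (lie_bracket A (Zs ! i) (Zs ! j) # omit i (omit j Zs)) p)"
    if j: "j \<le> k" "i < j" for i j
  proof -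
    let ?B = "lie_bracket A (Zs ! i) (Zs ! j)"
    have B: "?B \<in> VF" by (rule VF_bracket[OF nth_VF[OF Z(2)] nth_VF[OF Z(2)]]) (use Z j in auto)
    have "set (map (\<lambda>X. X p) (Y # ?B # omit i (omit j Zs))) \<subseteq> T p"
      by (rule set_map_VF) (use Y B omit_VF[OF omit_VF[OF Z(2)]] in auto)
    then have "\<alpha> p (?B p # Y p # map (\<lambda>X. X p) (omit i (omit j Zs))) =
        - \<alpha> p (Y p # ?B p # map (\<lambda>X. X p) (omit i (omit j Zs)))"
      by (intro alt_forms_swap_first[OF linear_space_T form_alt[OF \<alpha>]]) (use Z j in auto)
    then show ?thesis by (simp add: eval_form_def interior_form_def)
  qed
  have "(\<Sum>j\<le>Suc k. \<Sum>i<j. ?t i j) = (\<Sum>j\<le>k. \<Sum>i<Suc j. ?t i (Suc j))"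
    by (subst sum.atMost_Suc_shift) simp
  also have "\<dots> = (\<Sum>j\<le>k. ?t 0 (Suc j) + (\<Sum>i<j. ?t (Suc i) (Suc j)))"
    by (intro sum.cong refl) (rule sum.lessThan_Suc_shift)
  also have "\<dots> = - (\<Sum>j\<le>k. eval_form \<alpha> (Zs[j := lie_bracket A Y (Zs ! j)]) p)
      - (\<Sum>j\<le>k. \<Sum>i<j. (-1) ^ (i + j) *
        eval_form (interior_form Y \<alpha>) (lie_bracket A (Zs ! i) (Zs ! j) # omit i (omit j Zs)) p)"
  proof -
    have "(\<Sum>j\<le>k. ?t 0 (Suc j) + (\<Sum>i<j. ?t (Suc i) (Suc j))) =
      (\<Sum>j\<le>k. - eval_form \<alpha> (Zs[j := lie_bracket A Y (Zs ! j)]) p + (\<Sum>i<j. - ((-1) ^ (i + j) *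
        eval_form (interior_form Y \<alpha>) (lie_bracket A (Zs ! i) (Zs ! j) # omit i (omit j Zs)) p)))"
      by (intro sum.cong refl arg_cong2[where f = "(+)"] 0 S) auto
    also have "\<dots> = - (\<Sum>j\<le>k. eval_form \<alpha> (Zs[j := lie_bracket A Y (Zs ! j)]) p)
      - (\<Sum>j\<le>k. \<Sum>i<j. (-1) ^ (i + j) *
        eval_form (interior_form Y \<alpha>) (lie_bracket A (Zs ! i) (Zs ! j) # omit i (omit j Zs)) p)"
      by (simp add: sum.distrib sum_negf sum_subtractf)
    finally show ?thesis .
  qed
  finally have 2: "(\<Sum>j\<le>Suc k. \<Sum>i<j. ?t i j) = \<dots>" .
  have 1: "(\<Sum>i\<le>Suc k. (-1) ^ i * ((Y # Zs) ! i) p (eval_form \<alpha> (omit i (Y # Zs)))) =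
      Y p (eval_form \<alpha> Zs) - (\<Sum>i\<le>k. (-1) ^ i * (Zs ! i) p (eval_form (interior_form Y \<alpha>) (omit i Zs)))"
    by (subst sum.atMost_Suc_shift) (simp add: eval_interior sum_negf)
  show ?thesis
    unfolding ext_values_def lie_values_def 1 2 by (simp add: lessThan_Suc_atMost)
qed

lemma T_prod:
  assumes v: "v \<in> T p" and "finite I" "\<And>i. i \<in> I \<Longrightarrow> g i \<in> C"
  shows "v (\<lambda>x. \<Prod>i\<in>I. g i x) = (\<Sum>j\<in>I. v (g j) * (\<Prod>i\<in>I - {j}. g i p))"
  using assms(2,3)
proof (induction I)
  case empty
  then show ?case by (simp add: T_const[OF v])
next
  case (insert j I)
  have "v (\<lambda>x. \<Prod>i\<in>insert j I. g i x) = g j p * v (\<lambda>x. \<Prod>i\<in>I. g i x) + (\<Prod>i\<in>I. g i p) * v (g j)"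
    using insert T_mult[OF v, of "g j" "\<lambda>x. \<Prod>i\<in>I. g i x"] by (simp add: C_prod)
  also have "g j p * v (\<lambda>x. \<Prod>i\<in>I. g i x) = (\<Sum>m\<in>I. v (g m) * (\<Prod>i\<in>insert j I - {m}. g i p))"
  proof -
    have "insert j I - {m} = insert j (I - {m})" if "m \<in> I" for m using that insert by auto
    then have "(\<Prod>i\<in>insert j I - {m}. g i p) = g j p * (\<Prod>i\<in>I - {m}. g i p)" if "m \<in> I" for m
      using that insert by simp
    then show ?thesis using insert by (simp add: sum_distrib_left algebra_simps)
  qed
  also have "(\<Prod>i\<in>I. g i p) = (\<Prod>i\<in>insert j I - {j}. g i p)" using insert by simp
  finally show ?case using insert by (simp add: mult.commute)
qed

text \<open>\<open>L\<^sub>X\<close> acts on \<open>df\<^sub>1 \<and> \<dots> \<and> df\<^sub>k\<close> as a derivation with \<open>L\<^sub>X df = d (X f)\<close>. In each term of the determinant, the product rule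
for \<open>X\<close> leaves \<open>X (Z f) - [X, Z] f = Z (X f)\<close>.\<close>

lemma lie_values_dwedge:
  assumes X: "X \<in> VF" and fs: "length fs = k" "set fs \<subseteq> C" and Z: "length Zs = k" "set Zs \<subseteq> VF"
  shows "lie_values k X (dwedge fs) Zs p = (\<Sum>j<k. eval_form (dwedge (fs[j := (\<lambda>q. X q (fs ! j))])) Zs p)"
proof -
  let ?P = "{\<sigma>. \<sigma> permutes {..<k}}"
  let ?R = "\<lambda>\<sigma> j. \<Prod>i\<in>{..<k} - {j}. (Zs ! \<sigma> i) p (fs ! i)"
  have one: "(\<Prod>i<k. if i = j then a else b i) = a * (\<Prod>i\<in>{..<k} - {j}. b i)" if "j < k" for j a and b :: "nat \<Rightarrow> real"
  proof -
    have "(\<Prod>i<k. if i = j then a else b i) = a * (\<Prod>i\<in>{..<k} - {j}. if i = j then a else b i)"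
      using that by (subst prod.remove[of _ j]) auto
    also have "(\<Prod>i\<in>{..<k} - {j}. if i = j then a else b i) = (\<Prod>i\<in>{..<k} - {j}. b i)"
      by (intro prod.cong) auto
    finally show ?thesis .
  qed
  have ZV: "Zs ! \<sigma> i \<in> VF" "fs ! i \<in> C" if "\<sigma> \<in> ?P" "i < k" for \<sigma> i
  proof -
    have "\<sigma> i < k" using permutes_in_image[of \<sigma> "{..<k}" i] that by simp
    then show "Zs ! \<sigma> i \<in> VF" using nth_VF Z by simp
    show "fs ! i \<in> C" using that fs by auto
  qed
  \<comment> \<open>\<open>?R \<sigma> j\<close> is the product of the entries other than the one that is differentiated.\<close>
  have A: "X p (eval_form (dwedge fs) Zs) =
      (\<Sum>\<sigma>\<in>?P. of_int (sign \<sigma>) * (\<Sum>j<k. X p (\<lambda>q. (Zs ! \<sigma> j) q (fs ! j)) * ?R \<sigma> j))"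
  proof -
    have g: "(\<lambda>q. (Zs ! \<sigma> i) q (fs ! i)) \<in> C" if "\<sigma> \<in> ?P" "i < k" for \<sigma> i
      by (rule VF_C[OF ZV[OF that]])
    have "X p (eval_form (dwedge fs) Zs) =
        X p (\<lambda>q. \<Sum>\<sigma>\<in>?P. of_int (sign \<sigma>) * (\<Prod>i<k. (Zs ! \<sigma> i) q (fs ! i)))"
      using dwedge_apply[of Zs fs] fs Z by simp
    also have "\<dots> = (\<Sum>\<sigma>\<in>?P. X p (\<lambda>q. of_int (sign \<sigma>) * (\<Prod>i<k. (Zs ! \<sigma> i) q (fs ! i))))"
      by (rule T_sum[OF VF_T[OF X]]) (use g in \<open>auto intro!: finite_permutations C_cmult C_prod\<close>)
    also have "\<dots> = (\<Sum>\<sigma>\<in>?P. of_int (sign \<sigma>) * (\<Sum>j<k. X p (\<lambda>q. (Zs ! \<sigma> j) q (fs ! j)) * ?R \<sigma> j))"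
    proof (rule sum.cong[OF refl])
      fix \<sigma> assume \<sigma>: "\<sigma> \<in> ?P"
      have "X p (\<lambda>q. of_int (sign \<sigma>) * (\<Prod>i<k. (Zs ! \<sigma> i) q (fs ! i))) =
          of_int (sign \<sigma>) * X p (\<lambda>q. \<Prod>i<k. (Zs ! \<sigma> i) q (fs ! i))"
        by (rule T_cmult[OF VF_T[OF X]]) (use g[OF \<sigma>] in \<open>auto intro!: C_prod\<close>)
      also have "X p (\<lambda>q. \<Prod>i<k. (Zs ! \<sigma> i) q (fs ! i)) = (\<Sum>j<k. X p (\<lambda>q. (Zs ! \<sigma> j) q (fs ! j)) * ?R \<sigma> j)"
        by (rule T_prod[OF VF_T[OF X]]) (use g[OF \<sigma>] in auto)
      finally show "X p (\<lambda>q. of_int (sign \<sigma>) * (\<Prod>i<k. (Zs ! \<sigma> i) q (fs ! i))) =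
        of_int (sign \<sigma>) * (\<Sum>j<k. X p (\<lambda>q. (Zs ! \<sigma> j) q (fs ! j)) * ?R \<sigma> j)" .
    qed
    finally show ?thesis .
  qed
  have B: "(\<Sum>m<k. eval_form (dwedge fs) (Zs[m := lie_bracket A X (Zs ! m)]) p) =
      (\<Sum>\<sigma>\<in>?P. of_int (sign \<sigma>) * (\<Sum>j<k. lie_bracket A X (Zs ! \<sigma> j) p (fs ! j) * ?R \<sigma> j))"
  proof -
    have "(\<Sum>m<k. eval_form (dwedge fs) (Zs[m := lie_bracket A X (Zs ! m)]) p) =
      (\<Sum>m<k. \<Sum>\<sigma>\<in>?P. of_int (sign \<sigma>) * (\<Prod>i<k. (Zs[m := lie_bracket A X (Zs ! m)] ! \<sigma> i) p (fs ! i)))"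
    proof (rule sum.cong[OF refl])
      fix m assume "m \<in> {..<k}"
      then have "set (Zs[m := lie_bracket A X (Zs ! m)]) \<subseteq> VF"
        by (intro update_VF Z VF_bracket X nth_VF) (use Z in auto)
      then show "eval_form (dwedge fs) (Zs[m := lie_bracket A X (Zs ! m)]) p =
          (\<Sum>\<sigma>\<in>?P. of_int (sign \<sigma>) * (\<Prod>i<k. (Zs[m := lie_bracket A X (Zs ! m)] ! \<sigma> i) p (fs ! i)))"
        using dwedge_apply[of "Zs[m := lie_bracket A X (Zs ! m)]" fs] fs Z by simp
    qed
    also have "\<dots> = (\<Sum>\<sigma>\<in>?P. of_int (sign \<sigma>) * (\<Sum>m<k. \<Prod>i<k. (Zs[m := lie_bracket A X (Zs ! m)] ! \<sigma> i) p (fs ! i)))"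
      by (subst sum.swap) (simp add: sum_distrib_left)
    also have "\<dots> = (\<Sum>\<sigma>\<in>?P. of_int (sign \<sigma>) * (\<Sum>j<k. lie_bracket A X (Zs ! \<sigma> j) p (fs ! j) * ?R \<sigma> j))"
    proof (rule sum.cong[OF refl], rule arg_cong2[where f = "(*)", OF refl])
      fix \<sigma> assume "\<sigma> \<in> ?P"
      then have \<sigma>: "\<sigma> permutes {..<k}" by simp
      have lt: "\<sigma> i < k" if "i < k" for i using permutes_in_image[OF \<sigma>, of i] that by simp
      have "(\<Sum>m<k. \<Prod>i<k. (Zs[m := lie_bracket A X (Zs ! m)] ! \<sigma> i) p (fs ! i)) =
          (\<Sum>j<k. \<Prod>i<k. (Zs[\<sigma> j := lie_bracket A X (Zs ! \<sigma> j)] ! \<sigma> i) p (fs ! i))"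
        using sum.permute[OF \<sigma>, of "\<lambda>m. \<Prod>i<k. (Zs[m := lie_bracket A X (Zs ! m)] ! \<sigma> i) p (fs ! i)"] by (simp add: o_def)
      also have "\<dots> = (\<Sum>j<k. lie_bracket A X (Zs ! \<sigma> j) p (fs ! j) * ?R \<sigma> j)"
      proof (rule sum.cong[OF refl])
        fix j assume j: "j \<in> {..<k}"
        have "(\<Prod>i<k. (Zs[\<sigma> j := lie_bracket A X (Zs ! \<sigma> j)] ! \<sigma> i) p (fs ! i)) =
          (\<Prod>i<k. if i = j then lie_bracket A X (Zs ! \<sigma> j) p (fs ! j) else (Zs ! \<sigma> i) p (fs ! i))"
          by (intro prod.cong refl)
            (use lt j Z permutes_inj[OF \<sigma>] in \<open>auto simp: nth_list_update inj_eq\<close>)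
        then show "(\<Prod>i<k. (Zs[\<sigma> j := lie_bracket A X (Zs ! \<sigma> j)] ! \<sigma> i) p (fs ! i)) =
          lie_bracket A X (Zs ! \<sigma> j) p (fs ! j) * ?R \<sigma> j" using one[of j] j by simp
      qed
      finally show "(\<Sum>m<k. \<Prod>i<k. (Zs[m := lie_bracket A X (Zs ! m)] ! \<sigma> i) p (fs ! i)) =
          (\<Sum>j<k. lie_bracket A X (Zs ! \<sigma> j) p (fs ! j) * ?R \<sigma> j)" .
    qed
    finally show ?thesis .
  qed
  have "(\<Sum>j<k. eval_form (dwedge (fs[j := (\<lambda>q. X q (fs ! j))])) Zs p) =
      (\<Sum>j<k. \<Sum>\<sigma>\<in>?P. of_int (sign \<sigma>) * ((Zs ! \<sigma> j) p (\<lambda>q. X q (fs ! j)) * ?R \<sigma> j))"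
  proof (rule sum.cong[OF refl])
    fix j assume j: "j \<in> {..<k}"
    have "(\<Prod>i<k. (Zs ! \<sigma> i) p (fs[j := (\<lambda>q. X q (fs ! j))] ! i)) = (Zs ! \<sigma> j) p (\<lambda>q. X q (fs ! j)) * ?R \<sigma> j" for \<sigma>
    proof -
      have "(\<Prod>i<k. (Zs ! \<sigma> i) p (fs[j := (\<lambda>q. X q (fs ! j))] ! i)) =
          (\<Prod>i<k. if i = j then (Zs ! \<sigma> j) p (\<lambda>q. X q (fs ! j)) else (Zs ! \<sigma> i) p (fs ! i))"
        by (intro prod.cong refl) (use j fs in \<open>auto simp: nth_list_update\<close>)
      then show ?thesis using one[of j] j by simp
    qed
    then show "eval_form (dwedge (fs[j := (\<lambda>q. X q (fs ! j))])) Zs p =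
        (\<Sum>\<sigma>\<in>?P. of_int (sign \<sigma>) * ((Zs ! \<sigma> j) p (\<lambda>q. X q (fs ! j)) * ?R \<sigma> j))"
      using dwedge_apply[of Zs "fs[j := (\<lambda>q. X q (fs ! j))]"] fs Z by simp
  qed
  also have "\<dots> = (\<Sum>\<sigma>\<in>?P. of_int (sign \<sigma>) * (\<Sum>j<k. (Zs ! \<sigma> j) p (\<lambda>q. X q (fs ! j)) * ?R \<sigma> j))"
    by (subst sum.swap) (simp add: sum_distrib_left)
  also have "\<dots> = (\<Sum>\<sigma>\<in>?P. of_int (sign \<sigma>) * ((\<Sum>j<k. X p (\<lambda>q. (Zs ! \<sigma> j) q (fs ! j)) * ?R \<sigma> j)
      - (\<Sum>j<k. lie_bracket A X (Zs ! \<sigma> j) p (fs ! j) * ?R \<sigma> j)))"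
  proof (rule sum.cong[OF refl], rule arg_cong2[where f = "(*)", OF refl])
    fix \<sigma> assume \<sigma>: "\<sigma> \<in> ?P"
    have "(Zs ! \<sigma> j) p (\<lambda>q. X q (fs ! j)) = X p (\<lambda>q. (Zs ! \<sigma> j) q (fs ! j)) - lie_bracket A X (Zs ! \<sigma> j) p (fs ! j)"
      if "j < k" for j using bracket_apply[OF ZV(2)[OF \<sigma> that]] by simp
    then show "(\<Sum>j<k. (Zs ! \<sigma> j) p (\<lambda>q. X q (fs ! j)) * ?R \<sigma> j) = (\<Sum>j<k. X p (\<lambda>q. (Zs ! \<sigma> j) q (fs ! j)) * ?R \<sigma> j)
      - (\<Sum>j<k. lie_bracket A X (Zs ! \<sigma> j) p (fs ! j) * ?R \<sigma> j)"
      by (simp add: sum_subtractf[symmetric] left_diff_distrib)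
  qed
  finally show ?thesis
    unfolding lie_values_def A B by (simp add: right_diff_distrib sum_subtractf)
qed

lemma map_VF_D: "set vs \<subseteq> T p \<Longrightarrow> i < length vs \<Longrightarrow> D f p (vs ! i) = (vs ! i) f"
  using D_apply nth_mem by blast

lemma dwedge_update:
  assumes "length vs = length fs" "set vs \<subseteq> T p" "j < length fs"
  shows "dwedge (fs[j := g]) p vs = (\<Sum>i<length vs. (-1) ^ (i + j) * (vs ! i) g * dwedge (omit j fs) p (omit i vs))"
proof -
  have "dwedge (fs[j := g]) p vs = (\<Sum>i<length vs. (-1) ^ (i + j) * D g p (vs ! i) * dwedge (omit j fs) p (omit i vs))"
    using wedge_update_row[of vs "map (\<lambda>f. D f p) fs" "T p" j "D g p"] assms
    by (simp add: dwedge_def map_update map_omit)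
  then show ?thesis using map_VF_D[OF assms(2)] by simp
qed

lemma dwedge_Cons:
  assumes "length vs = Suc (length fs)" "set vs \<subseteq> T p"
  shows "dwedge (g # fs) p vs = (\<Sum>i<length vs. (-1) ^ i * (vs ! i) g * dwedge fs p (omit i vs))"
  using dwedge_update[of vs "g # fs" p 0 g] assms by simp

lemma interior_dwedge:
  assumes fs: "length fs = Suc k" and Y: "Y \<in> VF"
  shows "interior_form Y (dwedge fs) = (\<lambda>p vs. \<Sum>j<Suc k. ((-1) ^ j * Y p (fs ! j)) * dwedge (omit j fs) p vs)"
proof (intro ext)
  fix p vs
  show "interior_form Y (dwedge fs) p vs = (\<Sum>j<Suc k. ((-1) ^ j * Y p (fs ! j)) * dwedge (omit j fs) p vs)"
  proof (cases "length vs = k \<and> set vs \<subseteq> T p")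
    case True
    have "D f p (Y p) = Y p f" for f by (rule D_apply[OF VF_T[OF Y]])
    then show ?thesis
      using wedge_expand_col[of "Y p # vs" "map (\<lambda>f. D f p) fs" "T p" 0] True fs VF_T[OF Y]
      by (simp add: interior_form_def dwedge_def map_omit del: sum.lessThan_Suc)
  next
    case False
    have "dwedge (omit j fs) p vs = 0" if "j < Suc k" for j
      by (rule alt_forms_outside[OF dwedge_alt False]) (use fs that in simp)
    moreover have "dwedge fs p (Y p # vs) = 0"
      by (rule alt_forms_outside[OF dwedge_alt[OF fs]]) (use False in auto)
    ultimately show ?thesis by (simp add: interior_form_def del: sum.lessThan_Suc)
  qed
qed

lemma ext_values_scale_dwedge:
  assumes closed: "ext_values k (dwedge fs) Zs p = 0"
    and fs: "length fs = k" "set fs \<subseteq> C" and u: "u \<in> C" and Z: "length Zs = Suc k" "set Zs \<subseteq> VF"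
  shows "ext_values k (\<lambda>p vs. u p * dwedge fs p vs) Zs p = dwedge (u # fs) p (map (\<lambda>X. X p) Zs)"
proof -
  have "dwedge (u # fs) p (map (\<lambda>X. X p) Zs) =
      (\<Sum>i<Suc k. (-1) ^ i * (map (\<lambda>X. X p) Zs ! i) u * dwedge fs p (omit i (map (\<lambda>X. X p) Zs)))"
    using dwedge_Cons[of "map (\<lambda>X. X p) Zs" fs p u] fs Z set_map_VF[OF Z(2)] by (simp del: sum.lessThan_Suc)
  also have "\<dots> = (\<Sum>i<Suc k. (-1) ^ i * (Zs ! i) p u * eval_form (dwedge fs) (omit i Zs) p)"
    by (rule sum.cong[OF refl]) (use Z in \<open>simp add: eval_form_def map_omit\<close>)
  finally show ?thesis
    using ext_values_scale[OF dwedge_form[OF fs] u Z, of p] closed by (simp add: lessThan_Suc_atMost)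
qed

text \<open>The forms \<open>df\<^sub>1 \<and> \<dots> \<and> df\<^sub>k\<close> are closed: by Cartan's formula \<open>i\<^sub>Y d\<close> of such a form is \<open>L\<^sub>Y\<close> of it minus \<open>d i\<^sub>Y\<close> of it.
Here \<open>i\<^sub>Y\<close> is a combination of \<open>k - 1\<close>-fold products with coefficients \<open>\<plusminus> Y f\<^sub>j\<close>, whose derivative is known by
induction; it agrees with \<open>L\<^sub>Y\<close> term by term.\<close>

lemma ext_values_dwedge:
  "length fs = k \<Longrightarrow> set fs \<subseteq> C \<Longrightarrow> length Zs = Suc k \<Longrightarrow> set Zs \<subseteq> VF \<Longrightarrow> ext_values k (dwedge fs) Zs p = 0"
proof (induction k arbitrary: fs Zs)
  case 0
  then obtain Y where Y: "Zs = [Y]" by (auto simp: length_Suc_conv)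
  have "eval_form (dwedge []) [] = (\<lambda>p. 1)" by (simp add: eval_form_def dwedge_def)
  then show ?case using 0 Y T_const[OF VF_T, of Y p 1] by (simp add: ext_values_def)
next
  case (Suc k)
  then obtain Y Ws where Zs: "Zs = Y # Ws" by (cases Zs) auto
  have Y: "Y \<in> VF" and W: "length Ws = Suc k" "set Ws \<subseteq> VF" using Suc.prems Zs by auto
  let ?vs = "map (\<lambda>X. X p) Ws"
  have vs: "length ?vs = length fs" "set ?vs \<subseteq> T p" using W Suc.prems set_map_VF[OF W(2)] by auto
  define u where "u j = (\<lambda>q. (-1) ^ j * Y q (fs ! j))" for j
  have Yf: "(\<lambda>q. Y q (fs ! j)) \<in> C" if "j < Suc k" for j
    by (rule VF_C[OF Y]) (use that Suc.prems in auto)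
  have u: "u j \<in> C" if "j < Suc k" for j unfolding u_def by (rule C_cmult[OF Yf[OF that]])
  have om: "length (omit j fs) = k" "set (omit j fs) \<subseteq> C" if "j < Suc k" for j
    using that Suc.prems set_omit_subset[OF Suc.prems(2)] by auto
  have "ext_values k (interior_form Y (dwedge fs)) Ws p = ext_values k (\<lambda>p vs. \<Sum>j<Suc k. u j p * dwedge (omit j fs) p vs) Ws p"
    using interior_dwedge[OF Suc.prems(1) Y] by (simp add: u_def del: sum.lessThan_Suc)
  also have "\<dots> = (\<Sum>j<Suc k. ext_values k (\<lambda>p vs. u j p * dwedge (omit j fs) p vs) Ws p)"
    by (rule ext_values_sum[OF finite_lessThan form_scale[OF dwedge_form[OF om] u] W]) simp_all
  also have "\<dots> = (\<Sum>j<Suc k. eval_form (dwedge (fs[j := (\<lambda>q. Y q (fs ! j))])) Ws p)"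
  proof (rule sum.cong[OF refl])
    fix j assume "j \<in> {..<Suc k}"
    then have j: "j < Suc k" by simp
    have "ext_values k (\<lambda>p vs. u j p * dwedge (omit j fs) p vs) Ws p = dwedge (u j # omit j fs) p ?vs"
      by (rule ext_values_scale_dwedge[OF Suc.IH[OF om[OF j] W] om[OF j] u[OF j] W])
    also have "\<dots> = (\<Sum>i<length ?vs. (-1) ^ i * (?vs ! i) (u j) * dwedge (omit j fs) p (omit i ?vs))"
      by (rule dwedge_Cons) (use om[OF j] vs W in auto)
    also have "\<dots> = (\<Sum>i<length ?vs. (-1) ^ (i + j) * (?vs ! i) (\<lambda>q. Y q (fs ! j)) * dwedge (omit j fs) p (omit i ?vs))"
    proof (rule sum.cong[OF refl])
      fix i assume "i \<in> {..<length ?vs}"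
      then have "?vs ! i \<in> T p" using vs(2) nth_mem[of i ?vs] by auto
      then have "(?vs ! i) (u j) = (-1) ^ j * (?vs ! i) (\<lambda>q. Y q (fs ! j))"
        unfolding u_def by (rule T_cmult[OF _ Yf[OF j]])
      then show "(-1) ^ i * (?vs ! i) (u j) * dwedge (omit j fs) p (omit i ?vs) =
          (-1) ^ (i + j) * (?vs ! i) (\<lambda>q. Y q (fs ! j)) * dwedge (omit j fs) p (omit i ?vs)"
        by (simp only:) (simp add: power_add)
    qed
    also have "\<dots> = dwedge (fs[j := (\<lambda>q. Y q (fs ! j))]) p ?vs"
      by (rule dwedge_update[symmetric, OF vs]) (use j Suc.prems in simp)
    finally show "ext_values k (\<lambda>p vs. u j p * dwedge (omit j fs) p vs) Ws p =
        eval_form (dwedge (fs[j := (\<lambda>q. Y q (fs ! j))])) Ws p" by (simp add: eval_form_def)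
  qed
  also have "\<dots> = lie_values (Suc k) Y (dwedge fs) Ws p"
    by (rule lie_values_dwedge[symmetric, OF Y Suc.prems(1,2) W])
  finally show ?case
    using ext_values_Cons[OF dwedge_form[OF Suc.prems(1,2)] Y W] by (simp add: Zs)
qed

lemma ext_values_C:
  assumes \<alpha>: "\<alpha> \<in> diff_forms A k" and Z: "length Zs = Suc k" "set Zs \<subseteq> VF"
  shows "ext_values k \<alpha> Zs \<in> C"
  unfolding ext_values_def
proof (intro C_add C_sum finite_lessThan finite_atMost C_cmult)
  show "(\<lambda>p. (Zs ! i) p (eval_form \<alpha> (omit i Zs))) \<in> C" if "i \<in> {..k}" for i
    by (rule VF_C[OF nth_VF[OF Z(2)] form_C[OF \<alpha> _ omit_VF[OF Z(2)]]]) (use that Z in auto)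
  show "eval_form \<alpha> (lie_bracket A (Zs ! i) (Zs ! j) # omit i (omit j Zs)) \<in> C" if "j \<in> {..k}" "i \<in> {..<j}" for i j
  proof (rule form_C[OF \<alpha>])
    have "lie_bracket A (Zs ! i) (Zs ! j) \<in> VF"
      by (rule VF_bracket[OF nth_VF[OF Z(2)] nth_VF[OF Z(2)]]) (use that Z in auto)
    then show "set (lie_bracket A (Zs ! i) (Zs ! j) # omit i (omit j Zs)) \<subseteq> VF"
      using omit_VF[OF omit_VF[OF Z(2)], of i j] by simp
  qed (use that Z in auto)
qed

text \<open>Near \<open>p\<close>, \<open>H \<alpha> = \<Sum> a\<^sub>I dF\<^sub>I\<close>, so by the Leibniz rule and closedness the value of \<open>d \<alpha>\<close> at \<open>p\<close> is
\<open>\<Sum> (da\<^sub>I \<and> dF\<^sub>I - a\<^sub>I dH \<and> dF\<^sub>I)\<close>, which is visibly a form.\<close>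

lemma ext_values_tensorial:
  assumes \<alpha>: "\<alpha> \<in> diff_forms A k"
  shows "\<exists>\<omega>\<in>alt_forms (Suc k) (T p). \<forall>Zs. length Zs = Suc k \<and> set Zs \<subseteq> VF \<longrightarrow>
    ext_values k \<alpha> Zs p = \<omega> (map (\<lambda>X. X p) Zs)"
proof -
  obtain S :: "nat list set" and F a H where S: "finite S" and H: "H \<in> C" "H p = 1"
    and a: "\<And>I. I \<in> S \<Longrightarrow> a I \<in> C" and F: "\<And>I. I \<in> S \<Longrightarrow> length (F I) = k" "\<And>I. I \<in> S \<Longrightarrow> set (F I) \<subseteq> C"
    and dec: "(\<lambda>q vs. H q * \<alpha> q vs) = (\<lambda>q vs. \<Sum>I\<in>S. a I q * dwedge (F I) q vs)"
    by (rule local_decomposition[OF \<alpha>, of p]) (rule that)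
  define w where "w I = (\<lambda>vs. 1 * dwedge (a I # F I) p vs + (- a I p) * dwedge (H # F I) p vs)" for I
  have w: "w I \<in> alt_forms (Suc k) (T p)" if "I \<in> S" for I
    unfolding w_def by (intro alt_forms_lincomb dwedge_alt) (simp_all add: F[OF that])
  let ?\<omega> = "\<lambda>vs. \<Sum>I\<in>S. 1 * w I vs"
  have "ext_values k \<alpha> Zs p = ?\<omega> (map (\<lambda>X. X p) Zs)" if Z: "length Zs = Suc k" "set Zs \<subseteq> VF" for Zs
  proof -
    let ?vs = "map (\<lambda>X. X p) Zs"
    have "\<alpha> p vs = (\<Sum>I\<in>S. a I p * dwedge (F I) p vs)" for vs
      using fun_cong[OF fun_cong[OF dec, of p], of vs] H(2) by simp
    then have "(\<Sum>i\<le>k. (-1) ^ i * (Zs ! i) p H * eval_form \<alpha> (omit i Zs) p) =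
        (\<Sum>i\<le>k. \<Sum>I\<in>S. a I p * ((-1) ^ i * (Zs ! i) p H * dwedge (F I) p (omit i ?vs)))"
      by (simp add: eval_form_def map_omit sum_distrib_left algebra_simps)
    also have "\<dots> = (\<Sum>I\<in>S. a I p * (\<Sum>i\<le>k. (-1) ^ i * (Zs ! i) p H * dwedge (F I) p (omit i ?vs)))"
      by (subst sum.swap) (simp add: sum_distrib_left)
    also have "\<dots> = (\<Sum>I\<in>S. a I p * dwedge (H # F I) p ?vs)"
    proof (rule sum.cong[OF refl])
      fix I assume I: "I \<in> S"
      have "dwedge (H # F I) p ?vs = (\<Sum>i<length ?vs. (-1) ^ i * (?vs ! i) H * dwedge (F I) p (omit i ?vs))"
        by (rule dwedge_Cons) (use F[OF I] Z set_map_VF[OF Z(2)] in auto)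
      also have "\<dots> = (\<Sum>i\<le>k. (-1) ^ i * (Zs ! i) p H * dwedge (F I) p (omit i ?vs))"
        by (rule sum.cong) (use Z in auto)
      finally show "a I p * (\<Sum>i\<le>k. (-1) ^ i * (Zs ! i) p H * dwedge (F I) p (omit i ?vs)) = a I p * dwedge (H # F I) p ?vs"
        by simp
    qed
    finally have 1: "(\<Sum>i\<le>k. (-1) ^ i * (Zs ! i) p H * eval_form \<alpha> (omit i Zs) p) =
      (\<Sum>I\<in>S. a I p * dwedge (H # F I) p ?vs)" .
    have "ext_values k \<alpha> Zs p + (\<Sum>i\<le>k. (-1) ^ i * (Zs ! i) p H * eval_form \<alpha> (omit i Zs) p) =
        ext_values k (\<lambda>q vs. H q * \<alpha> q vs) Zs p"
      using ext_values_scale[OF \<alpha> H(1) Z, of p] H(2) by simp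
    also have "\<dots> = (\<Sum>I\<in>S. ext_values k (\<lambda>q vs. a I q * dwedge (F I) q vs) Zs p)"
      unfolding dec by (rule ext_values_sum[OF S form_scale[OF dwedge_form[OF F] a] Z])
    also have "\<dots> = (\<Sum>I\<in>S. dwedge (a I # F I) p ?vs)"
      by (rule sum.cong[OF refl], rule ext_values_scale_dwedge[OF ext_values_dwedge[OF F Z] F a Z])
    finally show ?thesis unfolding 1 w_def by (simp add: sum_subtractf)
  qed
  moreover have "?\<omega> \<in> alt_forms (Suc k) (T p)"
    by (intro alt_forms_sum S w)
  ultimately show ?thesis by (intro bexI[of _ ?\<omega>]) auto
qed

lemma exterior_derivative_form:
  assumes "\<alpha> \<in> diff_forms A k"
  shows "exterior_derivative A k \<alpha> \<in> diff_forms A (Suc k)"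
    and "length Zs = Suc k \<Longrightarrow> set Zs \<subseteq> VF \<Longrightarrow> eval_form (exterior_derivative A k \<alpha>) Zs = ext_values k \<alpha> Zs"
  using form_with_values_spec[OF ext_values_C[OF assms] ext_values_tensorial[OF assms]]
  by (simp_all add: exterior_derivative_def ext_values_def)

text \<open>For the Lie derivative, Cartan's formula exhibits the form.\<close>

lemma lie_derivative_form:
  assumes X: "X \<in> VF" and \<alpha>: "\<alpha> \<in> diff_forms A (Suc k)"
  shows "lie_derivative A (Suc k) X \<alpha> \<in> diff_forms A (Suc k)"
    and "length Zs = Suc k \<Longrightarrow> set Zs \<subseteq> VF \<Longrightarrow>
      eval_form (lie_derivative A (Suc k) X \<alpha>) Zs = lie_values (Suc k) X \<alpha> Zs"
proof -
  define \<beta> where "\<beta> = (\<lambda>p vs. 1 * interior_form X (exterior_derivative A (Suc k) \<alpha>) p vs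
    + 1 * exterior_derivative A k (interior_form X \<alpha>) p vs)"
  have \<beta>: "\<beta> \<in> diff_forms A (Suc k)"
    unfolding \<beta>_def
    by (intro form_lin C_const interior_form_in exterior_derivative_form(1) X \<alpha>)
  have "lie_values (Suc k) X \<alpha> Zs = eval_form \<beta> Zs" if Z: "length Zs = Suc k" "set Zs \<subseteq> VF" for Zs
  proof -
    have "eval_form (exterior_derivative A (Suc k) \<alpha>) (X # Zs) = ext_values (Suc k) \<alpha> (X # Zs)"
      by (rule exterior_derivative_form(2)[OF \<alpha>]) (use X Z in auto)
    then show ?thesis
      using exterior_derivative_form(2)[OF interior_form_in[OF \<alpha> X] Z] ext_values_Cons[OF \<alpha> X Z]
      by (simp add: fun_eq_iff \<beta>_def eval_form_def interior_form_def)
  qed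
  then have *: "lie_values (Suc k) X \<alpha> Zs \<in> C" "lie_values (Suc k) X \<alpha> Zs p = \<beta> p (map (\<lambda>X. X p) Zs)"
    if "length Zs = Suc k" "set Zs \<subseteq> VF" for Zs p
    using that form_C[OF \<beta> that] by (simp_all add: eval_form_def)
  have "\<exists>\<omega>\<in>alt_forms (Suc k) (T p). \<forall>Zs. length Zs = Suc k \<and> set Zs \<subseteq> VF \<longrightarrow>
      lie_values (Suc k) X \<alpha> Zs p = \<omega> (map (\<lambda>X. X p) Zs)" for p
    by (rule bexI[OF _ form_alt[OF \<beta>, of p]]) (simp add: *(2))
  from form_with_values_spec[OF *(1) this]
  show "lie_derivative A (Suc k) X \<alpha> \<in> diff_forms A (Suc k)"
    and "length Zs = Suc k \<Longrightarrow> set Zs \<subseteq> VF \<Longrightarrow>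
      eval_form (lie_derivative A (Suc k) X \<alpha>) Zs = lie_values (Suc k) X \<alpha> Zs"
    by (simp_all add: lie_derivative_def lie_values_def)
qed

end

section \<open>The map \<open>\<pi>\<^sup>\<sharp>\<close>\<close>

text \<open>The order of the structure is \<open>n = m + 1\<close>, which makes the degree \<open>m\<close> of \<open>i\<^sub>Y \<alpha>\<close> available for \<open>n\<close>-forms \<open>\<alpha>\<close>.\<close>

locale smooth_multivector = smooth_frames A for A :: "('a, 'e::euclidean_space) atlas" +
  fixes m :: nat and \<pi> :: "'a \<Rightarrow> 'a multivector"
  assumes \<pi>: "\<pi> \<in> multivector_fields A (Suc (Suc m))"
begin

abbreviation "n \<equiv> Suc m"

definition B :: "('a \<Rightarrow> real) list \<Rightarrow> 'a \<Rightarrow> real" where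
  "B fs p = \<pi> p (map (\<lambda>f. D f p) fs)"

lemma \<pi>_alt: "\<pi> p \<in> alt_forms (Suc n) (dual (T p))"
  using \<pi> unfolding multivector_fields_def by auto

lemma B_C: "length fs = Suc n \<Longrightarrow> set fs \<subseteq> C \<Longrightarrow> B fs \<in> C"
  using \<pi> unfolding multivector_fields_def B_def[abs_def] by auto

lemma B_lin:
  assumes "length fs = Suc n" "i < Suc n" "f \<in> C" "g \<in> C"
  shows "B (fs[i := (\<lambda>x. a * f x + b * g x)]) p = a * B (fs[i := f]) p + b * B (fs[i := g]) p"
  unfolding B_def map_update D_lin[OF assms(3,4)]
  by (rule alt_forms_lin[OF \<pi>_alt]) (use assms in auto)

lemma B_mult:
  assumes "length fs = Suc n" "i < Suc n" "f \<in> C" "g \<in> C"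
  shows "B (fs[i := (\<lambda>x. f x * g x)]) p = f p * B (fs[i := g]) p + g p * B (fs[i := f]) p"
  unfolding B_def map_update D_mult[OF assms(3,4)]
  by (rule alt_forms_lin[OF \<pi>_alt]) (use assms in auto)

lemma B_swap:
  assumes "length fs = Suc n" "i < Suc n" "j < Suc n" "i \<noteq> j"
  shows "B (fs[i := fs ! j, j := fs ! i]) p = - B fs p"
  using alt_forms_swap[OF linear_space_dual \<pi>_alt _ set_map_D[where fs = fs] assms(2-4), of p] assms
  by (simp add: B_def map_update)

lemma contract_apply: "f \<in> C \<Longrightarrow> contract_covectors A p (\<pi> p) \<xi>s f = \<pi> p (\<xi>s @ [D f p])"
  by (simp add: contract_covectors_def)

lemma contract_T:
  assumes "length \<xi>s = n" "set \<xi>s \<subseteq> dual (T p)"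
  shows "contract_covectors A p (\<pi> p) \<xi>s \<in> T p"
proof (rule TI)
  have lin: "\<pi> p (\<xi>s @ [\<lambda>v. a * D f p v + b * D g p v]) = a * \<pi> p (\<xi>s @ [D f p]) + b * \<pi> p (\<xi>s @ [D g p])" for f g a b
    using alt_forms_lin[OF \<pi>_alt, of "\<xi>s @ [D f p]" p n "D f p" "D g p" a b] assms
    by (simp add: list_update_append)
  show "contract_covectors A p (\<pi> p) \<xi>s (\<lambda>x. a * f x + b * g x) =
      a * contract_covectors A p (\<pi> p) \<xi>s f + b * contract_covectors A p (\<pi> p) \<xi>s g"
    if "f \<in> C" "g \<in> C" for f g a b
    using that by (simp add: contract_apply C_lin D_lin lin)
  show "contract_covectors A p (\<pi> p) \<xi>s (\<lambda>x. f x * g x) =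
      f p * contract_covectors A p (\<pi> p) \<xi>s g + g p * contract_covectors A p (\<pi> p) \<xi>s f"
    if "f \<in> C" "g \<in> C" for f g
    using that by (simp add: contract_apply C_mult D_mult lin)
qed (simp add: contract_covectors_def)

text \<open>The predicate inside the definite description of \<open>sharp\<close>. A map that satisfies it is written down in a frame; two such
maps agree on the decomposable forms, which span.\<close>

definition is_sharp :: "'a \<Rightarrow> ('a form \<Rightarrow> 'a tangent) \<Rightarrow> bool" where
  "is_sharp p L \<longleftrightarrow>
     (\<forall>\<xi>. \<xi> \<notin> alt_forms n (T p) \<longrightarrow> L \<xi> = (\<lambda>f. 0)) \<and>
     (\<forall>\<xi>\<in>alt_forms n (T p). L \<xi> \<in> T p) \<and>
     (\<forall>\<xi>\<in>alt_forms n (T p). \<forall>\<eta>\<in>alt_forms n (T p). \<forall>a b.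
        L (\<lambda>vs. a * \<xi> vs + b * \<eta> vs) = (\<lambda>f. a * L \<xi> f + b * L \<eta> f)) \<and>
     (\<forall>\<xi>s. length \<xi>s = n \<and> set \<xi>s \<subseteq> dual (T p) \<longrightarrow>
        L (wedge (T p) \<xi>s) = contract_covectors A p (\<pi> p) \<xi>s)"

lemma is_sharp_exists: "\<exists>L. is_sharp p L"
proof -
  obtain N x E h where h: "h \<in> C" "h p = 1" and E: "\<And>i. i < N \<Longrightarrow> E i \<in> VF"
    and fr: "\<And>q. finite_frame (T q) N (\<lambda>i. E i q) (\<lambda>i. D (x i) q) (h q)" by (rule frameE[of p]) (rule that)
  let ?K = "\<lambda>I. contract_covectors A p (\<pi> p) (map (\<lambda>i. D (x i) p) I)"
  let ?E = "\<lambda>I. map (\<lambda>i. E i p) I"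
  define L where "L \<omega> = (if \<omega> \<in> alt_forms n (T p) then (\<lambda>f. \<Sum>I\<in>tuples N n. (\<omega> (?E I) / fact n) * ?K I f) else (\<lambda>f. 0))" for \<omega>
  have K: "?K I \<in> T p" if "I \<in> tuples N n" for I
    by (rule contract_T) (use that in \<open>auto simp: tuples_def\<close>)
  have 2: "L \<omega> \<in> T p" for \<omega>
  proof (cases "\<omega> \<in> alt_forms n (T p)")
    case True
    then have "L \<omega> = (\<lambda>f. \<Sum>I\<in>tuples N n. (\<omega> (?E I) / fact n) * ?K I f)" by (simp only: L_def if_True)
    then show ?thesis by (simp only:) (rule T_sum_mem[OF finite_tuples K])
  next
    case False
    then show ?thesis by (simp add: L_def T_zero)
  qed
  have 3: "L (\<lambda>vs. a * \<xi> vs + b * \<eta> vs) = (\<lambda>f. a * L \<xi> f + b * L \<eta> f)"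
    if "\<xi> \<in> alt_forms n (T p)" "\<eta> \<in> alt_forms n (T p)" for \<xi> \<eta> a b
    using that alt_forms_lincomb[OF that, of a b]
    by (simp add: L_def sum_distrib_left sum.distrib add_divide_distrib algebra_simps)
  have 4: "L (wedge (T p) \<xi>s) = contract_covectors A p (\<pi> p) \<xi>s" if \<xi>s: "length \<xi>s = n" "set \<xi>s \<subseteq> dual (T p)" for \<xi>s
  proof
    fix f show "L (wedge (T p) \<xi>s) f = contract_covectors A p (\<pi> p) \<xi>s f"
    proof (cases "f \<in> C")
      case True
      have w: "wedge (T p) \<xi>s \<in> alt_forms n (T p)" by (rule wedge_in_alt_forms[OF linear_space_T \<xi>s(2,1)])
      have "fact n * \<pi> p (\<xi>s @ [D f p]) =
          (\<Sum>I\<in>tuples N n. wedge (T p) \<xi>s (?E I) * \<pi> p (map (\<lambda>i. D (x i) p) I @ [D f p]))"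
        using finite_frame.multivector_eq_sum_wedge[OF fr[of p] D_dual alt_forms_fix_last[OF \<pi>_alt D_dual] \<xi>s, of f] h(2)
        by simp
      then have "\<pi> p (\<xi>s @ [D f p]) =
          inverse (fact n) * (\<Sum>I\<in>tuples N n. wedge (T p) \<xi>s (?E I) * \<pi> p (map (\<lambda>i. D (x i) p) I @ [D f p]))"
        by (simp add: field_simps del: fact_Suc)
      then show ?thesis
        using True w by (simp add: L_def contract_apply sum_distrib_left divide_inverse mult.commute mult.left_commute del: fact_Suc)
    next
      case False
      then show ?thesis by (simp add: L_def contract_covectors_def)
    qed
  qed
  have 1: "L \<xi> = (\<lambda>f. 0)" if "\<xi> \<notin> alt_forms n (T p)" for \<xi> using that by (simp add: L_def)
  show ?thesis unfolding is_sharp_def using 1 2 3 4 by (intro exI[of _ L]) auto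
qed

lemma is_sharp_unique:
  assumes "is_sharp p L" "is_sharp p L'"
  shows "L = L'"
proof
  fix \<omega>
  show "L \<omega> = L' \<omega>"
  proof (cases "\<omega> \<in> alt_forms n (T p)")
    case True
    then show ?thesis
    proof (induction rule: form_induct)
      case (wedge fs)
      then show ?case using assms by (simp add: dwedge_def is_sharp_def image_subset_iff)
    next
      case (lincomb \<omega> \<eta> a b)
      then show ?case using assms unfolding is_sharp_def by simp
    qed
  next
    case False
    then show ?thesis using assms by (simp add: is_sharp_def)
  qed
qed

abbreviation "sh p \<equiv> sharp A n \<pi> p"

lemma is_sharp_sharp: "is_sharp p (sh p)"
proof -
  obtain L where L: "is_sharp p L" using is_sharp_exists by blast
  have "is_sharp p (THE L. is_sharp p L)"
    by (rule theI[of _ L]) (use L is_sharp_unique in auto)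
  then show ?thesis unfolding sharp_def is_sharp_def .
qed

lemma sharp_T: "\<omega> \<in> alt_forms n (T p) \<Longrightarrow> sh p \<omega> \<in> T p"
  using is_sharp_sharp[of p] by (simp add: is_sharp_def)

lemma sharp_lin:
  "\<omega> \<in> alt_forms n (T p) \<Longrightarrow> \<eta> \<in> alt_forms n (T p) \<Longrightarrow>
    sh p (\<lambda>vs. a * \<omega> vs + b * \<eta> vs) = (\<lambda>f. a * sh p \<omega> f + b * sh p \<eta> f)"
  using is_sharp_sharp[of p] by (simp add: is_sharp_def)

lemma sharp_scale: "\<omega> \<in> alt_forms n (T p) \<Longrightarrow> sh p (\<lambda>vs. a * \<omega> vs) = (\<lambda>f. a * sh p \<omega> f)"
  using sharp_lin[of \<omega> p \<omega> a 0] by simp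

lemma sharp_sum:
  assumes "finite I" "\<And>i. i \<in> I \<Longrightarrow> \<omega> i \<in> alt_forms n (T p)"
  shows "sh p (\<lambda>vs. \<Sum>i\<in>I. c i * \<omega> i vs) = (\<lambda>f. \<Sum>i\<in>I. c i * sh p (\<omega> i) f)"
  using assms
proof (induction I)
  case empty
  have "dwedge (replicate n (\<lambda>x. 0)) p \<in> alt_forms n (T p)" by (rule dwedge_alt) simp
  from sharp_scale[OF this, of 0] show ?case by simp
next
  case (insert j I)
  then have "sh p (\<lambda>vs. c j * \<omega> j vs + 1 * (\<Sum>i\<in>I. c i * \<omega> i vs)) =
      (\<lambda>f. c j * sh p (\<omega> j) f + 1 * sh p (\<lambda>vs. \<Sum>i\<in>I. c i * \<omega> i vs) f)"
    by (intro sharp_lin alt_forms_sum) auto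
  then show ?case using insert by simp
qed

text \<open>The Hamiltonian vector field \<open>{f\<^sub>1, \<dots>, f\<^sub>n, \<cdot>}\<close>.\<close>

definition ham :: "('a \<Rightarrow> real) list \<Rightarrow> 'a \<Rightarrow> 'a tangent" where
  "ham F p = contract_covectors A p (\<pi> p) (map (\<lambda>f. D f p) F)"

lemma ham_apply: "f \<in> C \<Longrightarrow> ham F p f = B (F @ [f]) p"
  by (simp add: ham_def contract_apply B_def)

lemma ham_VF:
  assumes "length F = n" "set F \<subseteq> C"
  shows "ham F \<in> VF"
proof (rule VFI)
  show "ham F p \<in> T p" for p unfolding ham_def by (rule contract_T) (use assms in auto)
  show "(\<lambda>p. ham F p f) \<in> C" if "f \<in> C" for f
    using B_C[of "F @ [f]"] assms that by (simp add: ham_apply)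
qed

lemma sharp_dwedge:
  assumes "length F = n"
  shows "sh p (dwedge F p) = ham F p"
  using is_sharp_sharp[of p] assms by (simp add: is_sharp_def dwedge_def ham_def image_subset_iff)

section \<open>The bracket of sections of the graph\<close>

definition sec :: "('a \<Rightarrow> 'a tangent) \<Rightarrow> ('a \<Rightarrow> 'a form) \<Rightarrow> bool" where
  "sec X \<alpha> \<longleftrightarrow> X \<in> VF \<and> \<alpha> \<in> diff_forms A n \<and> (\<forall>p. X p = sh p (\<alpha> p))"

lemma graph_sections_iff: "(X, \<alpha>) \<in> graph_sections A n \<pi> \<longleftrightarrow> sec X \<alpha>"
  using form_alt[of \<alpha> n] by (auto simp: graph_sections_def graph_at_def sec_def)

lemma secD: "sec X \<alpha> \<Longrightarrow> X \<in> VF" "sec X \<alpha> \<Longrightarrow> \<alpha> \<in> diff_forms A n" "sec X \<alpha> \<Longrightarrow> X p = sh p (\<alpha> p)"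
  by (auto simp: sec_def)

lemma sec_ham: "length F = n \<Longrightarrow> set F \<subseteq> C \<Longrightarrow> sec (ham F) (dwedge F)"
  by (simp add: sec_def ham_VF dwedge_form sharp_dwedge)

lemma sec_scale:
  assumes s: "sec X \<alpha>" and u: "u \<in> C"
  shows "sec (\<lambda>p f. u p * X p f) (\<lambda>p vs. u p * \<alpha> p vs)"
  unfolding sec_def using VF_scale[OF secD(1)[OF s] u] form_scale[OF secD(2)[OF s] u]
    sharp_scale[OF form_alt[OF secD(2)[OF s]]] secD(3)[OF s] by simp

definition bracket_form :: "('a \<Rightarrow> 'a tangent) \<Rightarrow> ('a \<Rightarrow> 'a form) \<Rightarrow> ('a \<Rightarrow> 'a tangent) \<Rightarrow> ('a \<Rightarrow> 'a form) \<Rightarrow> 'a \<Rightarrow> 'a form" where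
  "bracket_form X \<alpha> Y \<beta> = (\<lambda>p vs. lie_derivative A n X \<beta> p vs - lie_derivative A n Y \<alpha> p vs
        + exterior_derivative A m (interior_form Y \<alpha>) p vs)"

lemma bracket_form_form:
  assumes "X \<in> VF" "Y \<in> VF" "\<alpha> \<in> diff_forms A n" "\<beta> \<in> diff_forms A n"
  shows "bracket_form X \<alpha> Y \<beta> \<in> diff_forms A n"
proof -
  let ?a = "lie_derivative A n X \<beta>" and ?b = "lie_derivative A n Y \<alpha>" and ?c = "exterior_derivative A m (interior_form Y \<alpha>)"
  have a: "?a \<in> diff_forms A n" "?b \<in> diff_forms A n" "?c \<in> diff_forms A n"
    using lie_derivative_form(1)[OF assms(1,4)] lie_derivative_form(1)[OF assms(2,3)]
      exterior_derivative_form(1)[OF interior_form_in[OF assms(3,2)]] by auto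
  have "(\<lambda>p vs. 1 * (1 * ?a p vs + (-1) * ?b p vs) + 1 * ?c p vs) \<in> diff_forms A n"
    by (intro form_lin a C_const)
  then show ?thesis by (simp add: bracket_form_def)
qed

text \<open>By Cartan's formula the form component of the Dorfman bracket is \<open>L\<^sub>X \<beta> - i\<^sub>Y d\<alpha>\<close>.\<close>

lemma bracket_form_values:
  assumes "X \<in> VF" "Y \<in> VF" "\<alpha> \<in> diff_forms A n" "\<beta> \<in> diff_forms A n" and Z: "length Zs = n" "set Zs \<subseteq> VF"
  shows "bracket_form X \<alpha> Y \<beta> p (map (\<lambda>X. X p) Zs) = lie_values n X \<beta> Zs p - ext_values n \<alpha> (Y # Zs) p"
  using fun_cong[OF lie_derivative_form(2)[OF assms(1,4) Z], of p] fun_cong[OF lie_derivative_form(2)[OF assms(2,3) Z], of p]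
    fun_cong[OF exterior_derivative_form(2)[OF interior_form_in[OF assms(3,2)] Z], of p]
    ext_values_Cons[OF assms(3,2) Z, of p]
  by (simp add: bracket_form_def eval_form_def)

text \<open>The obstruction for the bracket of two sections to lie in the graph at \<open>p\<close>.\<close>

definition defect :: "('a \<Rightarrow> 'a tangent) \<Rightarrow> ('a \<Rightarrow> 'a form) \<Rightarrow> ('a \<Rightarrow> 'a tangent) \<Rightarrow> ('a \<Rightarrow> 'a form) \<Rightarrow> 'a \<Rightarrow> 'a tangent" where
  "defect X \<alpha> Y \<beta> p = (\<lambda>f. lie_bracket A X Y p f - sh p (bracket_form X \<alpha> Y \<beta> p) f)"

lemma graph_closed_iff:
  "graph_closed A n \<pi> \<longleftrightarrow> (\<forall>X \<alpha> Y \<beta>. sec X \<alpha> \<longrightarrow> sec Y \<beta> \<longrightarrow> (\<forall>p. defect X \<alpha> Y \<beta> p = (\<lambda>f. 0)))"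
proof -
  have 1: "sec (lie_bracket A X Y) (bracket_form X \<alpha> Y \<beta>) \<longleftrightarrow> (\<forall>p. defect X \<alpha> Y \<beta> p = (\<lambda>f. 0))"
    if "sec X \<alpha>" "sec Y \<beta>" for X \<alpha> Y \<beta>
    using that VF_bracket bracket_form_form by (auto simp: sec_def defect_def fun_eq_iff)
  have 2: "dorfman_bracket A n (X, \<alpha>) (Y, \<beta>) \<in> graph_sections A n \<pi> \<longleftrightarrow> sec (lie_bracket A X Y) (bracket_form X \<alpha> Y \<beta>)"
    for X \<alpha> Y \<beta>
    unfolding graph_sections_iff[symmetric] by (simp add: bracket_form_def)
  have 3: "(\<forall>s\<in>graph_sections A n \<pi>. Q s) \<longleftrightarrow> (\<forall>X \<alpha>. sec X \<alpha> \<longrightarrow> Q (X, \<alpha>))" for Q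
    unfolding graph_sections_iff[symmetric] by auto
  show ?thesis unfolding graph_closed_def 3 2 using 1 by blast
qed

text \<open>For exact forms \<open>\<alpha> = dF\<close> and \<open>\<beta> = dG\<close> the form component is \<open>L\<^sub>X dG\<close>, since \<open>dF\<close> is closed. Expanding it by the
derivation property, the obstruction evaluated at a function \<open>g\<close> is the difference of the two sides of the fundamental
identity for \<open>F\<close> and \<open>(G, g)\<close>.\<close>

lemma defect_exact:
  assumes F: "length F = n" "set F \<subseteq> C" and G: "length G = n" "set G \<subseteq> C" and g: "g \<in> C"
  shows "defect (ham F) (dwedge F) (ham G) (dwedge G) p g =
    B (F @ [B (G @ [g])]) p - (\<Sum>i<Suc n. B ((G @ [g])[i := B (F @ [(G @ [g]) ! i])]) p)"
proof -
  note VF = ham_VF[OF F] ham_VF[OF G] and df = dwedge_form[OF F] dwedge_form[OF G]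
  let ?G = "\<lambda>j. G[j := (\<lambda>q. ham F q (G ! j))]"
  let ?w = "\<lambda>vs. \<Sum>j<n. 1 * dwedge (?G j) p vs"
  have w: "?w \<in> alt_forms n (T p)" by (rule alt_forms_sum) (use G in \<open>auto intro!: dwedge_alt\<close>)
  have "bracket_form (ham F) (dwedge F) (ham G) (dwedge G) p = ?w"
  proof (rule form_eqI[OF form_alt[OF bracket_form_form[OF VF df]] w])
    fix Zs assume Z: "length Zs = n" "set Zs \<subseteq> VF"
    have "ext_values n (dwedge F) (ham G # Zs) p = 0"
      by (rule ext_values_dwedge[OF F]) (use Z VF in auto)
    then show "bracket_form (ham F) (dwedge F) (ham G) (dwedge G) p (map (\<lambda>X. X p) Zs) = ?w (map (\<lambda>X. X p) Zs)"
      using bracket_form_values[OF VF df Z, of p] lie_values_dwedge[OF VF(1) G Z, of p]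
      by (simp add: eval_form_def del: sum.lessThan_Suc)
  qed
  then have "sh p (bracket_form (ham F) (dwedge F) (ham G) (dwedge G) p) g = (\<Sum>j<n. sh p (dwedge (?G j) p) g)"
    using sharp_sum[of "{..<n}" "\<lambda>j. dwedge (?G j) p" p "\<lambda>j. 1"] G by (simp add: dwedge_alt del: sum.lessThan_Suc)
  also have "\<dots> = (\<Sum>j<n. B ((G @ [g])[j := B (F @ [(G @ [g]) ! j])]) p)"
  proof (rule sum.cong[OF refl])
    fix j assume j: "j \<in> {..<n}"
    then have "G ! j \<in> C" using G by auto
    then have "(\<lambda>q. ham F q (G ! j)) = B (F @ [G ! j])" by (simp add: ham_apply)
    then show "sh p (dwedge (?G j) p) g = B ((G @ [g])[j := B (F @ [(G @ [g]) ! j])]) p"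
      using j G g by (simp add: sharp_dwedge ham_apply list_update_append nth_append)
  qed
  finally have 1: "sh p (bracket_form (ham F) (dwedge F) (ham G) (dwedge G) p) g =
      (\<Sum>j<n. B ((G @ [g])[j := B (F @ [(G @ [g]) ! j])]) p)" .
  have "(\<lambda>q. ham G q g) = B (G @ [g])" "(\<lambda>q. ham F q g) = B (F @ [g])" using g by (simp_all add: ham_apply)
  moreover have "B (G @ [g]) \<in> C" "B (F @ [g]) \<in> C" using F G g by (auto intro!: B_C)
  ultimately have "lie_bracket A (ham F) (ham G) p g = B (F @ [B (G @ [g])]) p - B (G @ [B (F @ [g])]) p"
    using g by (simp add: bracket_apply ham_apply)
  then show ?thesis
    unfolding defect_def 1 using G(1) by (subst sum.lessThan_Suc) (simp add: list_update_append nth_append)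
qed

definition fundamental_identity :: bool where
  "fundamental_identity \<longleftrightarrow> (\<forall>F G p. length F = n \<and> set F \<subseteq> C \<and> length G = Suc n \<and> set G \<subseteq> C \<longrightarrow>
    B (F @ [B G]) p = (\<Sum>i<Suc n. B (G[i := B (F @ [G ! i])]) p))"

lemma nambu_iff: "nambu_poisson A n \<pi> \<longleftrightarrow> fundamental_identity"
proof -
  have B': "(\<lambda>fs p. \<pi> p (map (\<lambda>f. D f p) fs)) = B" by (intro ext) (simp add: B_def)
  have "B ((\<lambda>x. f x * g x) # fs) p = f p * B (g # fs) p + g p * B (f # fs) p"
    if "f \<in> C" "g \<in> C" "length fs = n" for f g fs p
    using B_mult[of "f # fs" 0 f g p] that by simp
  then show ?thesis
    unfolding nambu_poisson_def B' nambu_bracket_def Let_def fundamental_identity_def fun_eq_iff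
    using B_C B_lin B_swap by (auto simp del: sum.lessThan_Suc)
qed

lemma fundamental_identity_iff_defect:
  "fundamental_identity \<longleftrightarrow> (\<forall>F G p. length F = n \<and> set F \<subseteq> C \<and> length G = n \<and> set G \<subseteq> C \<longrightarrow>
    defect (ham F) (dwedge F) (ham G) (dwedge G) p = (\<lambda>f. 0))" (is "_ \<longleftrightarrow> ?R")
proof
  assume FI: fundamental_identity
  show ?R
  proof (intro allI impI ext)
    fix F G p g assume a: "length F = n \<and> set F \<subseteq> C \<and> length G = n \<and> set G \<subseteq> C"
    show "defect (ham F) (dwedge F) (ham G) (dwedge G) p g = 0"
    proof (cases "g \<in> C")
      case True
      then show ?thesis
        using FI[unfolded fundamental_identity_def, rule_format, of F "G @ [g]" p] a
        by (simp add: defect_exact del: sum.lessThan_Suc)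
    next
      case False
      have "bracket_form (ham F) (dwedge F) (ham G) (dwedge G) p \<in> alt_forms n (T p)"
        using a by (intro form_alt bracket_form_form ham_VF dwedge_form) auto
      from T_outside[OF sharp_T[OF this] False] show ?thesis
        using False by (simp add: defect_def lie_bracket_def)
    qed
  qed
next
  assume R: ?R
  show fundamental_identity
    unfolding fundamental_identity_def
  proof (intro allI impI)
    fix F G p assume a: "length F = n \<and> set F \<subseteq> C \<and> length G = Suc n \<and> set G \<subseteq> C"
    then obtain G' g where G: "G = G' @ [g]" by (metis append_butlast_last_id length_0_conv nat.distinct(1))
    have "defect (ham F) (dwedge F) (ham G') (dwedge G') p g = 0" using R a G by simp
    then show "B (F @ [B G]) p = (\<Sum>i<Suc n. B (G[i := B (F @ [G ! i])]) p)"
      using a G by (simp add: defect_exact del: sum.lessThan_Suc)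
  qed
qed

end

context smooth_multivector
begin

section \<open>The quadratic identities\<close>

text \<open>The product of brackets after the \<open>i\<close>-th entry of \<open>F\<close> and the \<open>j\<close>-th entry of \<open>G\<close> have been exchanged. As a matrix in \<open>i\<close>
and \<open>j\<close> it is transposed when \<open>F\<close> and \<open>G\<close> change places.\<close>

definition exchange :: "('a \<Rightarrow> real) list \<Rightarrow> ('a \<Rightarrow> real) list \<Rightarrow> 'a \<Rightarrow> nat \<Rightarrow> nat \<Rightarrow> real" where
  "exchange F G p i j = B (F[i := G ! j]) p * B (G[j := F ! i]) p"

text \<open>The fundamental identity is a second-order condition on its first \<open>n\<close> arguments, whose symbol is quadratic in \<open>\<pi>\<close>: put
a product \<open>f u\<close> in the \<open>i\<close>-th argument and subtract \<open>f\<close> times the identity for \<open>u\<close> and \<open>u\<close> times the identity for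
\<open>f\<close>. What is left are the terms in which the Leibniz rule acts on the outer bracket, and these are the two row sums with
opposite signs.\<close>

lemma exchange_rows:
  assumes FI: fundamental_identity and H: "length H = Suc n" "set H \<subseteq> C" and G: "length G = Suc n" "set G \<subseteq> C"
    and i: "i < n"
  shows "(\<Sum>j<Suc n. exchange H G p i j) = (\<Sum>j<Suc n. exchange H G p n j)"
proof -
  obtain F u where HF: "H = F @ [u]" using H by (metis append_butlast_last_id length_0_conv nat.distinct(1))
  have F: "length F = n" "set F \<subseteq> C" "u \<in> C" using H HF by auto
  let ?f = "F ! i"
  have f: "?f \<in> C" using F i by auto
  let ?F1 = "F[i := u]" and ?Fm = "F[i := (\<lambda>x. ?f x * u x)]"
  have fu: "(\<lambda>x. ?f x * u x) \<in> C" by (rule C_mult[OF f F(3)])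
  have F1: "length ?F1 = n" "set ?F1 \<subseteq> C" and Fm: "length ?Fm = n" "set ?Fm \<subseteq> C"
    using F list_update_subset[OF F(2)] fu by auto
  define a where "a j = B (F @ [G ! j])" for j
  define b where "b j = B (?F1 @ [G ! j])" for j
  have Gj: "G ! j \<in> C" if "j < Suc n" for j using G that by auto
  have aC: "a j \<in> C" and bC: "b j \<in> C" if "j < Suc n" for j
    unfolding a_def b_def using F F1 Gj[OF that] by (auto intro!: B_C)
  have m: "B (?Fm @ [h]) q = ?f q * B (?F1 @ [h]) q + u q * B (F @ [h]) q" if "h \<in> C" for h q
    using B_mult[of "F @ [h]" i ?f u q] F i f by (simp add: list_update_append)
  have S: "B G \<in> C" by (rule B_C[OF G])
  have expand_term: "B (G[j := B (?Fm @ [G ! j])]) p =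
      ?f p * B (G[j := b j]) p + b j p * B (G[j := ?f]) p + (u p * B (G[j := a j]) p + a j p * B (G[j := u]) p)"
    if j: "j < Suc n" for j
  proof -
    have "B (?Fm @ [G ! j]) = (\<lambda>q. 1 * (?f q * b j q) + 1 * (u q * a j q))"
      by (rule ext) (simp add: m[OF Gj[OF j]] a_def b_def)
    then have "B (G[j := B (?Fm @ [G ! j])]) p =
        1 * B (G[j := (\<lambda>q. ?f q * b j q)]) p + 1 * B (G[j := (\<lambda>q. u q * a j q)]) p"
      by (simp only:) (rule B_lin[OF G(1) j C_mult[OF f bC[OF j]] C_mult[OF F(3) aC[OF j]]])
    then show ?thesis
      using B_mult[OF G(1) j f bC[OF j], of p] B_mult[OF G(1) j F(3) aC[OF j], of p] by simp
  qed
  have FI': "B (F' @ [B G]) p = (\<Sum>j<Suc n. B (G[j := B (F' @ [G ! j])]) p)" if "length F' = n" "set F' \<subseteq> C" for F'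
    using FI that G unfolding fundamental_identity_def by blast
  have "?f p * (\<Sum>j<Suc n. B (G[j := b j]) p) + u p * (\<Sum>j<Suc n. B (G[j := a j]) p) =
      ?f p * B (?F1 @ [B G]) p + u p * B (F @ [B G]) p"
    unfolding FI'[OF F1] FI'[OF F(1,2)] a_def b_def ..
  also have "\<dots> = (\<Sum>j<Suc n. B (G[j := B (?Fm @ [G ! j])]) p)"
    unfolding m[OF S, symmetric] by (rule FI'[OF Fm])
  also have "\<dots> = (\<Sum>j<Suc n. ?f p * B (G[j := b j]) p + b j p * B (G[j := ?f]) p
      + (u p * B (G[j := a j]) p + a j p * B (G[j := u]) p))"
    by (rule sum.cong[OF refl], rule expand_term) simp
  also have "\<dots> = ?f p * (\<Sum>j<Suc n. B (G[j := b j]) p) + u p * (\<Sum>j<Suc n. B (G[j := a j]) p)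
      + ((\<Sum>j<Suc n. b j p * B (G[j := ?f]) p) + (\<Sum>j<Suc n. a j p * B (G[j := u]) p))"
    by (simp only: sum.distrib sum_distrib_left ac_simps)
  finally have 0: "(\<Sum>j<Suc n. b j p * B (G[j := ?f]) p) + (\<Sum>j<Suc n. a j p * B (G[j := u]) p) = 0" by simp
  have "exchange H G p n j = a j p * B (G[j := u]) p" for j
    using F HF by (simp add: exchange_def a_def list_update_append nth_append)
  moreover have "exchange H G p i j = - (b j p * B (G[j := ?f]) p)" for j
  proof -
    have "B ((?F1 @ [G ! j])[i := (?F1 @ [G ! j]) ! n, n := (?F1 @ [G ! j]) ! i]) p = - B (?F1 @ [G ! j]) p"
      by (rule B_swap) (use F i in auto)
    then show ?thesis
      using F HF i by (simp add: exchange_def b_def list_update_append nth_append)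
  qed
  ultimately show ?thesis using 0 by (simp add: sum_negf del: sum.lessThan_Suc)
qed

text \<open>All rows have the same sum, so the sum of all entries is \<open>n + 1\<close> times the last row sum. It is also \<open>n + 1\<close> times the last
column sum, because the columns are the rows for the exchanged lists.\<close>

lemma exchange_row_col:
  assumes FI: fundamental_identity and H: "length H = Suc n" "set H \<subseteq> C" and G: "length G = Suc n" "set G \<subseteq> C"
  shows "(\<Sum>j<Suc n. exchange H G p n j) = (\<Sum>i<Suc n. exchange H G p i n)"
proof -
  have rows: "(\<Sum>j<Suc n. exchange P Q p i j) = (\<Sum>j<Suc n. exchange P Q p n j)"
    if "length P = Suc n" "set P \<subseteq> C" "length Q = Suc n" "set Q \<subseteq> C" "i < Suc n" for P Q i
    using exchange_rows[OF FI that(1-4), of i] that(5) by (cases "i = n") auto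
  have sym: "exchange H G p i j = exchange G H p j i" for i j by (simp add: exchange_def mult.commute)
  have total: "(\<Sum>i<Suc n. \<Sum>j<Suc n. exchange P Q p i j) = real (Suc n) * (\<Sum>j<Suc n. exchange P Q p n j)"
    if "length P = Suc n" "set P \<subseteq> C" "length Q = Suc n" "set Q \<subseteq> C" for P Q
  proof -
    have "(\<Sum>i<Suc n. \<Sum>j<Suc n. exchange P Q p i j) = (\<Sum>i<Suc n. \<Sum>j<Suc n. exchange P Q p n j)"
      by (rule sum.cong[OF refl], rule rows[OF that]) simp
    then show ?thesis by (simp only: sum_constant card_lessThan)
  qed
  have "real (Suc n) * (\<Sum>j<Suc n. exchange H G p n j) = (\<Sum>i<Suc n. \<Sum>j<Suc n. exchange H G p i j)"
    by (rule total[OF H G, symmetric])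
  also have "\<dots> = (\<Sum>j<Suc n. \<Sum>i<Suc n. exchange G H p j i)"
    unfolding sym by (rule sum.swap)
  also have "\<dots> = real (Suc n) * (\<Sum>i<Suc n. exchange G H p n i)" by (rule total[OF G H])
  finally show ?thesis unfolding sym[of _ n] by (simp del: sum.lessThan_Suc of_nat_Suc)
qed

text \<open>The last row sum and the last column sum share their corner entry. The rest is the identity in the form in which it enters
the bracket of sections.\<close>

lemma exchange_cross:
  assumes FI: fundamental_identity and F: "length F = n" "set F \<subseteq> C" and G: "length G = n" "set G \<subseteq> C"
    and u: "u \<in> C" and f: "f \<in> C"
  shows "(\<Sum>j<n. B (F @ [G ! j]) p * B (G[j := u] @ [f]) p) + (\<Sum>i<n. B (G @ [F ! i]) p * B (F[i := u] @ [f]) p) = 0"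
proof -
  let ?H = "F @ [u]" and ?G = "G @ [f]"
  have "(\<Sum>j<Suc n. exchange ?H ?G p n j) = (\<Sum>i<Suc n. exchange ?H ?G p i n)"
    by (rule exchange_row_col[OF FI]) (use F G u f in auto)
  then have "(\<Sum>j<n. exchange ?H ?G p n j) = (\<Sum>i<n. exchange ?H ?G p i n)"
    by (simp only: sum.lessThan_Suc[of _ n] add_right_cancel)
  also have "(\<Sum>j<n. exchange ?H ?G p n j) = (\<Sum>j<n. B (F @ [G ! j]) p * B (G[j := u] @ [f]) p)"
    by (rule sum.cong[OF refl]) (use F G in \<open>simp add: exchange_def list_update_append nth_append\<close>)
  also have "(\<Sum>i<n. exchange ?H ?G p i n) = (\<Sum>i<n. - (B (G @ [F ! i]) p * B (F[i := u] @ [f]) p))"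
  proof (rule sum.cong[OF refl])
    fix i assume i: "i \<in> {..<n}"
    have "B ((F[i := u] @ [f])[i := (F[i := u] @ [f]) ! n, n := (F[i := u] @ [f]) ! i]) p = - B (F[i := u] @ [f]) p"
      by (rule B_swap) (use F i in auto)
    then show "exchange ?H ?G p i n = - (B (G @ [F ! i]) p * B (F[i := u] @ [f]) p)"
      using F G i by (simp add: exchange_def list_update_append nth_append)
  qed
  finally show ?thesis by (simp add: sum_negf del: sum.lessThan_Suc)
qed

text \<open>The form \<open>du \<and> i\<^sub>w \<alpha>\<close> at \<open>p\<close>, with \<open>w\<close> put back in the slot from which \<open>du\<close> takes its argument, so that no signs
occur.\<close>

definition ins :: "'a \<Rightarrow> ('a \<Rightarrow> real) \<Rightarrow> 'a tangent \<Rightarrow> 'a form \<Rightarrow> 'a form" where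
  "ins p u w \<alpha> = (\<lambda>vs. if length vs = n \<and> set vs \<subseteq> T p then \<Sum>i<n. (vs ! i) u * \<alpha> (vs[i := w]) else 0)"

lemma ins_dwedge:
  assumes F: "length F = n" and w: "w \<in> T p"
  shows "ins p u w (dwedge F p) = (\<lambda>vs. \<Sum>j<n. w (F ! j) * dwedge (F[j := u]) p vs)"
proof
  fix vs show "ins p u w (dwedge F p) vs = (\<Sum>j<n. w (F ! j) * dwedge (F[j := u]) p vs)"
  proof (cases "length vs = n \<and> set vs \<subseteq> T p")
    case True
    have "(\<Sum>i<n. D u p (vs ! i) * dwedge F p (vs[i := w])) = (\<Sum>j<n. w (F ! j) * dwedge (F[j := u]) p vs)"
      using wedge_rank_one[of vs "map (\<lambda>f. D f p) F" "T p" w "D u p"] True F w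
      by (simp add: dwedge_def map_update D_apply del: sum.lessThan_Suc)
    moreover have "D u p (vs ! i) = (vs ! i) u" if "i < n" for i
      using map_VF_D[of vs p i u] True that by auto
    ultimately show ?thesis using True by (simp add: ins_def del: sum.lessThan_Suc)
  next
    case False
    have "dwedge (F[j := u]) p vs = 0" for j
      by (rule alt_forms_outside[OF dwedge_alt False]) (use F in simp)
    then show ?thesis by (simp only: ins_def if_not_P[OF False]) simp
  qed
qed

lemma ins_lin: "ins p u w (\<lambda>vs. a * \<alpha> vs + b * \<beta> vs) = (\<lambda>vs. a * ins p u w \<alpha> vs + b * ins p u w \<beta> vs)"
  by (rule ext) (simp add: ins_def sum_distrib_left sum.distrib algebra_simps del: sum.lessThan_Suc)

lemma ins_lin_vector:
  assumes \<alpha>: "\<alpha> \<in> alt_forms n (T p)" and w: "w \<in> T p" "w' \<in> T p"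
  shows "ins p u (\<lambda>f. a * w f + b * w' f) \<alpha> = (\<lambda>vs. a * ins p u w \<alpha> vs + b * ins p u w' \<alpha> vs)"
proof
  fix vs
  have "\<alpha> (vs[i := (\<lambda>f. a * w f + b * w' f)]) = a * \<alpha> (vs[i := w]) + b * \<alpha> (vs[i := w'])"
    if "length vs = n" "set vs \<subseteq> T p" "i < n" for i
    by (rule alt_forms_lin[OF \<alpha> that w])
  then show "ins p u (\<lambda>f. a * w f + b * w' f) \<alpha> vs = a * ins p u w \<alpha> vs + b * ins p u w' \<alpha> vs"
    by (simp add: ins_def sum_distrib_left sum.distrib[symmetric] algebra_simps del: sum.lessThan_Suc)
qed

lemma ins_alt:
  assumes "\<alpha> \<in> alt_forms n (T p)" and w: "w \<in> T p"
  shows "ins p u w \<alpha> \<in> alt_forms n (T p)"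
  using assms(1)
proof (induction rule: form_induct)
  case (wedge fs)
  show ?case unfolding ins_dwedge[OF wedge(1) w] by (rule alt_forms_sum) (use wedge in \<open>auto intro!: dwedge_alt\<close>)
next
  case (lincomb \<omega> \<eta> a b)
  then show ?case unfolding ins_lin by (intro alt_forms_lincomb)
qed

text \<open>In invariant terms, \<open>\<pi>\<^sup>\<sharp> (du \<and> (i\<^sub>X \<beta> + i\<^sub>Y \<alpha>)) = 0\<close> for \<open>X = \<pi>\<^sup>\<sharp> \<alpha>\<close> and \<open>Y = \<pi>\<^sup>\<sharp> \<beta>\<close>. The expression is bilinear in
\<open>\<alpha>\<close> and \<open>\<beta>\<close>, and for decomposable \<open>\<alpha>\<close> and \<open>\<beta>\<close> it vanishes by the preceding identity.\<close>

lemma sharp_ins_cross: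
  assumes FI: fundamental_identity and u: "u \<in> C"
    and \<alpha>: "\<alpha> \<in> alt_forms n (T p)" and \<beta>: "\<beta> \<in> alt_forms n (T p)"
  shows "sh p (ins p u (sh p \<alpha>) \<beta>) f + sh p (ins p u (sh p \<beta>) \<alpha>) f = 0"
proof (cases "f \<in> C")
  case False
  then show ?thesis
    using T_outside[OF sharp_T[OF ins_alt[OF \<beta> sharp_T[OF \<alpha>]]] False] T_outside[OF sharp_T[OF ins_alt[OF \<alpha> sharp_T[OF \<beta>]]] False]
    by simp
next
  case f: True
  let ?Q = "\<lambda>\<alpha> \<beta>. sh p (ins p u (sh p \<alpha>) \<beta>) f + sh p (ins p u (sh p \<beta>) \<alpha>) f"
  have lin: "?Q (\<lambda>vs. a * \<omega> vs + b * \<eta> vs) \<beta> = a * ?Q \<omega> \<beta> + b * ?Q \<eta> \<beta>"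
    if "\<omega> \<in> alt_forms n (T p)" "\<eta> \<in> alt_forms n (T p)" "\<beta> \<in> alt_forms n (T p)" for \<omega> \<eta> \<beta> a b
  proof -
    note t = sharp_T[OF that(1)] sharp_T[OF that(2)] sharp_T[OF that(3)]
    have "sh p (ins p u (sh p (\<lambda>vs. a * \<omega> vs + b * \<eta> vs)) \<beta>) f =
        a * sh p (ins p u (sh p \<omega>) \<beta>) f + b * sh p (ins p u (sh p \<eta>) \<beta>) f"
      by (simp only: sharp_lin[OF that(1,2)] ins_lin_vector[OF that(3) t(1,2)]
          sharp_lin[OF ins_alt[OF that(3) t(1)] ins_alt[OF that(3) t(2)]])
    moreover have "sh p (ins p u (sh p \<beta>) (\<lambda>vs. a * \<omega> vs + b * \<eta> vs)) f =
        a * sh p (ins p u (sh p \<beta>) \<omega>) f + b * sh p (ins p u (sh p \<beta>) \<eta>) f"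
      by (simp only: ins_lin sharp_lin[OF ins_alt[OF that(1) t(3)] ins_alt[OF that(2) t(3)]])
    ultimately show ?thesis by (simp only:) (simp add: algebra_simps)
  qed
  have sym: "?Q \<alpha> \<beta> = ?Q \<beta> \<alpha>" for \<alpha> \<beta> by (rule add.commute)
  have ex: "?Q (dwedge F p) (dwedge G p) = 0" if F: "length F = n" "set F \<subseteq> C" and G: "length G = n" "set G \<subseteq> C" for F G
  proof -
    have *: "sh p (ins p u (sh p (dwedge F p)) (dwedge G p)) f = (\<Sum>j<n. B (F @ [G ! j]) p * B (G[j := u] @ [f]) p)"
      if F: "length F = n" "set F \<subseteq> C" and G: "length G = n" "set G \<subseteq> C" for F G
    proof -
      have "sh p (ins p u (sh p (dwedge F p)) (dwedge G p)) = sh p (\<lambda>vs. \<Sum>j<n. ham F p (G ! j) * dwedge (G[j := u]) p vs)"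
        by (simp only: sharp_dwedge[OF F(1)] ins_dwedge[OF G(1) VF_T[OF ham_VF[OF F]]])
      also have "\<dots> = (\<lambda>f. \<Sum>j<n. ham F p (G ! j) * sh p (dwedge (G[j := u]) p) f)"
        by (rule sharp_sum) (use G in \<open>auto intro!: dwedge_alt\<close>)
      finally have "sh p (ins p u (sh p (dwedge F p)) (dwedge G p)) f =
          (\<Sum>j<n. ham F p (G ! j) * sh p (dwedge (G[j := u]) p) f)" by simp
      also have "\<dots> = (\<Sum>j<n. B (F @ [G ! j]) p * B (G[j := u] @ [f]) p)"
      proof (rule sum.cong[OF refl])
        fix j assume "j \<in> {..<n}"
        then have "G ! j \<in> C" using G by auto
        then show "ham F p (G ! j) * sh p (dwedge (G[j := u]) p) f = B (F @ [G ! j]) p * B (G[j := u] @ [f]) p"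
          using f G by (simp add: ham_apply sharp_dwedge)
      qed
      finally show ?thesis .
    qed
    show ?thesis unfolding *[OF F G] *[OF G F] by (rule exchange_cross[OF FI F G u f])
  qed
  have left: "?Q \<alpha> (dwedge G p) = 0" if G: "length G = n" "set G \<subseteq> C" for G
    using \<alpha>
  proof (induction rule: form_induct)
    case (wedge F)
    then show ?case by (rule ex[OF _ _ G])
  next
    case (lincomb \<omega> \<eta> a b)
    then show ?case by (simp only: lin[OF lincomb(1,2) dwedge_alt[OF G(1)]])
  qed
  show "?Q \<alpha> \<beta> = 0"
    using \<beta>
  proof (induction rule: form_induct)
    case (wedge G)
    then show ?case by (rule left)
  next
    case (lincomb \<omega> \<eta> a b)
    have "?Q (\<lambda>vs. a * \<omega> vs + b * \<eta> vs) \<alpha> = 0"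
      unfolding lin[OF lincomb(1,2) \<alpha>] using lincomb(3,4) by (simp add: sym[of _ \<alpha>])
    then show ?case by (simp only: sym[of \<alpha>])
  qed
qed

section \<open>Tensoriality of the defect\<close>

text \<open>Since \<open>d\<alpha>\<close> is a form, \<open>i\<^sub>Y d\<alpha>\<close> is linear over the functions in \<open>Y\<close>.\<close>

lemma ext_values_field:
  assumes \<alpha>: "\<alpha> \<in> diff_forms A n" and Z: "length Zs = n" "set Zs \<subseteq> VF" and Y: "Y \<in> VF"
  shows "ext_values n \<alpha> (Y # Zs) p = exterior_derivative A n \<alpha> p (Y p # map (\<lambda>X. X p) Zs)"
  using fun_cong[OF exterior_derivative_form(2)[OF \<alpha>, of "Y # Zs"], of p] Y Z by (simp add: eval_form_def)

lemma ext_values_scale_field: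
  assumes \<alpha>: "\<alpha> \<in> diff_forms A n" and Z: "length Zs = n" "set Zs \<subseteq> VF" and Y: "Y \<in> VF" and u: "u \<in> C"
  shows "ext_values n \<alpha> ((\<lambda>p f. u p * Y p f) # Zs) p = u p * ext_values n \<alpha> (Y # Zs) p"
  using alt_forms_lin[OF form_alt[OF exterior_derivative_form(1)[OF \<alpha>], of p],
      of "Y p # map (\<lambda>X. X p) Zs" 0 "Y p" "Y p" "u p" 0] VF_T[OF Y] set_map_VF[OF Z(2)] Z(1)
  by (simp add: ext_values_field[OF \<alpha> Z Y] ext_values_field[OF \<alpha> Z VF_scale[OF Y u]])

lemma ext_values_sum_field:
  assumes \<alpha>: "\<alpha> \<in> diff_forms A n" and Z: "length Zs = n" "set Zs \<subseteq> VF" and I: "finite I" "\<And>i. i \<in> I \<Longrightarrow> Y i \<in> VF"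
  shows "ext_values n \<alpha> ((\<lambda>p f. \<Sum>i\<in>I. Y i p f) # Zs) p = (\<Sum>i\<in>I. ext_values n \<alpha> (Y i # Zs) p)"
proof -
  let ?vs = "map (\<lambda>X. X p) Zs"
  have Y: "(\<lambda>p f. \<Sum>i\<in>I. Y i p f) \<in> VF" using VF_sum[OF I(1), of "\<lambda>i q. 1" Y] C_const I(2) by simp
  have "exterior_derivative A n \<alpha> p (((\<lambda>f. 0) # ?vs)[0 := (\<lambda>f. \<Sum>i\<in>I. 1 * Y i p f)]) =
      (\<Sum>i\<in>I. 1 * exterior_derivative A n \<alpha> p (((\<lambda>f. 0) # ?vs)[0 := Y i p]))"
    by (rule alt_forms_sum_arg[OF linear_space_T form_alt[OF exterior_derivative_form(1)[OF \<alpha>]] _ _ _ I(1) VF_T[OF I(2)]])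
      (use Z set_map_VF[OF Z(2)] T_zero in auto)
  then show ?thesis by (simp add: ext_values_field[OF \<alpha> Z Y] ext_values_field[OF \<alpha> Z I(2)])
qed

lemma ins_values:
  assumes Z: "length Zs = n" "set Zs \<subseteq> VF"
  shows "ins p u (Y p) (\<alpha> p) (map (\<lambda>X. X p) Zs) = (\<Sum>i<n. (Zs ! i) p u * eval_form \<alpha> (Zs[i := Y]) p)"
  using Z set_map_VF[OF Z(2), of p] by (simp add: ins_def eval_form_def map_update del: sum.lessThan_Suc)

lemma ext_values_scale_form:
  assumes \<alpha>: "\<alpha> \<in> diff_forms A n" and Y: "Y \<in> VF" and u: "u \<in> C" and Z: "length Zs = n" "set Zs \<subseteq> VF"
  shows "ext_values n (\<lambda>p vs. u p * \<alpha> p vs) (Y # Zs) p =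
    u p * ext_values n \<alpha> (Y # Zs) p + Y p u * eval_form \<alpha> Zs p - ins p u (Y p) (\<alpha> p) (map (\<lambda>X. X p) Zs)"
proof -
  have "(-1) ^ i * eval_form \<alpha> (Y # omit i Zs) p = eval_form \<alpha> (Zs[i := Y]) p" if "i < n" for i
    using alt_forms_move[OF linear_space_T form_alt[OF \<alpha>, of p] _ set_map_VF[OF Z(2)] VF_T[OF Y] that] Z
    by (simp add: eval_form_def map_omit map_update flip: mult.assoc power_add)
  then have "(\<Sum>i\<le>m. (-1) ^ i * (Zs ! i) p u * eval_form \<alpha> (Y # omit i Zs) p) =
      (\<Sum>i<n. (Zs ! i) p u * eval_form \<alpha> (Zs[i := Y]) p)"
    unfolding lessThan_Suc_atMost by (intro sum.cong refl) (simp add: mult.commute mult.left_commute)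
  then have "(\<Sum>i\<le>n. (-1) ^ i * ((Y # Zs) ! i) p u * eval_form \<alpha> (omit i (Y # Zs)) p) =
      Y p u * eval_form \<alpha> Zs p - ins p u (Y p) (\<alpha> p) (map (\<lambda>X. X p) Zs)"
    unfolding ins_values[OF Z] by (subst sum.atMost_Suc_shift) (simp add: sum_negf del: sum.lessThan_Suc)
  moreover have "length (Y # Zs) = Suc n" "set (Y # Zs) \<subseteq> VF" using Y Z by auto
  ultimately show ?thesis using ext_values_scale[OF \<alpha> u, of "Y # Zs" p] by simp
qed

lemma bracket_form_scale_right:
  assumes XY: "X \<in> VF" "Y \<in> VF" and ab: "\<alpha> \<in> diff_forms A n" "\<beta> \<in> diff_forms A n" and u: "u \<in> C"
  shows "bracket_form X \<alpha> (\<lambda>p f. u p * Y p f) (\<lambda>p vs. u p * \<beta> p vs) p =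
    (\<lambda>vs. u p * bracket_form X \<alpha> Y \<beta> p vs + X p u * \<beta> p vs)" (is "?L = ?R")
proof (rule form_eqI)
  note uY = VF_scale[OF XY(2) u] and ub = form_scale[OF ab(2) u]
  show "?L \<in> alt_forms n (T p)" by (rule form_alt[OF bracket_form_form[OF XY(1) uY ab(1) ub]])
  show "?R \<in> alt_forms n (T p)"
    by (intro alt_forms_lincomb form_alt[OF bracket_form_form[OF XY ab]] form_alt[OF ab(2)])
  fix Zs assume Z: "length Zs = n" "set Zs \<subseteq> VF"
  show "?L (map (\<lambda>X. X p) Zs) = ?R (map (\<lambda>X. X p) Zs)"
    unfolding bracket_form_values[OF XY(1) uY ab(1) ub Z] bracket_form_values[OF XY ab Z]
      lie_values_scale[OF XY(1) ab(2) u Z] ext_values_scale_field[OF ab(1) Z XY(2) u]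
    by (simp add: eval_form_def algebra_simps)
qed

text \<open>In contrast to the second argument, scaling the first one produces the two terms with \<open>ins\<close>, that is
\<open>du \<and> (i\<^sub>X \<beta> + i\<^sub>Y \<alpha>)\<close>. They are the reason why tensoriality of the obstruction in the first argument needs the
fundamental identity.\<close>

lemma bracket_form_scale_left:
  assumes XY: "X \<in> VF" "Y \<in> VF" and ab: "\<alpha> \<in> diff_forms A n" "\<beta> \<in> diff_forms A n" and u: "u \<in> C"
  shows "bracket_form (\<lambda>p f. u p * X p f) (\<lambda>p vs. u p * \<alpha> p vs) Y \<beta> p =
    (\<lambda>vs. 1 * (u p * bracket_form X \<alpha> Y \<beta> p vs + (- Y p u) * \<alpha> p vs)
      + 1 * (1 * ins p u (X p) (\<beta> p) vs + 1 * ins p u (Y p) (\<alpha> p) vs))" (is "?L = ?R")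
proof (rule form_eqI)
  note uX = VF_scale[OF XY(1) u] and ua = form_scale[OF ab(1) u]
  show "?L \<in> alt_forms n (T p)" by (rule form_alt[OF bracket_form_form[OF uX XY(2) ua ab(2)]])
  show "?R \<in> alt_forms n (T p)"
    by (intro alt_forms_lincomb ins_alt form_alt[OF bracket_form_form[OF XY ab]] form_alt[OF ab(1)] form_alt[OF ab(2)]
        VF_T[OF XY(1)] VF_T[OF XY(2)])
  fix Zs assume Z: "length Zs = n" "set Zs \<subseteq> VF"
  show "?L (map (\<lambda>X. X p) Zs) = ?R (map (\<lambda>X. X p) Zs)"
    unfolding bracket_form_values[OF uX XY(2) ua ab(2) Z] bracket_form_values[OF XY ab Z]
      lie_values_scale_field[OF XY(1) ab(2) u Z] ext_values_scale_form[OF ab(1) XY(2) u Z] ins_values[OF Z]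
    by (simp add: eval_form_def algebra_simps del: sum.lessThan_Suc)
qed

lemma defect_scale_right:
  assumes s: "sec X \<alpha>" and t: "sec Y \<beta>" and u: "u \<in> C"
  shows "defect X \<alpha> (\<lambda>p f. u p * Y p f) (\<lambda>p vs. u p * \<beta> p vs) p = (\<lambda>f. u p * defect X \<alpha> Y \<beta> p f)"
proof -
  note X = secD(1,2)[OF s] and Y = secD(1,2)[OF t]
  have "sh p (\<lambda>vs. u p * bracket_form X \<alpha> Y \<beta> p vs + X p u * \<beta> p vs) =
      (\<lambda>f. u p * sh p (bracket_form X \<alpha> Y \<beta> p) f + X p u * sh p (\<beta> p) f)"
    by (rule sharp_lin[OF form_alt[OF bracket_form_form[OF X(1) Y(1) X(2) Y(2)]] form_alt[OF Y(2)]])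
  then show ?thesis
    unfolding defect_def bracket_form_scale_right[OF X(1) Y(1) X(2) Y(2) u] bracket_scale_right[OF X(1) Y(1) u]
    by (simp add: secD(3)[OF t, symmetric] algebra_simps)
qed

lemma defect_scale_left:
  assumes FI: fundamental_identity and s: "sec X \<alpha>" and t: "sec Y \<beta>" and u: "u \<in> C"
  shows "defect (\<lambda>p f. u p * X p f) (\<lambda>p vs. u p * \<alpha> p vs) Y \<beta> p = (\<lambda>f. u p * defect X \<alpha> Y \<beta> p f)"
proof -
  note X = secD(1,2)[OF s] and Y = secD(1,2)[OF t]
  note b = form_alt[OF bracket_form_form[OF X(1) Y(1) X(2) Y(2)], of p]
  note i1 = ins_alt[OF form_alt[OF Y(2)] VF_T[OF X(1)], of p u] and i2 = ins_alt[OF form_alt[OF X(2)] VF_T[OF Y(1)], of p u]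
  have "sh p (\<lambda>vs. 1 * (u p * bracket_form X \<alpha> Y \<beta> p vs + (- Y p u) * \<alpha> p vs)
      + 1 * (1 * ins p u (X p) (\<beta> p) vs + 1 * ins p u (Y p) (\<alpha> p) vs)) =
      (\<lambda>f. 1 * (u p * sh p (bracket_form X \<alpha> Y \<beta> p) f + (- Y p u) * sh p (\<alpha> p) f)
      + 1 * (1 * sh p (ins p u (X p) (\<beta> p)) f + 1 * sh p (ins p u (Y p) (\<alpha> p)) f))"
    by (simp only: sharp_lin alt_forms_lincomb b i1 i2 form_alt[OF X(2)])
  moreover have "sh p (ins p u (X p) (\<beta> p)) f + sh p (ins p u (Y p) (\<alpha> p)) f = 0" for f
    using sharp_ins_cross[OF FI u form_alt[OF X(2)] form_alt[OF Y(2)], of p f]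
    by (simp only: secD(3)[OF s, symmetric] secD(3)[OF t, symmetric])
  ultimately show ?thesis
    unfolding defect_def bracket_form_scale_left[OF X(1) Y(1) X(2) Y(2) u] bracket_scale_left[OF X(1) Y(1) u]
    by (simp add: secD(3)[OF s, symmetric] algebra_simps)
qed

lemma sec_sum:
  assumes I: "finite I" and s: "\<And>i. i \<in> I \<Longrightarrow> sec (X i) (\<alpha> i)"
  shows "sec (\<lambda>p f. \<Sum>i\<in>I. X i p f) (\<lambda>p vs. \<Sum>i\<in>I. \<alpha> i p vs)"
  unfolding sec_def
proof (intro conjI allI)
  show "(\<lambda>p f. \<Sum>i\<in>I. X i p f) \<in> VF"
    using VF_sum[OF I, of "\<lambda>i q. 1" X] C_const secD(1)[OF s] by simp
  show "(\<lambda>p vs. \<Sum>i\<in>I. \<alpha> i p vs) \<in> diff_forms A n"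
    using form_sum[OF I, of "\<lambda>i q. 1" \<alpha> n] C_const secD(2)[OF s] by simp
  show "(\<lambda>f. \<Sum>i\<in>I. X i p f) = sh p (\<lambda>vs. \<Sum>i\<in>I. \<alpha> i p vs)" for p
    using sharp_sum[OF I, of "\<lambda>i. \<alpha> i p" p "\<lambda>_. 1"] form_alt[OF secD(2)[OF s]] secD(3)[OF s, of _ p] by simp
qed

lemma defect_sum_right:
  assumes s: "sec X \<alpha>" and I: "finite I" and t: "\<And>i. i \<in> I \<Longrightarrow> sec (Y i) (\<beta> i)"
  shows "defect X \<alpha> (\<lambda>p f. \<Sum>i\<in>I. Y i p f) (\<lambda>p vs. \<Sum>i\<in>I. \<beta> i p vs) p = (\<lambda>f. \<Sum>i\<in>I. defect X \<alpha> (Y i) (\<beta> i) p f)"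
    (is "defect X \<alpha> ?Y ?\<beta> p = _")
proof -
  note X = secD(1,2)[OF s] and Y = secD(1,2)[OF t] and S = secD(1,2)[OF sec_sum[OF I t]]
  have bi: "bracket_form X \<alpha> (Y i) (\<beta> i) p \<in> alt_forms n (T p)" if "i \<in> I" for i
    by (rule form_alt[OF bracket_form_form[OF X(1) Y(1)[OF that] X(2) Y(2)[OF that]]])
  have "bracket_form X \<alpha> ?Y ?\<beta> p = (\<lambda>vs. \<Sum>i\<in>I. 1 * bracket_form X \<alpha> (Y i) (\<beta> i) p vs)"
  proof (rule form_eqI[OF form_alt[OF bracket_form_form[OF X(1) S(1) X(2) S(2)]] alt_forms_sum[OF I bi]])
    fix Zs assume Z: "length Zs = n" "set Zs \<subseteq> VF"
    have "bracket_form X \<alpha> ?Y ?\<beta> p (map (\<lambda>X. X p) Zs) = lie_values n X ?\<beta> Zs p - ext_values n \<alpha> (?Y # Zs) p"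
      by (rule bracket_form_values[OF X(1) S(1) X(2) S(2) Z])
    also have "lie_values n X ?\<beta> Zs p = (\<Sum>i\<in>I. lie_values n X (\<beta> i) Zs p)"
      by (rule lie_values_sum[OF X(1) I Y(2) Z])
    also have "ext_values n \<alpha> (?Y # Zs) p = (\<Sum>i\<in>I. ext_values n \<alpha> (Y i # Zs) p)"
      by (rule ext_values_sum_field[OF X(2) Z I Y(1)])
    finally show "bracket_form X \<alpha> ?Y ?\<beta> p (map (\<lambda>X. X p) Zs) =
        (\<Sum>i\<in>I. 1 * bracket_form X \<alpha> (Y i) (\<beta> i) p (map (\<lambda>X. X p) Zs))"
      by (simp add: sum_subtractf bracket_form_values[OF X(1) Y(1) X(2) Y(2) Z])
  qed
  moreover have "sh p (\<lambda>vs. \<Sum>i\<in>I. 1 * bracket_form X \<alpha> (Y i) (\<beta> i) p vs) =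
      (\<lambda>f. \<Sum>i\<in>I. 1 * sh p (bracket_form X \<alpha> (Y i) (\<beta> i) p) f)"
    by (rule sharp_sum[OF I bi])
  moreover have "lie_bracket A X ?Y p = (\<lambda>f. \<Sum>i\<in>I. lie_bracket A X (Y i) p f)"
    by (rule bracket_sum_right[OF X(1) I Y(1)])
  ultimately show ?thesis by (simp only: defect_def mult_1 sum_subtractf)
qed

lemma defect_sum_left:
  assumes t: "sec Y \<beta>" and I: "finite I" and s: "\<And>i. i \<in> I \<Longrightarrow> sec (X i) (\<alpha> i)"
  shows "defect (\<lambda>p f. \<Sum>i\<in>I. X i p f) (\<lambda>p vs. \<Sum>i\<in>I. \<alpha> i p vs) Y \<beta> p = (\<lambda>f. \<Sum>i\<in>I. defect (X i) (\<alpha> i) Y \<beta> p f)"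
    (is "defect ?X ?\<alpha> Y \<beta> p = _")
proof -
  note Y = secD(1,2)[OF t] and X = secD(1,2)[OF s] and S = secD(1,2)[OF sec_sum[OF I s]]
  have bi: "bracket_form (X i) (\<alpha> i) Y \<beta> p \<in> alt_forms n (T p)" if "i \<in> I" for i
    by (rule form_alt[OF bracket_form_form[OF X(1)[OF that] Y(1) X(2)[OF that] Y(2)]])
  have "bracket_form ?X ?\<alpha> Y \<beta> p = (\<lambda>vs. \<Sum>i\<in>I. 1 * bracket_form (X i) (\<alpha> i) Y \<beta> p vs)"
  proof (rule form_eqI[OF form_alt[OF bracket_form_form[OF S(1) Y(1) S(2) Y(2)]] alt_forms_sum[OF I bi]])
    fix Zs assume Z: "length Zs = n" "set Zs \<subseteq> VF"
    have "bracket_form ?X ?\<alpha> Y \<beta> p (map (\<lambda>X. X p) Zs) = lie_values n ?X \<beta> Zs p - ext_values n ?\<alpha> (Y # Zs) p"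
      by (rule bracket_form_values[OF S(1) Y(1) S(2) Y(2) Z])
    also have "lie_values n ?X \<beta> Zs p = (\<Sum>i\<in>I. lie_values n (X i) \<beta> Zs p)"
      by (rule lie_values_sum_field[OF I X(1) Y(2) Z])
    also have "ext_values n ?\<alpha> (Y # Zs) p = (\<Sum>i\<in>I. ext_values n (\<alpha> i) (Y # Zs) p)"
      by (rule ext_values_sum[OF I X(2)]) (use Y Z in auto)
    finally show "bracket_form ?X ?\<alpha> Y \<beta> p (map (\<lambda>X. X p) Zs) =
        (\<Sum>i\<in>I. 1 * bracket_form (X i) (\<alpha> i) Y \<beta> p (map (\<lambda>X. X p) Zs))"
      by (simp add: sum_subtractf bracket_form_values[OF X(1) Y(1) X(2) Y(2) Z])
  qed
  moreover have "sh p (\<lambda>vs. \<Sum>i\<in>I. 1 * bracket_form (X i) (\<alpha> i) Y \<beta> p vs) =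
      (\<lambda>f. \<Sum>i\<in>I. 1 * sh p (bracket_form (X i) (\<alpha> i) Y \<beta> p) f)"
    by (rule sharp_sum[OF I bi])
  moreover have "lie_bracket A ?X Y p = (\<lambda>f. \<Sum>i\<in>I. lie_bracket A (X i) Y p f)"
    by (rule bracket_sum_left[OF Y(1) I X(1)])
  ultimately show ?thesis by (simp only: defect_def mult_1 sum_subtractf)
qed

lemma sec_decomposition:
  assumes s: "sec X \<alpha>"
  obtains S :: "nat list set" and F a H where "finite S" "H \<in> C" "H p = 1"
    "\<And>I. I \<in> S \<Longrightarrow> a I \<in> C" "\<And>I. I \<in> S \<Longrightarrow> length (F I) = n" "\<And>I. I \<in> S \<Longrightarrow> set (F I) \<subseteq> C"
    "(\<lambda>q vs. H q * \<alpha> q vs) = (\<lambda>q vs. \<Sum>I\<in>S. a I q * dwedge (F I) q vs)"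
    "(\<lambda>q f. H q * X q f) = (\<lambda>q f. \<Sum>I\<in>S. a I q * ham (F I) q f)"
proof (rule local_decomposition[OF secD(2)[OF s], of p])
  fix S :: "nat list set" and F a H
  assume S: "finite S" and H: "H \<in> C" "H p = 1"
    and a: "\<And>I. I \<in> S \<Longrightarrow> a I \<in> C" and F: "\<And>I. I \<in> S \<Longrightarrow> length (F I) = n" "\<And>I. I \<in> S \<Longrightarrow> set (F I) \<subseteq> C"
    and dec: "(\<lambda>q vs. H q * \<alpha> q vs) = (\<lambda>q vs. \<Sum>I\<in>S. a I q * dwedge (F I) q vs)"
  have "(\<lambda>f. H q * X q f) = (\<lambda>f. \<Sum>I\<in>S. a I q * ham (F I) q f)" for q
  proof -
    have "(\<lambda>f. H q * X q f) = sh q (\<lambda>vs. H q * \<alpha> q vs)"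
      using sharp_scale[OF form_alt[OF secD(2)[OF s]], of q "H q"] by (simp add: secD(3)[OF s, symmetric])
    also have "\<dots> = sh q (\<lambda>vs. \<Sum>I\<in>S. a I q * dwedge (F I) q vs)"
      by (rule arg_cong[where f = "sh q"]) (rule fun_cong[OF dec, of q])
    also have "\<dots> = (\<lambda>f. \<Sum>I\<in>S. a I q * sh q (dwedge (F I) q) f)"
      by (rule sharp_sum[OF S]) (use F in \<open>auto intro!: dwedge_alt\<close>)
    finally show ?thesis using F by (simp add: sharp_dwedge)
  qed
  then have "(\<lambda>q f. H q * X q f) = (\<lambda>q f. \<Sum>I\<in>S. a I q * ham (F I) q f)" by (rule ext)
  with S H a F dec show thesis by (rule that)
qed

text \<open>By tensoriality in both arguments the obstruction at \<open>p\<close> is a combination of obstructions for exact forms.\<close>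

lemma defect_zero:
  assumes FI: fundamental_identity and s: "sec X \<alpha>" and t: "sec Y \<beta>"
  shows "defect X \<alpha> Y \<beta> p = (\<lambda>f. 0)"
proof -
  have exact: "defect (ham F) (dwedge F) (ham G) (dwedge G) p = (\<lambda>f. 0)"
    if "length F = n" "set F \<subseteq> C" "length G = n" "set G \<subseteq> C" for F G
    using FI that unfolding fundamental_identity_iff_defect by blast
  have right_exact: "defect X \<alpha> (ham G) (dwedge G) p = (\<lambda>f. 0)" if G: "length G = n" "set G \<subseteq> C" for G
  proof -
    note tG = sec_ham[OF G]
    obtain S :: "nat list set" and F a H where S: "finite S" and H: "H \<in> C" "H p = 1"
      and a: "\<And>I. I \<in> S \<Longrightarrow> a I \<in> C" and F: "\<And>I. I \<in> S \<Longrightarrow> length (F I) = n" "\<And>I. I \<in> S \<Longrightarrow> set (F I) \<subseteq> C"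
      and dec: "(\<lambda>q vs. H q * \<alpha> q vs) = (\<lambda>q vs. \<Sum>I\<in>S. a I q * dwedge (F I) q vs)"
        "(\<lambda>q f. H q * X q f) = (\<lambda>q f. \<Sum>I\<in>S. a I q * ham (F I) q f)"
      by (rule sec_decomposition[OF s, of p]) (rule that)
    have "defect X \<alpha> (ham G) (dwedge G) p = (\<lambda>f. H p * defect X \<alpha> (ham G) (dwedge G) p f)" using H by simp
    also have "\<dots> = (\<lambda>f. \<Sum>I\<in>S. defect (\<lambda>q f. a I q * ham (F I) q f) (\<lambda>q vs. a I q * dwedge (F I) q vs) (ham G) (dwedge G) p f)"
      unfolding defect_scale_left[OF FI s tG H(1), symmetric] dec
      by (rule defect_sum_left[OF tG S sec_scale[OF sec_ham[OF F] a]])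
    also have "\<dots> = (\<lambda>f. \<Sum>I\<in>S. a I p * defect (ham (F I)) (dwedge (F I)) (ham G) (dwedge G) p f)"
      by (intro ext sum.cong refl) (simp add: defect_scale_left[OF FI sec_ham[OF F] tG a])
    also have "\<dots> = (\<lambda>f. 0)" by (simp add: exact[OF F G])
    finally show ?thesis .
  qed
  obtain S :: "nat list set" and G b K where S: "finite S" and K: "K \<in> C" "K p = 1"
    and b: "\<And>I. I \<in> S \<Longrightarrow> b I \<in> C" and G: "\<And>I. I \<in> S \<Longrightarrow> length (G I) = n" "\<And>I. I \<in> S \<Longrightarrow> set (G I) \<subseteq> C"
    and dec: "(\<lambda>q vs. K q * \<beta> q vs) = (\<lambda>q vs. \<Sum>I\<in>S. b I q * dwedge (G I) q vs)"
      "(\<lambda>q f. K q * Y q f) = (\<lambda>q f. \<Sum>I\<in>S. b I q * ham (G I) q f)"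
    by (rule sec_decomposition[OF t, of p]) (rule that)
  have "defect X \<alpha> Y \<beta> p = (\<lambda>f. K p * defect X \<alpha> Y \<beta> p f)" using K by simp
  also have "\<dots> = (\<lambda>f. \<Sum>I\<in>S. defect X \<alpha> (\<lambda>q f. b I q * ham (G I) q f) (\<lambda>q vs. b I q * dwedge (G I) q vs) p f)"
    unfolding defect_scale_right[OF s t K(1), symmetric] dec
    by (rule defect_sum_right[OF s S sec_scale[OF sec_ham[OF G] b]])
  also have "\<dots> = (\<lambda>f. \<Sum>I\<in>S. b I p * defect X \<alpha> (ham (G I)) (dwedge (G I)) p f)"
    by (intro ext sum.cong refl) (simp add: defect_scale_right[OF s sec_ham[OF G] b])
  also have "\<dots> = (\<lambda>f. 0)" by (simp add: right_exact[OF G])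
  finally show ?thesis .
qed

theorem graph_closed_iff_nambu: "graph_closed A n \<pi> \<longleftrightarrow> nambu_poisson A n \<pi>"
  unfolding nambu_iff graph_closed_iff
proof
  assume "\<forall>X \<alpha> Y \<beta>. sec X \<alpha> \<longrightarrow> sec Y \<beta> \<longrightarrow> (\<forall>p. defect X \<alpha> Y \<beta> p = (\<lambda>f. 0))"
  then show fundamental_identity unfolding fundamental_identity_iff_defect using sec_ham by blast
next
  assume fundamental_identity
  then show "\<forall>X \<alpha> Y \<beta>. sec X \<alpha> \<longrightarrow> sec Y \<beta> \<longrightarrow> (\<forall>p. defect X \<alpha> Y \<beta> p = (\<lambda>f. 0))"
    using defect_zero by blast
qed

end

theorem theorem3p3:
  fixes V :: "'e::euclidean_space set"
    and A :: "('a::{t2_space,second_countable_topology}, 'e) atlas"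
    and n :: nat
    and \<pi> :: "'a \<Rightarrow> 'a multivector"
  assumes "smooth_manifold V A"
    and "n \<ge> 1"
    and "\<pi> \<in> multivector_fields A (n + 1)"
  shows "graph_closed A n \<pi> \<longleftrightarrow> nambu_poisson A n \<pi>"
proof -
  obtain m where n: "n = Suc m" using assms(2) by (cases n) auto
  have "smooth_frames A"
    by (rule smooth_frames.intro)
      (rule smooth_functions_const, erule (1) smooth_functions_add, erule (1) smooth_functions_mult,
        rule local_frame[OF assms(1)])
  moreover have "smooth_multivector_axioms A m \<pi>"
    by (rule smooth_multivector_axioms.intro) (use assms(3) n in simp)
  ultimately interpret smooth_multivector A m \<pi> by (rule smooth_multivector.intro)
  show ?thesis using graph_closed_iff_nambu by (simp only: n)
qed

end
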